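(* Let $p\ge3$ be an odd integer and $m\ge1$. For any vector $v\in(\mathbb{Z}/p\mathbb{Z})^{2m}$, there exists a $\mathbb{Z}/p\mathbb{Z}$-colored $m$-string virtual tangle diagram $(T,C)$ such that $\partial(T,C)=v$. Moreover, such a diagram can be chosen so that $T$ satisfies the property $\mathrm{P}_2$ when $m=1$, and both properties $\mathrm{P}_2$ and $\mathrm{P}_3$ when $m\ge2$, where $\mathrm{P}_2$: $T$ has at most one virtual crossing; $\mathrm{P}_3$: $T$ can be transformed into a trivial tangle diagram by a finite sequence of moves (a) and (b), each of which interchanges adjacent endpoints of strings on the boundary of the $2$-disk containing $T$.
   Context: An $m$-string virtual tangle diagram $T$ ($m\ge1$) consists of $m$ intervals (strings) properly immersed in a $2$-disk $D^2$ (so there are $2m$ boundary points on $\partial D^2$, and no closed components), whose singularities are only transverse double points. Each double point is designated either a classical crossing (with over/under information) or a virtual crossing (no over/under information). Diagrams are considered up to planar isotopy. An arc of $T$ is a connected component obtained from the diagram by removing all under-crossings (arcs pass through virtual crossings and over-crossings). A $\mathbb{Z}/p\mathbb{Z}$-coloring of $T$ is a map $C:\{\text{arcs of }T\}\to\mathbb{Z}/p\mathbb{Z}$ such that at each classical crossing $C(x)+C(z)=2C(y)$, where $x,z$ are the two under-arcs and $y$ is the over-arc; no condition is imposed at virtual crossings. The pair $(T,C)$ is called a $\mathbb{Z}/p\mathbb{Z}$-colored diagram. Its boundary color vector $\partial(T,C)=(a_1,\dots,a_{2m})\in(\mathbb{Z}/p\mathbb{Z})^{2m}$ lists the colors at the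 $2m$ boundary points in cyclic order along $\partial D^2$ (the choice of the starting endpoint is arbitrary). A trivial tangle diagram is a tangle diagram with no crossings. Moves (a) and (b): if two endpoints adjacent along $\partial D^2$ are such that the strings starting at them cross each other at a crossing immediately next to the boundary (the two initial segments up to this crossing, together with the boundary interval between the endpoints, bound a triangular region whose interior is disjoint from $T$), remove this crossing by interchanging the two endpoints along $\partial D^2$. It is move (a) when the crossing is classical (of either over/under type) and move (b) when the crossing is virtual. *)

theory Defs
  imports "HOL-Analysis.Analysis" "HOL-Number_Theory.Cong"
begin

text \<open>
  The 2-disk is the closed unit disk of the complex plane. The strings of a diagram are numbered
  \<open>0, \<dots>, m - 1\<close> and each is parametrised by \<open>[0, 1]\<close>; the numbering and the directions of the
  strings carry no meaning, and \<open>planar_isotopic\<close> below forgets them.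
  The over/under information of a classical crossing is recorded by putting the parameter place
  of its lower strand into \<open>under_places\<close>.
\<close>

record vdiagram =
  strand :: "nat \<Rightarrow> real \<Rightarrow> complex"
  under_places :: "(nat \<times> real) set"
  virtuals :: "complex set"

abbreviation disk :: "complex set" where
  "disk \<equiv> cball 0 1"

abbreviation bdisk :: "complex set" where
  "bdisk \<equiv> sphere 0 1"

definition places :: "nat \<Rightarrow> (nat \<times> real) set" where
  "places m = {..<m} \<times> {0..1}"

definition ends :: "nat \<Rightarrow> (nat \<times> real) set" where
  "ends m = {..<m} \<times> {0, 1}"

definition pt :: "vdiagram \<Rightarrow> nat \<times> real \<Rightarrow> complex" where
  "pt T a = strand T (fst a) (snd a)"

definition velocity :: "vdiagram \<Rightarrow> nat \<times> real \<Rightarrow> complex" where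
  "velocity T a = vector_derivative (strand T (fst a)) (at (snd a))"

definition crossings :: "nat \<Rightarrow> vdiagram \<Rightarrow> complex set" where
  "crossings m T = {z. \<exists>a\<in>places m. \<exists>b\<in>places m. a \<noteq> b \<and> pt T a = z \<and> pt T b = z}"

text \<open>
  Strings are C1 immersions; derivatives at the ends of \<open>[0, 1]\<close> are two-sided, which is no
  restriction because only the values on \<open>[0, 1]\<close> belong to the diagram. ``Properly''
  means that exactly the ends lie on the boundary circle, and that they meet it transversally.
\<close>

definition properly_immersed :: "nat \<Rightarrow> vdiagram \<Rightarrow> bool" where
  "properly_immersed m T \<longleftrightarrow>
     (\<forall>i<m. strand T i C1_differentiable_on {0..1}) \<and>
     (\<forall>a\<in>places m. velocity T a \<noteq> 0 \<and> pt T a \<in> disk \<and> (pt T a \<in> bdisk \<longleftrightarrow> a \<in> ends m)) \<and>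
     (\<forall>a\<in>ends m. velocity T a \<bullet> pt T a \<noteq> 0)"

definition transverse_double_points :: "nat \<Rightarrow> vdiagram \<Rightarrow> bool" where
  "transverse_double_points m T \<longleftrightarrow>
     finite (crossings m T) \<and> crossings m T \<inter> bdisk = {} \<and>
     (\<forall>z\<in>crossings m T. card {a \<in> places m. pt T a = z} = 2) \<and>
     (\<forall>a\<in>places m. \<forall>b\<in>places m. a \<noteq> b \<and> pt T a = pt T b \<longrightarrow>
        \<not> collinear {0, velocity T a, velocity T b})"

definition crossing_information :: "nat \<Rightarrow> vdiagram \<Rightarrow> bool" where
  "crossing_information m T \<longleftrightarrow>
     virtuals T \<subseteq> crossings m T \<and>
     under_places T \<subseteq> {a \<in> places m. pt T a \<in> crossings m T - virtuals T} \<and>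
     (\<forall>a\<in>places m. \<forall>b\<in>places m. a \<noteq> b \<and> pt T a = pt T b \<and> pt T a \<notin> virtuals T \<longrightarrow>
        (a \<in> under_places T \<longleftrightarrow> b \<notin> under_places T))"

definition virtual_tangle :: "nat \<Rightarrow> vdiagram \<Rightarrow> bool" where
  "virtual_tangle m T \<longleftrightarrow>
     properly_immersed m T \<and> transverse_double_points m T \<and> crossing_information m T"

text \<open>
  Arcs are taken in the parameter space of the strings, not in the plane: the images of
  different arcs may meet at virtual crossings and at over-crossings.
\<close>

definition arcs :: "nat \<Rightarrow> vdiagram \<Rightarrow> (nat \<times> real) set set" where
  "arcs m T = {{i} \<times> J | i J. i < m \<and> J \<in> components ({0..1} - {t. (i, t) \<in> under_places T})}"

text \<open>
  Residue classes modulo \<open>p\<close> are represented by the integers \<open>0, \<dots>, p - 1\<close>. The two under-arcs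
  at a classical crossing are the two arcs having its under-place in their closure (they are always
  different as arcs, since no string is closed); its over-arc contains the other place \<open>b\<close>.
\<close>

definition coloring :: "int \<Rightarrow> nat \<Rightarrow> vdiagram \<Rightarrow> ((nat \<times> real) set \<Rightarrow> int) \<Rightarrow> bool" where
  "coloring p m T C \<longleftrightarrow>
     (\<forall>x\<in>arcs m T. C x \<in> {0..<p}) \<and>
     (\<forall>a\<in>under_places T. \<forall>b\<in>places m. \<forall>x\<in>arcs m T. \<forall>y\<in>arcs m T. \<forall>z\<in>arcs m T.
        a \<noteq> b \<and> pt T a = pt T b \<and> b \<in> y \<and> x \<noteq> z \<and> a \<in> closure x \<and> a \<in> closure z \<longrightarrow>
        [C x + C z = 2 * C y] (mod p))"

definition colored_diagram ::
    "int \<Rightarrow> nat \<Rightarrow> vdiagram \<Rightarrow> ((nat \<times> real) set \<Rightarrow> int) \<Rightarrow> bool" where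
  "colored_diagram p m T C \<longleftrightarrow> virtual_tangle m T \<and> coloring p m T C"

text \<open>
  \<open>v\<close> lists the colors at the ends, counterclockwise from some end. The angles \<open>\<theta> k\<close> of
  the ends, taken in this order, increase and stay within one full turn.
\<close>

definition boundary_colors ::
    "nat \<Rightarrow> vdiagram \<Rightarrow> ((nat \<times> real) set \<Rightarrow> int) \<Rightarrow> int list \<Rightarrow> bool" where
  "boundary_colors m T C v \<longleftrightarrow>
     length v = 2 * m \<and>
     (\<exists>e \<theta>. bij_betw e {..<2 * m} (ends m) \<and> strict_mono_on {..<2 * m} \<theta> \<and>
        (\<forall>k<2 * m. \<theta> k < \<theta> 0 + 2 * pi \<and> pt T (e k) = cis (\<theta> k) \<and>
           (\<exists>x\<in>arcs m T. e k \<in> x \<and> C x = v ! k)))"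

definition trivial_tangle :: "nat \<Rightarrow> vdiagram \<Rightarrow> bool" where
  "trivial_tangle m T \<longleftrightarrow> virtual_tangle m T \<and> crossings m T = {}"

text \<open>
  An ambient isotopy of the disk, and a homeomorphism \<open>f\<close> between the parameter spaces, i.e. a
  permutation of the strings together with reparametrisations, possibly reversing directions.
\<close>

definition planar_isotopic :: "nat \<Rightarrow> vdiagram \<Rightarrow> vdiagram \<Rightarrow> bool" where
  "planar_isotopic m T T' \<longleftrightarrow>
     virtual_tangle m T \<and> virtual_tangle m T' \<and>
     (\<exists>h f g. homotopic_with_canon (\<lambda>k. \<exists>k'. homeomorphism disk disk k k') disk disk id h \<and>
        homeomorphism (places m) (places m) f g \<and>
        (\<forall>a\<in>places m. h (pt T a) = pt T' (f a) \<and>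
           (a \<in> under_places T \<longleftrightarrow> f a \<in> under_places T')) \<and>
        virtuals T' = h ` virtuals T)"

text \<open>
  The strings starting at the ends \<open>(i, \<epsilon>)\<close> and \<open>(j, \<delta>)\<close> cross at \<open>(i, s)\<close> and \<open>(j, t)\<close>, and
  \<open>\<Delta>\<close> is the closed disk bounded by the two initial segments and a boundary interval \<open>\<kappa>\<close> between
  the ends. One string may be responsible for both ends (\<open>i = j\<close>).
\<close>

definition boundary_triangle ::
    "nat \<Rightarrow> vdiagram \<Rightarrow> nat \<times> real \<Rightarrow> real \<Rightarrow> nat \<times> real \<Rightarrow> real \<Rightarrow> complex set \<Rightarrow> bool" where
  "boundary_triangle m T = (\<lambda>(i, \<epsilon>) s (j, \<delta>) t \<Delta>.
     (i, \<epsilon>) \<in> ends m \<and> (j, \<delta>) \<in> ends m \<and> (i, \<epsilon>) \<noteq> (j, \<delta>) \<and>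
     (i, s) \<in> places m \<and> (j, t) \<in> places m \<and> (i, s) \<noteq> (j, t) \<and> pt T (i, s) = pt T (j, t) \<and>
     (strand T i ` closed_segment \<epsilon> s \<union> strand T j ` closed_segment \<delta> t) \<inter> crossings m T
       = {pt T (i, s)} \<and>
     (\<exists>\<kappa>. arc \<kappa> \<and> path_image \<kappa> \<subseteq> bdisk \<and>
        pathstart \<kappa> = pt T (i, \<epsilon>) \<and> pathfinish \<kappa> = pt T (j, \<delta>) \<and>
        (\<forall>a\<in>ends m. pt T a \<in> path_image \<kappa> \<longrightarrow> a \<in> {(i, \<epsilon>), (j, \<delta>)}) \<and>
        \<Delta> \<subseteq> disk \<and> \<Delta> homeomorphic disk \<and>
        frontier \<Delta> = strand T i ` closed_segment \<epsilon> s \<union> strand T j ` closed_segment \<delta> t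
                        \<union> path_image \<kappa>) \<and>
     interior \<Delta> \<inter> pt T ` places m = {})"

text \<open>
  Removal of the crossing \<open>X\<close> next to the boundary by interchanging two adjacent ends.
  Everything happens in a closed disk \<open>N\<close> that contains the triangle \<open>\<Delta>\<close> and meets the diagram
  exactly in the initial segments up to places \<open>(i, s')\<close> and \<open>(j, t')\<close> slightly beyond \<open>X\<close>. In \<open>N\<close>
  these segments are replaced by two disjoint simple curves with the same inner end points and
  interchanged boundary points, which determines the new diagram up to planar isotopy.
\<close>

definition endpoint_move :: "nat \<Rightarrow> complex \<Rightarrow> vdiagram \<Rightarrow> vdiagram \<Rightarrow> bool" where
  "endpoint_move m X T T' \<longleftrightarrow>
     virtual_tangle m T \<and> virtual_tangle m T' \<and>
     (\<exists>i \<epsilon> s s' j \<delta> t t' \<Delta> N S.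
        boundary_triangle m T (i, \<epsilon>) s (j, \<delta>) t \<Delta> \<and> X = pt T (i, s) \<and>
        s' \<in> {0<..<1} \<and> s \<in> open_segment \<epsilon> s' \<and> t' \<in> {0<..<1} \<and> t \<in> open_segment \<delta> t' \<and>
        S = {i} \<times> closed_segment \<epsilon> s' \<union> {j} \<times> closed_segment \<delta> t' \<and>
        \<Delta> \<subseteq> N \<and> N \<subseteq> disk \<and> N homeomorphic disk \<and>
        {a \<in> places m. pt T a \<in> N} = S \<and> {a \<in> places m. pt T' a \<in> N} = S \<and>
        crossings m T \<inter> N = {X} \<and> crossings m T' \<inter> N = {} \<and>
        (\<forall>a \<in> (places m - S) \<union> {(i, s'), (j, t')}. pt T' a = pt T a) \<and>
        pt T' (i, \<epsilon>) = pt T (j, \<delta>) \<and> pt T' (j, \<delta>) = pt T (i, \<epsilon>) \<and>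
        virtuals T' = virtuals T - {X} \<and> under_places T' = under_places T - {(i, s), (j, t)})"

definition move_a :: "nat \<Rightarrow> vdiagram \<Rightarrow> vdiagram \<Rightarrow> bool" where
  "move_a m T T' \<longleftrightarrow> (\<exists>X. X \<notin> virtuals T \<and> endpoint_move m X T T')"

definition move_b :: "nat \<Rightarrow> vdiagram \<Rightarrow> vdiagram \<Rightarrow> bool" where
  "move_b m T T' \<longleftrightarrow> (\<exists>X. X \<in> virtuals T \<and> endpoint_move m X T T')"

definition P2 :: "vdiagram \<Rightarrow> bool" where
  "P2 T \<longleftrightarrow> finite (virtuals T) \<and> card (virtuals T) \<le> 1"

text \<open>Isotopies may be interspersed, since diagrams are considered up to planar isotopy.\<close>

definition P3 :: "nat \<Rightarrow> vdiagram \<Rightarrow> bool" where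
  "P3 m T \<longleftrightarrow>
     (\<exists>T0. (\<lambda>A B. planar_isotopic m A B \<or> move_a m A B \<or> move_b m A B)\<^sup>*\<^sup>* T T0 \<and>
        trivial_tangle m T0)"

end

theory Submission
  imports Defs
begin

text \<open>
  Put a crossing between two neighbouring ends of a colored diagram, right at the boundary. If the
  ends have the colors \<open>x, y\<close>, the new boundary colors are \<open>y, 2 y - x\<close> or \<open>2 x - y, x\<close> when the
  crossing is classical, depending on which string runs over, and \<open>y, x\<close> when it is virtual. The new
  crossing is removed again by one boundary move. So for \<open>m \<ge> 2\<close> it is enough to lead the
  given vector by such replacements, one of them virtual, to a vector \<open>(a, a, b, b, \<dots>)\<close>, which is the
  boundary of a crossingless diagram joining neighbouring ends in pairs.

  On the two differences of three consecutive colors the classical replacements act by adding one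
  difference to the other or subtracting it. By the Euclidean algorithm one of the differences
  becomes \<open>0\<close> (\<open>euclid_on_triples\<close>), while the alternating sum of the three colors does not
  change. Thus neighbouring ends are made equal two by two, from the left, until four ends remain; on
  these the procedure ends with an equal pair and a second pair, which is equal modulo \<open>p\<close> exactly when
  the alternating sum of the four colors is \<open>0\<close> modulo \<open>p\<close>. The virtual crossing serves to reach this
  situation. Bring the four colors to the form \<open>(x, y, y, u)\<close> and twist the left pair and the right
  pair \<open>n = (p - 1) / 2\<close> times so that the two inner colors move apart to a difference \<open>n (u - x)\<close>;
  interchanging them virtually makes the alternating sum \<open>p (x - u)\<close>
  (\<open>realizable_one_virtual_last_four\<close>).

  The geometry is carried by the locale \<open>twist\<close>. The diagrams are kept collared: near the circle
  all strings run along rays, at equally spaced angles. A crossing is added by multiplying each string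
  with \<open>cis\<close> of an angle that depends only on the depth below the circle, is zero except on the two
  strings concerned, and carries each of their rays to the other one. In the coordinates
  \<open>exp (x + i y)\<close> the neighbourhood of the new crossing required by a boundary move is a rectangle, and
  the triangle between the crossing and the circle is convex. The diagrams before and after the move
  agree literally outside this neighbourhood, so the sequence of moves is free of isotopies.

  For \<open>m = 1\<close> the diagram winds twice around the origin like the closed \<open>2\<close>-braid with \<open>p\<close> crossings,
  cut open at an outermost point; its last crossing is virtual. Along the string the under-crossings
  separate \<open>p\<close> arcs, and the over-arc of the crossing between the arcs \<open>k\<close> and \<open>k + 1\<close> is the arc whose
  number \<open>j\<close> satisfies \<open>2 j = 2 k + 1 + p\<close> or \<open>2 j = 2 k + 1 - p\<close>. Therefore every arithmetic progression modulo
  \<open>p\<close> is a coloring, and \<open>a, a + (a - b), \<dots>, a + (p - 1) (a - b)\<close> starts with \<open>a\<close> and ends with \<open>b\<close>.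
\<close>

section \<open>Curves in logarithmic coordinates\<close>

text \<open>
  A step from \<open>1\<close> to \<open>0\<close> on the interval from \<open>0\<close> to \<open>1\<close>, made of two parabolas and two constant pieces. It is
  \<open>C1\<close>, because the square of the positive part is, and it is concave up to the middle of the step; the
  latter makes the region between a crossing and the circle convex.
\<close>

definition fall :: "real \<Rightarrow> real" where
  "fall x = 1 - 2 * (max x 0)^2 + 4 * (max (x - 1/2) 0)^2 - 2 * (max (x - 1) 0)^2"

definition fall' :: "real \<Rightarrow> real" where
  "fall' x = - 4 * max x 0 + 8 * max (x - 1/2) 0 - 4 * max (x - 1) 0"

lemma max_square_derivative:
  "((\<lambda>x::real. (max x 0)^2) has_real_derivative 2 * max x 0) (at x)"
proof (cases "x = 0")
  case True
  have "((\<lambda>h::real. ((max (0 + h) 0)^2 - (max 0 0)^2) / h) \<longlongrightarrow> 0) (at 0)"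
  proof (rule Lim_null_comparison)
    show "eventually (\<lambda>h::real. norm (((max (0 + h) 0)^2 - (max 0 0)^2) / h) \<le> \<bar>h\<bar>) (at 0)"
      by (rule always_eventually) (auto simp: max_def power2_eq_square)
    show "((\<lambda>h::real. \<bar>h\<bar>) \<longlongrightarrow> 0) (at 0)" by (rule tendsto_rabs_zero) (rule tendsto_ident_at)
  qed
  then show ?thesis using True by (simp add: DERIV_def)
next
  case False
  show ?thesis
  proof (cases "x > 0")
    case True
    have "((\<lambda>x::real. x^2) has_real_derivative 2 * max x 0) (at x)"
      using True by (auto intro!: derivative_eq_intros)
    then show ?thesis
      by (rule has_field_derivative_transform_within_open[of _ _ _ "{0<..}"]) (use True in auto)
  next
    case F: False
    have "((\<lambda>x::real. 0) has_real_derivative 2 * max x 0) (at x)"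
      using F by auto
    then show ?thesis
      by (rule has_field_derivative_transform_within_open[of _ _ _ "{..<0}"]) (use F False in auto)
  qed
qed

lemma max_square_derivative' [derivative_intros]:
  assumes "(f has_real_derivative f') (at x)"
  shows "((\<lambda>x. (max (f x) 0)^2) has_real_derivative 2 * max (f x) 0 * f') (at x)"
  using DERIV_chain2[OF max_square_derivative assms] by simp

lemma fall_derivative: "(fall has_real_derivative fall' x) (at x)"
  unfolding fall_def[abs_def] fall'_def by (auto intro!: derivative_eq_intros)

lemma fall_derivative_chain [derivative_intros]:
  assumes "(f has_real_derivative f') (at x within s)"
  shows "((\<lambda>x. fall (f x)) has_real_derivative fall' (f x) * f') (at x within s)"
  using DERIV_chain2[OF fall_derivative assms] by simp

lemma continuous_on_fall' [continuous_intros]: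
  "continuous_on S f \<Longrightarrow> continuous_on S (\<lambda>x. fall' (f x))"
  unfolding fall'_def by (intro continuous_intros)

lemma continuous_on_fall [continuous_intros]:
  "continuous_on S f \<Longrightarrow> continuous_on S (\<lambda>x. fall (f x))"
  unfolding fall_def by (intro continuous_intros)

lemma fall_left: "x \<le> 0 \<Longrightarrow> fall x = 1"
  and fall'_left: "x \<le> 0 \<Longrightarrow> fall' x = 0"
  and fall'_right: "1 \<le> x \<Longrightarrow> fall' x = 0"
  by (auto simp: fall_def fall'_def max_def)

lemma fall_right: "1 \<le> x \<Longrightarrow> fall x = 0"
  by (auto simp: fall_def max_def power2_eq_square algebra_simps)

lemma fall_half: "fall (1/2) = 1/2" and fall'_half: "fall' (1/2) = -2"
  by (auto simp: fall_def fall'_def max_def power2_eq_square)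

lemma fall'_neg: "0 < x \<Longrightarrow> x < 1 \<Longrightarrow> fall' x < 0"
  by (auto simp: fall'_def max_def)

lemma fall_strict_antimono:
  assumes "x < y" "0 < y" "x < 1"
  shows "fall y < fall x"
proof -
  define x' y' where "x' = max x 0" and "y' = min y 1"
  have "fall x' = fall x" unfolding x'_def by (auto simp: max_def fall_left)
  moreover have "fall y' = fall y" unfolding y'_def by (auto simp: min_def fall_right)
  moreover have "fall y' < fall x'"
  proof (rule DERIV_neg_imp_decreasing_open[of x' y' fall])
    show "x' < y'" using assms by (auto simp: x'_def y'_def)
    show "\<And>z. x' < z \<Longrightarrow> z < y' \<Longrightarrow> \<exists>d. (fall has_real_derivative d) (at z) \<and> d < 0"
      using fall'_neg fall_derivative by (auto simp: x'_def y'_def)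
    show "continuous_on {x'..y'} fall" by (rule continuous_on_fall) (rule continuous_on_id)
  qed
  ultimately show ?thesis by simp
qed

lemma fall_antimono: "x \<le> y \<Longrightarrow> fall y \<le> fall x"
  by (cases "x < y \<and> 0 < y \<and> x < 1")
     (auto dest: fall_strict_antimono simp: fall_left fall_right not_less intro: less_imp_le)

lemma fall_nonneg [simp]: "0 \<le> fall x" 
  using fall_antimono[of x "max x 1"] fall_right[of "max x 1"] by auto

lemma fall_le_1 [simp]: "fall x \<le> 1"
  using fall_antimono[of "min x 0" x] fall_left[of "min x 0"] by auto

lemma fall_eq_half_iff: "fall x = 1/2 \<longleftrightarrow> x = 1/2"
proof
  assume h: "fall x = 1/2"
  then have "0 < x" "x < 1" using fall_left[of x] fall_right[of x] by (auto simp: not_less[symmetric] simp del: not_less)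
  then show "x = 1/2"
    using h fall_strict_antimono[of x "1/2"] fall_strict_antimono[of "1/2" x] fall_half
    by (cases x "1/2 :: real" rule: linorder_cases) auto
qed (simp only: fall_half)

lemma fall_concave_first_half: "concave_on {..1/2} fall"
  unfolding concave_on_def
proof (rule convex_on_realI)
  show "((\<lambda>x. - fall x) has_real_derivative - fall' x) (at x)" for x
    by (auto intro!: derivative_eq_intros)
  show "- fall' x \<le> - fall' y" if "x \<in> {..1/2}" "y \<in> {..1/2}" "x \<le> y" for x y
    using that by (auto simp: fall'_def max_def)
qed auto

text \<open>
  All strings below have the form \<open>exp (x + i y)\<close>. Their velocity is \<open>x' + i y'\<close> times the point, so
  immersion, transversality to the circle and transversality of crossings become statements about \<open>x'\<close>
  and \<open>y'\<close>.
\<close>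

lemma polar_derivative:
  assumes "(x has_real_derivative x') (at t within S)" "(y has_real_derivative y') (at t within S)"
  shows "((\<lambda>t. exp (Complex (x t) (y t))) has_vector_derivative
    Complex x' y' * exp (Complex (x t) (y t))) (at t within S)"
  unfolding has_vector_derivative_complex_iff
  using assms by (auto intro!: derivative_eq_intros simp: Re_exp Im_exp algebra_simps)

lemma exp_strip_inj:
  assumes "\<And>z. z \<in> S \<Longrightarrow> \<bar>Im z - y\<bar> < pi"
  shows "inj_on exp S"
proof (rule inj_onI)
  fix z w assume "z \<in> S" "w \<in> S" "exp z = exp w"
  moreover from this have "\<bar>Im z - Im w\<bar> < 2 * pi" using assms[of z] assms[of w] by linarith
  ultimately show "z = w" using exp_complex_eqI by blast
qed

text \<open>
  Invariance of domain lets \<open>exp\<close> carry interior, frontier and the property of being a closed disk from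
  a set in a strip of height \<open>2 \<pi>\<close> to its image.
\<close>

lemma exp_image_interior:
  assumes K: "\<And>z. z \<in> K \<Longrightarrow> \<bar>Im z - y\<bar> < pi"
  shows "interior (exp ` K) = exp ` interior K"
proof
  have inv: "open (exp ` S)" if "open S" "S \<subseteq> {z. \<bar>Im z - y\<bar> < pi}" for S
    by (rule invariance_of_domain)
       (use that in \<open>auto intro!: exp_strip_inj[of _ y] continuous_intros\<close>)
  show "exp ` interior K \<subseteq> interior (exp ` K)"
    by (rule interior_maximal) (use inv[of "interior K"] K interior_subset[of K] in auto)
  define U where "U = {z. \<bar>Im z - y\<bar> < pi}"
  have U: "open U" unfolding U_def by (intro open_Collect_less continuous_intros)
  have inj: "inj_on exp U" unfolding U_def by (rule exp_strip_inj) auto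
  define O' where "O' = U \<inter> exp -` interior (exp ` K)"
  have "open O'" unfolding O'_def
    by (intro open_Int U open_vimage) (auto intro: continuous_intros)
  moreover have "O' \<subseteq> K"
  proof
    fix z assume z: "z \<in> O'"
    then have "exp z \<in> exp ` K" using interior_subset unfolding O'_def by auto
    then obtain w where "w \<in> K" "exp z = exp w" by auto
    then show "z \<in> K" using inj_onD[OF inj, of z w] z K by (auto simp: O'_def U_def)
  qed
  ultimately have "O' \<subseteq> interior K" by (rule interior_maximal[rotated])
  moreover have "interior (exp ` K) \<subseteq> exp ` O'"
  proof
    fix x assume x: "x \<in> interior (exp ` K)"
    then obtain w where "w \<in> K" "x = exp w" using interior_subset by blast
    then show "x \<in> exp ` O'" using x K by (auto simp: O'_def U_def)
  qed
  ultimately show "interior (exp ` K) \<subseteq> exp ` interior K" by (meson image_mono order_trans)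
qed

lemma exp_image_frontier:
  assumes K: "\<And>z. z \<in> K \<Longrightarrow> \<bar>Im z - y\<bar> < pi" and "compact K"
  shows "frontier (exp ` K) = exp ` frontier K"
proof -
  have "compact (exp ` K)" by (rule compact_continuous_image) (use assms in \<open>auto intro: continuous_intros\<close>)
  then have "frontier (exp ` K) = exp ` K - exp ` interior K"
    by (simp add: frontier_def exp_image_interior[OF K] compact_imp_closed closure_closed)
  also have "\<dots> = exp ` (K - interior K)"
    using inj_on_image_set_diff[OF exp_strip_inj[of K y]] K interior_subset[of K] by auto
  finally show ?thesis using assms by (simp add: frontier_def compact_imp_closed closure_closed)
qed

lemma exp_image_homeomorphic_disk:
  assumes K: "\<And>z. z \<in> K \<Longrightarrow> \<bar>Im z - y\<bar> < pi" and "compact K" "convex K" "interior K \<noteq> {}"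
  shows "exp ` K homeomorphic disk"
proof -
  have "K homeomorphic exp ` K"
    by (rule homeomorphic_compact[of _ exp])
       (use assms in \<open>auto intro!: exp_strip_inj[of _ y] continuous_intros\<close>)
  moreover have "K homeomorphic disk"
    by (rule homeomorphic_convex_compact_cball) (use assms in auto)
  ultimately show ?thesis by (metis homeomorphic_sym homeomorphic_trans)
qed

section \<open>Colorings as functions on places\<close>

text \<open>
  A coloring given by the color of each place of a string. Unlike a function on arcs it can be compared
  between diagrams with different arcs, and extended to a longer diagram by changing it on one
  interval.
\<close>

definition place_coloring :: "int \<Rightarrow> nat \<Rightarrow> vdiagram \<Rightarrow> (nat \<times> real \<Rightarrow> int) \<Rightarrow> bool" where
  "place_coloring p m T \<kappa> \<longleftrightarrow>
     (\<forall>i<m. \<forall>s t. 0 \<le> s \<and> s \<le> t \<and> t \<le> 1 \<and> ({i} \<times> {s..t}) \<inter> under_places T = {} \<longrightarrow>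
        \<kappa> (i, s) = \<kappa> (i, t)) \<and>
     (\<forall>i u b s t. (i, u) \<in> under_places T \<and> b \<in> places m \<and> b \<noteq> (i, u) \<and> pt T b = pt T (i, u) \<and>
        0 \<le> s \<and> s < u \<and> u < t \<and> t \<le> 1 \<and> ({i} \<times> {s..t}) \<inter> under_places T = {(i, u)} \<longrightarrow>
        [\<kappa> (i, s) + \<kappa> (i, t) = 2 * \<kappa> b] (mod p))"

text \<open>
  An under-place adherent to an arc is adjacent to it on one side; this identifies the two under-arcs
  at a crossing as the ones just before and just after the under-place.
\<close>

lemma interval_reaches_limit:
  fixes J :: "real set"
  assumes J: "is_interval J" "J \<noteq> {}" and u: "u \<in> closure J" "u \<notin> J"
  shows "(\<exists>s\<in>J. s < u \<and> {s..<u} \<subseteq> J) \<or> (\<exists>t\<in>J. u < t \<and> {u<..t} \<subseteq> J)"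
proof -
  obtain w where w: "w \<in> J" using J by auto
  have near: "\<exists>j\<in>J. \<bar>j - u\<bar> < e" if "e > 0" for e
    using u(1) that by (auto simp: closure_approachable dist_real_def)
  show ?thesis
  proof (cases "w < u")
    case True
    have "r \<in> J" if "r \<in> {w..<u}" for r
    proof -
      have "0 < u - r" using that by simp
      then obtain j where "j \<in> J" "\<bar>j - u\<bar> < u - r" using near by blast
      then show ?thesis using J(1)[unfolded is_interval_1, rule_format, of w j r] w that by auto
    qed
    then show ?thesis using True w by blast
  next
    case False
    with w u have "u < w" by (metis linorder_neqE_linordered_idom)
    have "r \<in> J" if "r \<in> {u<..w}" for r
    proof -
      have "0 < r - u" using that by simp
      then obtain j where "j \<in> J" "\<bar>j - u\<bar> < r - u" using near by blast
      then show ?thesis using J(1)[unfolded is_interval_1, rule_format, of j w r] w that by auto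
    qed
    then show ?thesis using \<open>u < w\<close> w by blast
  qed
qed

lemma arc_through_place:
  assumes "a \<in> places m" "a \<notin> under_places T"
  obtains x where "x \<in> arcs m T" "a \<in> x"
proof -
  obtain i t where a: "a = (i, t)" by force
  let ?S = "{0..1} - {t. (i, t) \<in> under_places T}"
  have "t \<in> ?S" "i < m" using assms a by (auto simp: places_def)
  moreover from this obtain J where "J \<in> components ?S" "t \<in> J"
    using Union_components[of ?S] by blast
  ultimately show ?thesis using that[of "{i} \<times> J"] a unfolding arcs_def by blast
qed

lemma arc_cases:
  assumes "x \<in> arcs m T"
  obtains i J where "i < m" "x = {i} \<times> J" "is_interval J" "J \<noteq> {}"
    "J \<subseteq> {0..1} - {t. (i, t) \<in> under_places T}"
    "J \<in> components ({0..1} - {t. (i, t) \<in> under_places T})"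
proof -
  obtain i J where "i < m" "x = {i} \<times> J" and J: "J \<in> components ({0..1} - {t. (i, t) \<in> under_places T})"
    using assms unfolding arcs_def by blast
  then show ?thesis
    using that[of i J] in_components_nonempty[OF J] in_components_connected[OF J]
      in_components_subset[OF J] by (auto simp: is_interval_connected_1)
qed

lemma arc_avoids_under_places:
  assumes "{i} \<times> J \<in> arcs m T"
  shows "J \<subseteq> {0..1} - {t. (i, t) \<in> under_places T}"
  using assms
proof (cases rule: arc_cases)
  case (1 i' J')
  then have "i' = i \<and> J' = J" by (auto simp: times_eq_iff)
  then show ?thesis using 1 by auto
qed

lemma place_coloring_constant_on_arc:
  assumes \<kappa>: "place_coloring p m T \<kappa>" and x: "x \<in> arcs m T" and ab: "a \<in> x" "b \<in> x"
  shows "\<kappa> a = \<kappa> b"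
  using x
proof (cases rule: arc_cases)
  case (1 i J)
  obtain s t where st: "a = (i, s)" "b = (i, t)" "s \<in> J" "t \<in> J" using 1 ab by auto
  have const: "\<kappa> (i, s) = \<kappa> (i, t)" if "s \<in> J" "t \<in> J" "s \<le> t" for s t
  proof -
    have "{s..t} \<subseteq> J" using 1(3) that unfolding is_interval_1 by (meson atLeastAtMost_iff subsetI)
    then have "({i} \<times> {s..t}) \<inter> under_places T = {}" "0 \<le> s" "t \<le> 1" using 1(5) that by auto
    then show ?thesis using \<kappa> 1(1) that unfolding place_coloring_def by blast
  qed
  show ?thesis using const[of s t] const[of t s, symmetric] st
    by (metis linear)
qed

text \<open>
  Two different arcs adherent to the same under-place lie on its two sides, since on one side they would
  overlap. So the values of the place coloring slightly before and slightly after the under-place are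
  the colors of the two under-arcs.
\<close>

lemma coloring_from_places:
  assumes \<kappa>: "place_coloring p m T \<kappa>" and p: "p > 0"
  obtains C where "coloring p m T C"
    "\<And>a x. x \<in> arcs m T \<Longrightarrow> a \<in> x \<Longrightarrow> C x = \<kappa> a mod p"
proof
  define C where "C x = \<kappa> (SOME a. a \<in> x) mod p" for x
  show C: "C x = \<kappa> a mod p" if "x \<in> arcs m T" "a \<in> x" for a x
    unfolding C_def using place_coloring_constant_on_arc[OF \<kappa> that(1) that(2) someI[of "\<lambda>a. a \<in> x", OF that(2)]]
    by simp
  have main: "[C x + C z = 2 * C y] (mod p)"
    if "(i, u) \<in> under_places T" "b \<in> places m" and x: "x = {i} \<times> J" "x \<in> arcs m T"
      and z: "z = {i} \<times> J'" "z \<in> arcs m T" and y: "y \<in> arcs m T" "b \<in> y"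
      and b: "(i, u) \<noteq> b" "pt T (i, u) = pt T b"
      and s: "s \<in> J" "s < u" "{s..<u} \<subseteq> J" and t: "t \<in> J'" "u < t" "{u<..t} \<subseteq> J'" for i u b x y z J J' s t
  proof -
    have J: "J \<subseteq> {0..1} - {t. (i, t) \<in> under_places T}" "J' \<subseteq> {0..1} - {t. (i, t) \<in> under_places T}"
      using arc_avoids_under_places[of i _ m T] x z s t by auto
    have "({i} \<times> {s..t}) \<inter> under_places T = {(i, u)}"
    proof -
      have "{s..t} = {s..<u} \<union> {u} \<union> {u<..t}" using s(2) t(2) by auto
      then show ?thesis using s(3) t(3) J that(1) by auto
    qed
    moreover have "0 \<le> s" "t \<le> 1" using J s(1) t(1) by auto
    ultimately have "[\<kappa> (i, s) + \<kappa> (i, t) = 2 * \<kappa> b] (mod p)"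
      using \<kappa>[unfolded place_coloring_def, THEN conjunct2, rule_format, of i u b s t] that by auto
    moreover have "C x = \<kappa> (i, s) mod p" "C z = \<kappa> (i, t) mod p" "C y = \<kappa> b mod p"
      using C x z y s t by auto
    ultimately show ?thesis by (simp add: cong_def mod_simps)
  qed
  show "coloring p m T C"
    unfolding coloring_def
  proof (intro conjI ballI impI)
    show "C x \<in> {0..<p}" for x using p by (simp add: C_def)
    fix a b x y z
    assume a: "a \<in> under_places T" and b: "b \<in> places m"
      and arcs: "x \<in> arcs m T" "y \<in> arcs m T" "z \<in> arcs m T"
      and h: "a \<noteq> b \<and> pt T a = pt T b \<and> b \<in> y \<and> x \<noteq> z \<and> a \<in> closure x \<and> a \<in> closure z"
    obtain i u where iu: "a = (i, u)" by force
    obtain J where J: "x = {i} \<times> J" "is_interval J" "J \<noteq> {}" "u \<in> closure J" "u \<notin> J"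
        "J \<in> components ({0..1} - {t. (i, t) \<in> under_places T})"
      using arcs(1) by (cases rule: arc_cases) (use h a iu in \<open>auto simp: closure_Times\<close>)
    obtain J' where J': "z = {i} \<times> J'" "is_interval J'" "J' \<noteq> {}" "u \<in> closure J'" "u \<notin> J'"
        "J' \<in> components ({0..1} - {t. (i, t) \<in> under_places T})"
      using arcs(3) by (cases rule: arc_cases) (use h a iu in \<open>auto simp: closure_Times\<close>)
    have disj: "r \<notin> J \<or> r \<notin> J'" for r
      using components_nonoverlap[OF J(6) J'(6)] h J(1) J'(1) by auto
    consider (left_right) s t where "s \<in> J" "s < u" "{s..<u} \<subseteq> J" "t \<in> J'" "u < t" "{u<..t} \<subseteq> J'"
      | (right_left) s t where "s \<in> J'" "s < u" "{s..<u} \<subseteq> J'" "t \<in> J" "u < t" "{u<..t} \<subseteq> J"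
      | (left_left) s t where "s < u" "{s..<u} \<subseteq> J" "t < u" "{t..<u} \<subseteq> J'"
      | (right_right) s t where "u < s" "{u<..s} \<subseteq> J" "u < t" "{u<..t} \<subseteq> J'"
      using interval_reaches_limit[OF J(2-5)] interval_reaches_limit[OF J'(2-5)] by blast
    then show "[C x + C z = 2 * C y] (mod p)"
    proof cases
      case left_right
      show ?thesis
        by (rule main[of i u b x J z J' y s t]) (use a b arcs h J(1) J'(1) iu left_right in auto)
    next
      case right_left
      have "[C z + C x = 2 * C y] (mod p)"
        by (rule main[of i u b z J' x J y s t]) (use a b arcs h J(1) J'(1) iu right_left in auto)
      then show ?thesis by (simp add: add.commute)
    next
      case left_left
      \<comment> \<open>Both arcs reach the under-place from the same side, hence they share a place.\<close>
      then have "max s t \<in> J" "max s t \<in> J'" by auto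
      then show ?thesis using disj by blast
    next
      case right_right
      then have "min s t \<in> J" "min s t \<in> J'" by auto
      then show ?thesis using disj by blast
    qed
  qed
qed

section \<open>Adding a crossing next to the boundary\<close>

text \<open>
  The place at depth \<open>u\<close> on the string that starts at the end \<open>a\<close>. Both ends of a string are treated alike in
  this way.
\<close>

definition inward :: "nat \<times> real \<Rightarrow> real \<Rightarrow> nat \<times> real" where
  "inward a u = (fst a, snd a + (1 - 2 * snd a) * u)"

lemma inward_0: "inward (i, 0) u = (i, u)" and inward_1: "inward (i, 1) u = (i, 1 - u)"
  by (auto simp: inward_def)

lemma inward_inj:
  assumes "a \<in> ends m" "b \<in> ends m" "0 \<le> u" "u < 1/2" "0 \<le> u'" "u' < 1/2" "inward a u = inward b u'"
  shows "a = b" "u = u'"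
  using assms by (auto simp: ends_def inward_def)

lemma inward_places: "a \<in> ends m \<Longrightarrow> 0 \<le> u \<Longrightarrow> u \<le> 1 \<Longrightarrow> inward a u \<in> places m"
  by (auto simp: ends_def inward_def places_def)

lemma exp_Complex_cis: "exp (Complex x y) * cis w = exp (Complex x (y + w))"
  by (simp add: exp_eq_polar cis_mult mult.assoc)

text \<open>
  Down to depth \<open>\<tau>\<close> each string is the ray at its angle, and everything else of the diagram lies deeper.
  The formula is demanded for negative \<open>u\<close> as well, so that the two-sided derivative at an end is the
  radial one.
\<close>

definition collared :: "nat \<Rightarrow> vdiagram \<Rightarrow> (nat \<Rightarrow> nat \<times> real) \<Rightarrow> real \<Rightarrow> bool" where
  "collared m T e \<tau> \<longleftrightarrow>
     virtual_tangle m T \<and> 0 < \<tau> \<and> \<tau> < 1/2 \<and> bij_betw e {..<2 * m} (ends m) \<and>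
     (\<forall>k<2 * m. \<forall>u\<le>\<tau>. pt T (inward (e k) u) = exp (Complex (- u) (pi / m * k))) \<and>
     (\<forall>a\<in>places m. (\<exists>k<2 * m. \<exists>u\<in>{0..\<tau>}. a = inward (e k) u) \<or> norm (pt T a) < exp (- \<tau>))"

lemma has_velocity:
  assumes "properly_immersed m T" "(i, t) \<in> places m"
  shows "(strand T i has_vector_derivative velocity T (i, t)) (at t)"
proof -
  have "strand T i C1_differentiable_on {0..1}" using assms by (auto simp: properly_immersed_def places_def)
  then show ?thesis using assms(2)
    by (auto simp: C1_differentiable_on_eq velocity_def places_def vector_derivative_works)
qed

text \<open>
  A collared diagram and the data of a new crossing between the ends number \<open>k\<close> and \<open>k + 1\<close>: \<open>U\<close> holds the
  new under-place, \<open>V\<close> the new virtual crossing. The crossing will sit half-way between the two rays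
  and at three quarters of the depth of the collar.
\<close>

locale twist =
  fixes m :: nat and T :: vdiagram and e :: "nat \<Rightarrow> nat \<times> real" and \<tau> :: real and k :: nat
    and U :: "(nat \<times> real) set" and V :: "complex set"
  assumes collared: "collared m T e \<tau>" and k: "Suc k < 2 * m"
    and UV: "(U, V) \<in> {({inward (e k) (3 * \<tau> / 4)}, {}), ({inward (e (Suc k)) (3 * \<tau> / 4)}, {}),
       ({}, {exp (Complex (- (3 * \<tau> / 4)) (pi / m * (k + 1/2)))})}"
begin

definition gap :: real where "gap = pi / m"

definition X :: complex where "X = exp (Complex (- (3 * \<tau> / 4)) (gap * (k + 1/2)))"

definition rot :: "nat \<times> real \<Rightarrow> real" where
  "rot b = (if b = e k then 1 else if b = e (Suc k) then - 1 else 0)"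

text \<open>
  The angle by which the place \<open>(i, t)\<close> is turned. It is zero below the collar, and constant on its upper
  half, so that the turned diagram again has a collar, of depth \<open>\<tau> / 2\<close>.
\<close>

definition turn :: "nat \<Rightarrow> real \<Rightarrow> real" where
  "turn i t = gap * (rot (i, 0) * fall (2 * t / \<tau> - 1) + rot (i, 1) * fall (2 * (1 - t) / \<tau> - 1))"

definition turn' :: "nat \<Rightarrow> real \<Rightarrow> real" where
  "turn' i t = gap * (2 / \<tau>) *
     (rot (i, 0) * fall' (2 * t / \<tau> - 1) - rot (i, 1) * fall' (2 * (1 - t) / \<tau> - 1))"

definition T' :: vdiagram where
  "T' = \<lparr>strand = \<lambda>i t. strand T i t * cis (turn i t),
     under_places = under_places T \<union> U, virtuals = virtuals T \<union> V\<rparr>"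

definition P :: "nat \<times> real" where "P = inward (e k) (3 * \<tau> / 4)"

definition Q :: "nat \<times> real" where "Q = inward (e (Suc k)) (3 * \<tau> / 4)"

lemma m: "m \<ge> 1" and gap: "0 < gap" "gap * (2 * m) = 2 * pi" "gap \<le> pi"
  using k by (auto simp: gap_def field_simps)

lemma tau: "0 < \<tau>" "\<tau> < 1/2" and e: "bij_betw e {..<2 * m} (ends m)"
  and tangle: "virtual_tangle m T"
  and collar: "j < 2 * m \<Longrightarrow> u \<le> \<tau> \<Longrightarrow> pt T (inward (e j) u) = exp (Complex (- u) (gap * j))"
  and collar_or_core: "a \<in> places m \<Longrightarrow>
    (\<exists>j<2 * m. \<exists>u\<in>{0..\<tau>}. a = inward (e j) u) \<or> norm (pt T a) < exp (- \<tau>)"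
  using collared by (auto simp: collared_def gap_def)

lemma e_ends: "j < 2 * m \<Longrightarrow> e j \<in> ends m"
  using e by (auto dest: bij_betwE)

lemma e_inj: "i < 2 * m \<Longrightarrow> j < 2 * m \<Longrightarrow> e i = e j \<longleftrightarrow> i = j"
  using e by (auto simp: bij_betw_def inj_on_def)

lemma e_surj: "a \<in> ends m \<Longrightarrow> \<exists>j<2 * m. a = e j"
  using e by (auto simp: bij_betw_def)

lemma rot_e: "j < 2 * m \<Longrightarrow> rot (e j) = (if j = k then 1 else if j = Suc k then - 1 else 0)"
  using k by (auto simp: rot_def e_inj)

lemma lev_0: "\<tau> \<le> u \<Longrightarrow> fall (2 * u / \<tau> - 1) = 0 \<and> fall' (2 * u / \<tau> - 1) = 0"
  using tau by (auto intro!: fall_right fall'_right simp: field_simps)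

lemma pt_T': "pt T' a = pt T a * cis (turn (fst a) (snd a))"
  by (simp add: pt_def T'_def)

lemma norm_pt_T': "norm (pt T' a) = norm (pt T a)"
  by (simp add: pt_T' norm_mult)

lemma turn_collar:
  assumes "j < 2 * m" "u \<le> \<tau>" "inward (e j) u = (i, t)"
  shows "turn i t = gap * (rot (e j) * fall (2 * u / \<tau> - 1))"
    and "turn' i t = (1 - 2 * snd (e j)) * (gap * (2 / \<tau>) * (rot (e j) * fall' (2 * u / \<tau> - 1)))"
proof -
  have "\<tau> \<le> 1 - u" using assms tau by linarith
  note * = lev_0[OF this]
  have "e j \<in> ends m" using assms e_ends by auto
  then show "turn i t = gap * (rot (e j) * fall (2 * u / \<tau> - 1))"
     "turn' i t = (1 - 2 * snd (e j)) * (gap * (2 / \<tau>) * (rot (e j) * fall' (2 * u / \<tau> - 1)))"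
    using assms(3) * by (cases "e j"; auto simp: ends_def inward_def turn_def turn'_def)+
qed

lemma pt_collar:
  assumes "j < 2 * m" "u \<le> \<tau>"
  shows "pt T' (inward (e j) u) = exp (Complex (- u) (gap * (j + rot (e j) * fall (2 * u / \<tau> - 1))))"
proof -
  obtain i t where it: "inward (e j) u = (i, t)" by force
  show ?thesis using turn_collar(1)[OF assms it] collar[OF assms]
    unfolding pt_T' by (simp add: it exp_Complex_cis algebra_simps)
qed

lemma core_cases:
  assumes "(i, t) \<in> places m" "norm (pt T (i, t)) < exp (- \<tau>)"
  shows "\<tau> < t" "t < 1 - \<tau>"
proof -
  have "i < m" "0 \<le> t" "t \<le> 1" using assms(1) by (auto simp: places_def)
  then obtain j j' where j: "j < 2 * m" "(i, 0) = e j" "j' < 2 * m" "(i, 1) = e j'"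
    using e_surj[of "(i, 0)"] e_surj[of "(i, 1)"] by (auto simp: ends_def)
  show "\<tau> < t"
  proof (rule ccontr)
    assume "\<not> \<tau> < t"
    then show False using collar[OF j(1), of t] assms(2) by (simp add: j(2)[symmetric] inward_0)
  qed
  show "t < 1 - \<tau>"
  proof (rule ccontr)
    assume "\<not> t < 1 - \<tau>"
    then show False using collar[OF j(3), of "1 - t"] assms(2) by (simp add: j(4)[symmetric] inward_1)
  qed
qed

lemma core_turn:
  assumes "a \<in> places m" "norm (pt T a) < exp (- \<tau>)"
  shows "turn (fst a) (snd a) = 0" "turn' (fst a) (snd a) = 0"
  using core_cases[of "fst a" "snd a"] assms lev_0[of "snd a"] lev_0[of "1 - snd a"]
  by (auto simp: turn_def turn'_def)

lemma pt_core: "a \<in> places m \<Longrightarrow> norm (pt T a) < exp (- \<tau>) \<Longrightarrow> pt T' a = pt T a"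
  by (simp add: pt_T' core_turn)

lemma strand_T'_derivative:
  assumes "(i, t) \<in> places m"
  shows "(strand T' i has_vector_derivative
     (velocity T (i, t) + \<i> * turn' i t * pt T (i, t)) * cis (turn i t)) (at t)"
proof -
  have *: "(turn i has_real_derivative turn' i t) (at t)" for i t
    unfolding turn_def[abs_def] turn'_def using tau
    by (auto intro!: derivative_eq_intros simp: field_simps)
  have "((\<lambda>t. exp (Complex 0 (turn i t))) has_vector_derivative
      Complex 0 (turn' i t) * exp (Complex 0 (turn i t))) (at t)"
    by (intro polar_derivative *) simp
  moreover have "exp (Complex 0 y) = cis y" "Complex 0 y = \<i> * y" for y
    by (auto simp: exp_eq_polar complex_eq_iff)
  ultimately have "((\<lambda>t. cis (turn i t)) has_vector_derivative \<i> * turn' i t * cis (turn i t)) (at t)"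
    by simp
  from has_vector_derivative_mult[OF has_velocity[OF _ assms, of T] this] show ?thesis
    using tangle by (simp add: T'_def virtual_tangle_def pt_def algebra_simps)
qed

lemma velocity_T':
  "(i, t) \<in> places m \<Longrightarrow>
   velocity T' (i, t) = (velocity T (i, t) + \<i> * turn' i t * pt T (i, t)) * cis (turn i t)"
  using vector_derivative_at[OF strand_T'_derivative] by (simp add: velocity_def)

lemma velocity_core:
  "a \<in> places m \<Longrightarrow> norm (pt T a) < exp (- \<tau>) \<Longrightarrow> velocity T' a = velocity T a"
  using core_turn[of a] by (cases a) (simp add: velocity_T')

text \<open>
  The string is known to agree with a ray only on one side of depth \<open>\<tau>\<close>; since it is differentiable, its
  derivative there is the one-sided one.
\<close>

lemma velocity_T_collar:
  assumes j: "j < 2 * m" and u: "0 \<le> u" "u \<le> \<tau>"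
  shows "velocity T (inward (e j) u) = - of_real (1 - 2 * snd (e j)) * pt T (inward (e j) u)"
proof -
  define i where "i = fst (e j)"
  define y where "y = gap * j"
  have place: "inward (e j) u \<in> places m" using e_ends[OF j] u tau inward_places by auto
  have imm: "properly_immersed m T" using tangle by (simp add: virtual_tangle_def)
  have unique: "velocity T (i, t) = D" if "(i, t) \<in> places m" "t \<in> {a..b}" "a < b"
      "\<And>x. x \<in> {a..b} \<Longrightarrow> strand T i x = f x" "(f has_vector_derivative D) (at t within {a..b})"
    for t a b f D
  proof (rule vector_derivative_unique_within_closed_interval[of a b t "strand T i"])
    show "(strand T i has_vector_derivative velocity T (i, t)) (at t within cbox a b)"
      using has_velocity[OF imm that(1)] has_vector_derivative_at_within by blast
    show "(strand T i has_vector_derivative D) (at t within cbox a b)"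
      by (rule has_vector_derivative_transform[OF _ _ that(5)[folded cbox_interval]])
         (use that in auto)
  qed (use that in auto)
  have "e j = (i, 0) \<or> e j = (i, 1)" using e_ends[OF j] by (auto simp: i_def ends_def)
  then show ?thesis
  proof
    assume ej: "e j = (i, 0)"
    have "strand T i x = exp (Complex (- x) y)" if "x \<in> {u - 1..u}" for x
      using collar[OF j, of x] that u by (simp add: ej inward_0 pt_def y_def)
    moreover have "((\<lambda>x. exp (Complex (- x) y)) has_vector_derivative
        Complex (- 1) 0 * exp (Complex (- u) y)) (at u within {u - 1..u})"
      by (intro polar_derivative) (auto intro!: derivative_eq_intros)
    ultimately have "velocity T (i, u) = Complex (- 1) 0 * exp (Complex (- u) y)"
      by (intro unique[of u "u - 1" u]) (use place in \<open>auto simp: ej inward_0\<close>)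
    then show ?thesis using collar[OF j u(2)] by (simp add: ej inward_0 y_def Complex_eq)
  next
    assume ej: "e j = (i, 1)"
    have "strand T i x = exp (Complex (x - 1) y)" if "x \<in> {1 - u..2 - u}" for x
      using collar[OF j, of "1 - x"] that u by (simp add: ej inward_1 pt_def y_def)
    moreover have "((\<lambda>x. exp (Complex (x - 1) y)) has_vector_derivative
        Complex 1 0 * exp (Complex (1 - u - 1) y)) (at (1 - u) within {1 - u..2 - u})"
      by (intro polar_derivative) (auto intro!: derivative_eq_intros)
    ultimately have "velocity T (i, 1 - u) = Complex 1 0 * exp (Complex (1 - u - 1) y)"
      by (intro unique[of "1 - u" "1 - u" "2 - u"]) (use place in \<open>auto simp: ej inward_1\<close>)
    then show ?thesis using collar[OF j u(2)] by (simp add: ej inward_1 y_def Complex_eq)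
  qed
qed

lemma velocity_collar:
  assumes j: "j < 2 * m" and u: "0 \<le> u" "u \<le> \<tau>"
  shows "velocity T' (inward (e j) u) = of_real (1 - 2 * snd (e j)) *
    Complex (- 1) (gap * (2 / \<tau>) * (rot (e j) * fall' (2 * u / \<tau> - 1))) * pt T' (inward (e j) u)"
proof -
  obtain i t where it: "inward (e j) u = (i, t)" by force
  have place: "inward (e j) u \<in> places m" using e_ends[OF j] u tau inward_places by auto
  define \<rho> where "\<rho> = gap * (2 / \<tau>) * (rot (e j) * fall' (2 * u / \<tau> - 1))"
  define \<sigma> where "\<sigma> = 1 - 2 * snd (e j)"
  have "velocity T (i, t) = - of_real \<sigma> * pt T (i, t)" "turn' i t = \<sigma> * \<rho>"
    using velocity_T_collar[OF assms] turn_collar(2)[OF j u(2) it] by (auto simp: it \<sigma>_def \<rho>_def)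
  then have "velocity T' (i, t) = of_real \<sigma> * Complex (- 1) \<rho> * pt T' (i, t)"
    using velocity_T'[of i t] place by (simp add: it pt_T' Complex_eq algebra_simps)
  then show ?thesis by (simp only: it \<sigma>_def \<rho>_def)
qed

lemma collar_norm: "j < 2 * m \<Longrightarrow> u \<le> \<tau> \<Longrightarrow> norm (pt T (inward (e j) u)) = exp (- u)"
  by (simp add: collar)

lemma PQ: "P \<in> places m" "Q \<in> places m" "P \<noteq> Q"
  "norm (pt T P) = exp (- (3 * \<tau> / 4))" "norm (pt T Q) = exp (- (3 * \<tau> / 4))"
  using inward_places[of _ m "3 * \<tau> / 4"] e_ends[of k] e_ends[of "Suc k"] k tau
    inward_inj(1)[of "e k" m "e (Suc k)" "3 * \<tau> / 4" "3 * \<tau> / 4"] e_inj[of k "Suc k"]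
    collar_norm[of k "3 * \<tau> / 4"] collar_norm[of "Suc k" "3 * \<tau> / 4"]
  by (auto simp: P_def Q_def)

lemma pt_PQ: "pt T' P = X" "pt T' Q = X"
  using pt_collar[of k "3 * \<tau> / 4"] pt_collar[of "Suc k" "3 * \<tau> / 4"] k tau fall_half
  by (auto simp: P_def Q_def X_def rot_e algebra_simps)

text \<open>
  The angles of all turned strings stay between the first and the last ray, hence within less than one
  full turn.
\<close>

lemma polar_inj:
  fixes x x' y y' :: real
  assumes y: "0 \<le> y" "y \<le> 2 * m - 1" and y': "0 \<le> y'" "y' \<le> 2 * m - 1"
    and eq: "exp (Complex x (gap * y)) = exp (Complex x' (gap * y'))"
  shows "x = x'" "y = y'"
proof -
  have "\<bar>y - y'\<bar> < 2 * m" using y y' m by linarith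
  then have "gap * \<bar>y - y'\<bar> < gap * (2 * m)" using gap(1) by (intro mult_strict_left_mono) auto
  then have "\<bar>gap * y - gap * y'\<bar> < 2 * pi"
    unfolding gap(2) using gap(1) by (simp only: right_diff_distrib[symmetric] abs_mult abs_of_pos)
  then have "\<bar>Im (Complex x (gap * y)) - Im (Complex x' (gap * y'))\<bar> < 2 * pi" by simp
  from exp_complex_eqI[OF this eq] show "x = x'" "y = y'" using gap by auto
qed

lemma same_point_T:
  assumes ab: "a \<in> places m" "b \<in> places m" "a \<noteq> b" "pt T a = pt T b"
  shows "norm (pt T a) < exp (- \<tau>)"
proof (rule ccontr)
  assume n: "\<not> norm (pt T a) < exp (- \<tau>)"
  then obtain j u where j: "j < 2 * m" "u \<in> {0..\<tau>}" "a = inward (e j) u" using collar_or_core[OF ab(1)] by auto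
  obtain j' u' where j': "j' < 2 * m" "u' \<in> {0..\<tau>}" "b = inward (e j') u'"
    using collar_or_core[OF ab(2)] n ab(4) by auto
  have "u = u' \<and> real j = j'"
    using polar_inj[of j j' "- u" "- u'"] j j' collar ab(4) m by auto
  then show False using ab(3) j j' by auto
qed

lemma sector:
  assumes "j < 2 * m"
  shows "0 \<le> j + rot (e j) * fall x" "j + rot (e j) * fall x \<le> 2 * m - 1"
  using assms k fall_nonneg[of x] fall_le_1[of x] by (auto simp: rot_e simp del: fall_nonneg fall_le_1)

text \<open>
  Turning preserves the distance from the origin. Below the collar nothing changes, and in the collar
  two strings at the same depth can only meet if they are the two turned ones, at the depth where both
  are half-way.
\<close>

lemma same_point_T':
  assumes ab: "a \<in> places m" "b \<in> places m" "a \<noteq> b" "pt T' a = pt T' b"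
  shows "(norm (pt T a) < exp (- \<tau>) \<and> pt T a = pt T b) \<or> (a = P \<and> b = Q) \<or> (a = Q \<and> b = P)"
proof (cases "norm (pt T a) < exp (- \<tau>)")
  case True
  then show ?thesis using ab pt_core[of a] pt_core[of b] norm_pt_T'[of a] norm_pt_T'[of b] by metis
next
  case n: False
  then obtain j u where j: "j < 2 * m" "u \<in> {0..\<tau>}" "a = inward (e j) u" using collar_or_core[OF ab(1)] by auto
  have "\<not> norm (pt T b) < exp (- \<tau>)" using n ab(4) norm_pt_T'[of a] norm_pt_T'[of b] by metis
  then obtain j' u' where j': "j' < 2 * m" "u' \<in> {0..\<tau>}" "b = inward (e j') u'"
    using collar_or_core[OF ab(2)] by auto
  define f where "f x = fall (2 * x / \<tau> - 1)" for x
  have eq: "u = u'" "real j + rot (e j) * f u = real j' + rot (e j') * f u'"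
    using polar_inj[of "j + rot (e j) * f u" "j' + rot (e j') * f u'" "- u" "- u'"] j j' sector
      pt_collar[of j u] pt_collar[of j' u'] ab(4) by (auto simp: f_def)
  have "j \<noteq> j'" using eq(1) ab(3) j j' by auto
  have f01: "0 \<le> f u" "f u \<le> 1" by (auto simp: f_def)
  \<comment> \<open>Ends other than the two turned ones stay on their ray, and the two turned ones stay between
    their rays.\<close>
  have "j = k \<and> j' = Suc k \<or> j = Suc k \<and> j' = k"
  proof (rule ccontr)
    assume n: "\<not> ?thesis"
    show False
      using eq(2) f01 n \<open>j \<noteq> j'\<close> unfolding eq(1)[symmetric] rot_e[OF j(1)] rot_e[OF j'(1)]
      by (auto split: if_splits)
  qed
  moreover from this have "f u = 1/2"
    using eq(2) unfolding eq(1)[symmetric] rot_e[OF j(1)] rot_e[OF j'(1)] by auto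
  ultimately have half: "f u = 1/2" "j = k \<and> j' = Suc k \<or> j = Suc k \<and> j' = k" by auto
  then have "2 * u / \<tau> - 1 = 1/2" unfolding f_def fall_eq_half_iff by blast
  then have "u = 3 * \<tau> / 4" using tau by (simp add: field_simps)
  then have "a = inward (e j) (3 * \<tau> / 4)" "b = inward (e j') (3 * \<tau> / 4)"
    using j(3) j'(3) eq(1) by metis+
  then show ?thesis using half(2) unfolding P_def Q_def by blast
qed

lemma X_new: "X \<notin> crossings m T" "norm X = exp (- (3 * \<tau> / 4))" "exp (- \<tau>) < exp (- (3 * \<tau> / 4))"
proof -
  show X: "norm X = exp (- (3 * \<tau> / 4))" "exp (- \<tau>) < exp (- (3 * \<tau> / 4))" using tau by (auto simp: X_def)
  show "X \<notin> crossings m T"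
  proof
    assume "X \<in> crossings m T"
    then obtain a b where "a \<in> places m" "b \<in> places m" "a \<noteq> b" "pt T a = X" "pt T b = X"
      by (auto simp: crossings_def)
    then show False using same_point_T[of a b] X by simp
  qed
qed

lemma crossings_norm: "z \<in> crossings m T \<Longrightarrow> norm z < exp (- \<tau>)"
  using same_point_T by (fastforce simp: crossings_def)

lemma crossings_T': "crossings m T' = insert X (crossings m T)"
proof
  show "crossings m T' \<subseteq> insert X (crossings m T)"
  proof
    fix z assume "z \<in> crossings m T'"
    then obtain a b where ab: "a \<in> places m" "b \<in> places m" "a \<noteq> b" "pt T' a = z" "pt T' b = z"
      by (auto simp: crossings_def)
    then have "pt T' a = pt T' b" by simp
    from same_point_T'[OF ab(1-3) this] show "z \<in> insert X (crossings m T)"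
    proof (elim disjE)
      assume n: "norm (pt T a) < exp (- \<tau>) \<and> pt T a = pt T b"
      then have "pt T a = z" "pt T b = z" using ab pt_core[of a] by auto
      then show ?thesis using ab(1-3) unfolding crossings_def by blast
    qed (use ab pt_PQ in auto)
  qed
  show "insert X (crossings m T) \<subseteq> crossings m T'"
  proof
    fix z assume "z \<in> insert X (crossings m T)"
    then show "z \<in> crossings m T'"
    proof
      assume "z = X"
      then show ?thesis using PQ pt_PQ unfolding crossings_def by blast
    next
      assume "z \<in> crossings m T"
      then obtain a b where ab: "a \<in> places m" "b \<in> places m" "a \<noteq> b" "pt T a = z" "pt T b = z"
        by (auto simp: crossings_def)
      then have "pt T' a = z" "pt T' b = z" using same_point_T[of a b] pt_core[of a] pt_core[of b] by auto
      then show ?thesis using ab unfolding crossings_def by blast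
    qed
  qed
qed

lemma preimage_T':
  assumes "z \<in> crossings m T"
  shows "{a \<in> places m. pt T' a = z} = {a \<in> places m. pt T a = z}"
  using crossings_norm[OF assms] pt_core norm_pt_T' by auto

lemma preimage_X: "{a \<in> places m. pt T' a = X} = {P, Q}"
proof
  show "{a \<in> places m. pt T' a = X} \<subseteq> {P, Q}"
  proof
    fix a assume a: "a \<in> {a \<in> places m. pt T' a = X}"
    show "a \<in> {P, Q}"
    proof (rule ccontr)
      assume "a \<notin> {P, Q}"
      then have "norm (pt T a) < exp (- \<tau>)" using same_point_T'[of a P] a PQ pt_PQ by auto
      moreover have "norm (pt T a) = exp (- (3 * \<tau> / 4))" using X_new(2) norm_pt_T'[of a] a by simp
      ultimately show False using X_new(3) by linarith
    qed
  qed
qed (use PQ pt_PQ in auto)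

lemma properly_immersed_T': "properly_immersed m T'"
proof -
  have imm: "properly_immersed m T" using tangle by (simp add: virtual_tangle_def)
  have C1: "strand T' i C1_differentiable_on {0..1}" if i: "i < m" for i
    unfolding C1_differentiable_on_def
  proof (intro exI[of _ "\<lambda>t. velocity T' (i, t)"] conjI ballI)
    show "(strand T' i has_vector_derivative velocity T' (i, t)) (at t)" if "t \<in> {0..1}" for t
      using strand_T'_derivative[of i t] velocity_T'[of i t] i that by (simp add: places_def)
    have C1: "strand T i C1_differentiable_on {0..1}" using imm i by (auto simp: properly_immersed_def)
    then have "continuous_on {0..1} (\<lambda>t. velocity T (i, t))"
      by (auto simp: C1_differentiable_on_eq velocity_def)
    moreover have "continuous_on {0..1} (\<lambda>t. pt T (i, t))"
      using C1 by (auto simp: pt_def intro: C1_differentiable_imp_continuous_on)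
    ultimately have "continuous_on {0..1} (\<lambda>t. (velocity T (i, t) + \<i> * turn' i t * pt T (i, t)) * cis (turn i t))"
      unfolding turn_def turn'_def using tau by (intro continuous_intros) auto
    then show "continuous_on {0..1} (\<lambda>t. velocity T' (i, t))"
      by (rule continuous_on_eq) (use i velocity_T' in \<open>auto simp: places_def\<close>)
  qed
  moreover have "velocity T' a \<noteq> 0" if "a \<in> places m" for a
    using collar_or_core[OF that]
  proof (elim disjE exE conjE bexE)
    fix j u assume "j < 2 * m" "u \<in> {0..\<tau>}" "a = inward (e j) u"
    moreover from this have "of_real (1 - 2 * snd (e j)) \<noteq> (0 :: complex)"
      using e_ends[of j] by (auto simp: ends_def)
    moreover have "Complex (- 1) y \<noteq> 0" for y by (simp add: complex_eq_iff)
    ultimately show ?thesis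
      using velocity_collar[of j u] pt_collar[of j u]
      by (metis atLeastAtMost_iff exp_not_eq_zero mult_eq_0_iff)
  next
    assume "norm (pt T a) < exp (- \<tau>)"
    then show ?thesis using velocity_core[OF that] imm that by (auto simp: properly_immersed_def)
  qed
  moreover have "pt T' a \<in> disk \<and> (pt T' a \<in> bdisk \<longleftrightarrow> a \<in> ends m)" if "a \<in> places m" for a
    using imm that norm_pt_T'[of a] by (auto simp: properly_immersed_def)
  moreover have "velocity T' a \<bullet> pt T' a \<noteq> 0" if "a \<in> ends m" for a
  proof -
    obtain j where j: "j < 2 * m" "a = e j" using e_surj[OF \<open>a \<in> ends m\<close>] by auto
    have a: "a = inward (e j) 0" by (simp add: j(2) inward_def)
    have "1 - 2 * snd (e j) \<noteq> 0" using e_ends[of j] j by (auto simp: ends_def)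
    moreover have "velocity T' a = (- (1 - 2 * snd (e j))) *\<^sub>R pt T' a"
      using velocity_collar[OF j(1), of 0] tau by (simp add: a fall'_left Complex_eq scaleR_conv_of_real)
    moreover have "pt T' a \<noteq> 0" using pt_collar[OF j(1), of 0] tau by (simp add: a)
    ultimately show ?thesis by (simp only: inner_scaleR_left) simp
  qed
  ultimately show ?thesis by (auto simp: properly_immersed_def)
qed

lemma transverse_T': "transverse_double_points m T'"
proof -
  have dp: "transverse_double_points m T" using tangle by (simp add: virtual_tangle_def)
  have PQ_transverse: "\<not> collinear {0, velocity T' P, velocity T' Q}"
  proof
    assume "collinear {0, velocity T' P, velocity T' Q}"
    then have real: "velocity T' Q / velocity T' P \<in> \<real>" by (simp add: collinear_iff_Reals)
    define \<rho> where "\<rho> = 4 * gap / \<tau>"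
    define \<sigma> where "\<sigma> j = 1 - 2 * snd (e j)" for j
    have \<sigma>: "\<sigma> k \<in> {1, -1}" "\<sigma> (Suc k) \<in> {1, -1}"
      using e_ends[of k] e_ends[of "Suc k"] k by (auto simp: \<sigma>_def ends_def)
    have "2 * (3 * \<tau> / 4) / \<tau> - 1 = 1/2" using tau by simp
    then have "velocity T' P = of_real (\<sigma> k) * Complex (- 1) (- \<rho>) * X"
        "velocity T' Q = of_real (\<sigma> (Suc k)) * Complex (- 1) \<rho> * X"
      using velocity_collar[of k "3 * \<tau> / 4"] velocity_collar[of "Suc k" "3 * \<tau> / 4"] tau k pt_PQ
      by (simp_all add: P_def[symmetric] Q_def[symmetric] rot_e fall'_half \<sigma>_def \<rho>_def)
    then have "velocity T' Q / velocity T' P =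
        of_real (\<sigma> (Suc k) / \<sigma> k) * (Complex (- 1) \<rho> / Complex (- 1) (- \<rho>))"
      by (simp add: X_def)
    moreover have "Im (Complex (- 1) \<rho> / Complex (- 1) (- \<rho>)) = - 2 * \<rho> / (1 + \<rho>\<^sup>2)"
      by (simp add: Im_divide power2_eq_square)
    moreover have "\<rho> > 0" using gap tau by (simp add: \<rho>_def)
    then have "- 2 * \<rho> / (1 + \<rho>\<^sup>2) \<noteq> 0" by (simp add: add_nonneg_eq_0_iff)
    ultimately have "Im (velocity T' Q / velocity T' P) \<noteq> 0" using \<sigma>
      by (auto simp: Im_complex_of_real simp del: Im_divide)
    then show False using real complex_is_Real_iff by blast
  qed
  have "\<not> collinear {0, velocity T' a, velocity T' b}"
    if "a \<in> places m" "b \<in> places m" "a \<noteq> b" "pt T' a = pt T' b" for a b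
    using same_point_T'[OF that]
  proof (elim disjE conjE)
    assume "norm (pt T a) < exp (- \<tau>)" "pt T a = pt T b"
    then show ?thesis using dp that velocity_core[of a] velocity_core[of b]
      by (auto simp: transverse_double_points_def)
  qed (use PQ_transverse in \<open>auto simp: insert_commute\<close>)
  moreover have "card {a \<in> places m. pt T' a = z} = 2" if "z \<in> crossings m T'" for z
    using that dp PQ(3) preimage_X preimage_T'[of z]
    by (auto simp: crossings_T' transverse_double_points_def)
  moreover have "norm X < 1" using X_new tau by simp
  ultimately show ?thesis
    using dp by (auto simp: transverse_double_points_def crossings_T')
qed

lemma kind_cases:
  obtains (P_under) "under_places T' = insert P (under_places T)" "virtuals T' = virtuals T"
    | (Q_under) "under_places T' = insert Q (under_places T)" "virtuals T' = virtuals T"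
    | (virtual) "under_places T' = under_places T" "virtuals T' = insert X (virtuals T)"
proof -
  have "under_places T' = under_places T \<union> U" "virtuals T' = virtuals T \<union> V" by (simp_all add: T'_def)
  moreover have "U = {P} \<and> V = {} \<or> U = {Q} \<and> V = {} \<or> U = {} \<and> V = {X}"
    using UV unfolding P_def[symmetric] Q_def[symmetric] gap_def[symmetric] X_def[symmetric] by simp
  ultimately show ?thesis using that by (metis insert_is_Un sup.commute sup_bot.right_neutral)
qed

lemma crossing_information_T': "crossing_information m T'"
proof -
  have ci: "crossing_information m T" using tangle by (simp add: virtual_tangle_def)
  have old: "a \<in> places m \<and> pt T a \<in> crossings m T - virtuals T \<and> norm (pt T a) < exp (- \<tau>) \<and> pt T' a = pt T a"
    if "a \<in> under_places T" for a
    using ci that crossings_norm[of "pt T a"] pt_core[of a] by (auto simp: crossing_information_def)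
  have PQ_new: "P \<notin> under_places T" "Q \<notin> under_places T"
    using old[of P] old[of Q] PQ X_new by auto
  have X_not: "X \<notin> virtuals T" using ci X_new by (auto simp: crossing_information_def)
  have PQ_iff: "P \<in> under_places T' \<longleftrightarrow> Q \<notin> under_places T'" if "X \<notin> virtuals T'"
    by (rule kind_cases) (use that PQ_new PQ(3) in \<open>auto simp:\<close>)
  show ?thesis
    unfolding crossing_information_def
  proof (intro conjI ballI impI)
    show "virtuals T' \<subseteq> crossings m T'"
      using ci by (rule_tac kind_cases) (auto simp: crossings_T' crossing_information_def)
    show "under_places T' \<subseteq> {a \<in> places m. pt T' a \<in> crossings m T' - virtuals T'}"
    proof
      fix a assume a: "a \<in> under_places T'"
      show "a \<in> {a \<in> places m. pt T' a \<in> crossings m T' - virtuals T'}"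
      proof (cases "a \<in> under_places T")
        case True
        then have "pt T' a \<noteq> X" using old[OF True] X_new by auto
        then show ?thesis using old[OF True]
          by (rule_tac kind_cases) (auto simp: crossings_T')
      next
        case False
        then show ?thesis using a PQ pt_PQ X_not
          by (rule_tac kind_cases) (auto simp: crossings_T')
      qed
    qed
    fix a b assume ab: "a \<in> places m" "b \<in> places m" "a \<noteq> b \<and> pt T' a = pt T' b \<and> pt T' a \<notin> virtuals T'"
    have "(norm (pt T a) < exp (- \<tau>) \<and> pt T a = pt T b) \<or> (a = P \<and> b = Q) \<or> (a = Q \<and> b = P)"
      using same_point_T' ab by blast
    then show "a \<in> under_places T' \<longleftrightarrow> b \<notin> under_places T'"
    proof (elim disjE conjE)
      assume n: "norm (pt T a) < exp (- \<tau>)" "pt T a = pt T b"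
      then have "a \<notin> {P, Q}" "b \<notin> {P, Q}" using PQ X_new by auto
      then have "a \<in> under_places T' \<longleftrightarrow> a \<in> under_places T" "b \<in> under_places T' \<longleftrightarrow> b \<in> under_places T"
        by (rule_tac kind_cases, auto)+
      moreover have "virtuals T \<subseteq> virtuals T'" by (simp add: T'_def)
      then have "pt T a \<notin> virtuals T" using ab n pt_core[of a] by auto
      ultimately show ?thesis using ci ab n by (auto simp: crossing_information_def)
    qed (use PQ_iff ab pt_PQ in auto)
  qed
qed

lemma tangle_T': "virtual_tangle m T'"
  by (simp add: virtual_tangle_def properly_immersed_T' transverse_T' crossing_information_T')

end

text \<open>
  The region between two graphs that start at a common point, like a triangle with one vertical side.
\<close>

lemma region_between_graphs:
  fixes lo hi :: "real \<Rightarrow> real"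
  assumes ab: "a < b" and cont: "continuous_on UNIV lo" "continuous_on UNIV hi"
    and meet: "lo a = hi a" and less: "\<And>x. a < x \<Longrightarrow> x \<le> b \<Longrightarrow> lo x < hi x"
    and bounded: "bounded {z. a \<le> Re z \<and> Re z \<le> b \<and> lo (Re z) \<le> Im z \<and> Im z \<le> hi (Re z)}"
  defines "K \<equiv> {z. a \<le> Re z \<and> Re z \<le> b \<and> lo (Re z) \<le> Im z \<and> Im z \<le> hi (Re z)}"
  shows "compact K"
    and "interior K = {z. a < Re z \<and> Re z < b \<and> lo (Re z) < Im z \<and> Im z < hi (Re z)}"
    and "frontier K = (\<lambda>x. Complex x (hi x)) ` {a..b} \<union> (\<lambda>x. Complex x (lo x)) ` {a..b} \<union>
      Complex b ` {lo b..hi b}"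
proof -
  have contR: "continuous_on UNIV (\<lambda>z. lo (Re z))" "continuous_on UNIV (\<lambda>z. hi (Re z))"
    by (rule continuous_on_compose2[OF cont(1) continuous_on_Re[OF continuous_on_id]], simp,
        rule continuous_on_compose2[OF cont(2) continuous_on_Re[OF continuous_on_id]], simp)
  have "closed K" unfolding K_def
    by (intro closed_Collect_conj closed_Collect_le contR continuous_intros)
  then show compact: "compact K" using bounded by (simp add: compact_eq_bounded_closed K_def)
  let ?I = "{z. a < Re z \<and> Re z < b \<and> lo (Re z) < Im z \<and> Im z < hi (Re z)}"
  have "open ?I" by (intro open_Collect_conj open_Collect_less contR continuous_intros)
  then have "?I \<subseteq> interior K" by (intro interior_maximal) (auto simp: K_def)
  moreover have "interior K \<subseteq> ?I"
  proof
    fix z assume "z \<in> interior K"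
    then obtain r where r: "r > 0" "ball z r \<subseteq> K" by (auto simp: mem_interior)
    have in_K: "z + d \<in> K" if "norm d < r" for d using r that by (auto simp: dist_norm)
    \<comment> \<open>Moving a little in the four coordinate directions stays in the set, so none of the bounds is attained.\<close>
    have "z + of_real (- r/2) \<in> K" "z + of_real (r/2) \<in> K" "z + \<i> * of_real (- r/2) \<in> K" "z + \<i> * of_real (r/2) \<in> K"
      by (intro in_K; use r in \<open>simp add: norm_mult\<close>)+
    then show "z \<in> ?I" using r(1) by (auto simp: K_def)
  qed
  ultimately show int: "interior K = ?I" by blast
  have "lo x \<le> hi x" if "a \<le> x" "x \<le> b" for x
    using less[of x] meet that by (cases "x = a") auto
  note less_eq = this
  have "frontier K = K - ?I" unfolding frontier_def closure_closed[OF \<open>closed K\<close>] int ..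
  also have "\<dots> = {z. Re z \<in> {a..b} \<and> Im z = hi (Re z)} \<union> {z. Re z \<in> {a..b} \<and> Im z = lo (Re z)} \<union>
      {z. Re z = b \<and> Im z \<in> {lo b..hi b}}"
  proof (intro set_eqI)
    fix z
    show "z \<in> K - ?I \<longleftrightarrow> z \<in> {z. Re z \<in> {a..b} \<and> Im z = hi (Re z)} \<union>
        {z. Re z \<in> {a..b} \<and> Im z = lo (Re z)} \<union> {z. Re z = b \<and> Im z \<in> {lo b..hi b}}"
      using less_eq[of "Re z"] ab meet unfolding K_def by (cases "Re z = a") auto
  qed
  finally have frontier: "frontier K = {z. Re z \<in> {a..b} \<and> Im z = hi (Re z)} \<union>
      {z. Re z \<in> {a..b} \<and> Im z = lo (Re z)} \<union> {z. Re z = b \<and> Im z \<in> {lo b..hi b}}" .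
  have graph: "{z. Re z \<in> {a..b} \<and> Im z = f (Re z)} = (\<lambda>x. Complex x (f x)) ` {a..b}" for f
    by (auto simp: complex_eq_iff image_iff)
  have edge: "{z. Re z = b \<and> Im z \<in> {lo b..hi b}} = Complex b ` {lo b..hi b}"
    by (auto simp: complex_eq_iff image_iff)
  show "frontier K = (\<lambda>x. Complex x (hi x)) ` {a..b} \<union> (\<lambda>x. Complex x (lo x)) ` {a..b} \<union>
      Complex b ` {lo b..hi b}"
    unfolding frontier graph edge ..
qed

text \<open>
  Here \<open>D\<close> is the piece of a string between a new under-place and the end of the string next to it. Only
  this piece gets a new color, and the only new condition is the one at the new crossing.
\<close>

lemma place_coloring_new_under_place:
  assumes \<kappa>: "place_coloring p m T \<kappa>"
    and U': "under_places T' = insert (i0, c) (under_places T)" and i0: "i0 < m" and c: "0 < c" "c < 1"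
    and D: "D = {0..<c} \<or> D = {c<..1}"
    and old: "\<And>a b. a \<in> under_places T \<Longrightarrow> b \<in> places m \<Longrightarrow> b \<noteq> a \<Longrightarrow> pt T' b = pt T' a \<Longrightarrow>
      pt T b = pt T a \<and> b \<notin> {i0} \<times> D"
    and free: "({i0} \<times> insert c D) \<inter> under_places T = {}"
    and new: "\<And>b. b \<in> places m \<Longrightarrow> b \<noteq> (i0, c) \<Longrightarrow> pt T' b = pt T' (i0, c) \<Longrightarrow>
      b \<notin> {i0} \<times> D \<and> [w + \<kappa> (i0, c) = 2 * \<kappa> b] (mod p)"
  shows "place_coloring p m T' (\<lambda>a. if a \<in> {i0} \<times> D then w else \<kappa> a)" (is "place_coloring p m T' ?\<kappa>")
proof -
  have const: "\<kappa> (i, s) = \<kappa> (i, t)"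
    if "i < m" "0 \<le> s" "s \<le> t" "t \<le> 1" "({i} \<times> {s..t}) \<inter> under_places T = {}" for i s t
    using \<kappa> that unfolding place_coloring_def by blast
  have "?\<kappa> (i, s) = ?\<kappa> (i, t)"
    if "i < m" "0 \<le> s" "s \<le> t" "t \<le> 1" "({i} \<times> {s..t}) \<inter> under_places T' = {}" for i s t
  proof -
    have "c \<notin> {s..t}" if "i = i0" using \<open>({i} \<times> {s..t}) \<inter> under_places T' = {}\<close> that U' by auto
    then have "(i, s) \<in> {i0} \<times> D \<longleftrightarrow> (i, t) \<in> {i0} \<times> D" using D that by auto
    moreover have "\<kappa> (i, s) = \<kappa> (i, t)" using const[of i s t] that U' by auto
    ultimately show ?thesis by simp
  qed
  moreover have "[?\<kappa> (i, s) + ?\<kappa> (i, t) = 2 * ?\<kappa> b] (mod p)"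
    if u: "(i, u) \<in> under_places T'" and b: "b \<in> places m" "b \<noteq> (i, u)" "pt T' b = pt T' (i, u)"
      and st: "0 \<le> s" "s < u" "u < t" "t \<le> 1" "({i} \<times> {s..t}) \<inter> under_places T' = {(i, u)}" for i u b s t
  proof (cases "(i, u) = (i0, c)")
    case True
    \<comment> \<open>On the old diagram the interval from \<open>s\<close> to \<open>t\<close> lies in one arc, which is now cut at \<open>c\<close>.\<close>
    have only: "({i} \<times> {s..t}) \<inter> under_places T = {}"
      using st(5) True free unfolding U' by auto
    have "({i} \<times> {s..c}) \<inter> under_places T = {}" "({i} \<times> {c..t}) \<inter> under_places T = {}"
      using only st(2,3) True unfolding disjoint_iff by auto
    then have "\<kappa> (i, s) = \<kappa> (i, c)" "\<kappa> (i, c) = \<kappa> (i, t)"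
      using const[of i s c] const[of i c t] st True i0 c by auto
    moreover have "b \<notin> {i0} \<times> D" "[w + \<kappa> (i0, c) = 2 * \<kappa> b] (mod p)" using new[of b] b True by auto
    ultimately show ?thesis using D st True by (auto simp: add.commute)
  next
    case False
    then have u': "(i, u) \<in> under_places T" using u U' by auto
    then have b': "pt T b = pt T (i, u)" "b \<notin> {i0} \<times> D" using old[of "(i, u)" b] b by auto
    have only: "x = u" if "x \<in> {s..t}" "(i, x) \<in> under_places T'" for x
      using st(5) that by blast
    have "c \<notin> {s..t}" if i: "i = i0" using only[of c] False i U' by blast
    moreover have "u \<notin> D" if i: "i = i0" using free u' i by blast
    ultimately have notin: "(i, s) \<notin> {i0} \<times> D" "(i, t) \<notin> {i0} \<times> D" using D st by auto
    have "({i} \<times> {s..t}) \<inter> under_places T = {(i, u)}" using only u' st(2,3) U' by force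
    then have "[\<kappa> (i, s) + \<kappa> (i, t) = 2 * \<kappa> b] (mod p)"
      using \<kappa>[unfolded place_coloring_def, THEN conjunct2, rule_format, of i u b s t] u' b b' st by auto
    then show ?thesis using b'(2) notin by (simp only: if_False)
  qed
  ultimately show ?thesis unfolding place_coloring_def by blast
qed

lemma inward_segment:
  assumes "(i, \<epsilon>) \<in> ends m" "0 \<le> c"
  shows "{i} \<times> closed_segment \<epsilon> (snd (inward (i, \<epsilon>) c)) = inward (i, \<epsilon>) ` {0..c}"
proof (cases "\<epsilon> = 0")
  case True
  then show ?thesis using assms by (auto simp: inward_def closed_segment_eq_real_ivl image_iff)
next
  case False
  then have [simp]: "\<epsilon> = 1" using assms by (auto simp: ends_def)
  show ?thesis
    using assms by (auto simp: inward_def closed_segment_eq_real_ivl image_iff) (rule_tac x = "1 - b" in bexI, auto)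
qed

context twist
begin

text \<open>
  The turned strings have exchanged their positions on the circle.
\<close>

definition e' :: "nat \<Rightarrow> nat \<times> real" where
  "e' j = (if j = k then e (Suc k) else if j = Suc k then e k else e j)"

lemma bij_e': "bij_betw e' {..<2 * m} (ends m)"
proof -
  have "bij_betw (e \<circ> Transposition.transpose k (Suc k)) {..<2 * m} (ends m)"
    by (rule bij_betw_trans[OF _ e]) (use k in \<open>auto simp: bij_betw_transpose_iff\<close>)
  moreover have "e \<circ> Transposition.transpose k (Suc k) = e'"
    by (auto simp: e'_def Transposition.transpose_def)
  ultimately show ?thesis by simp
qed

lemma collared_T': "collared m T' e' (\<tau> / 2)"
  unfolding collared_def
proof (intro conjI allI impI ballI)
  show "virtual_tangle m T'" by (rule tangle_T')
  show "0 < \<tau> / 2" "\<tau> / 2 < 1/2" using tau by auto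
  show "bij_betw e' {..<2 * m} (ends m)" by (rule bij_e')
  fix j u assume j: "j < 2 * m" and u: "u \<le> \<tau> / 2"
  have "fall (2 * u / \<tau> - 1) = 1" using u tau by (intro fall_left) (simp add: field_simps)
  moreover define j0 where "j0 = (if j = k then Suc k else if j = Suc k then k else j)"
  moreover have "j0 < 2 * m" "e' j = e j0" "u \<le> \<tau>" using j k u tau by (auto simp: j0_def e'_def)
  moreover have "real j0 + rot (e j0) = j" using j k rot_e[of j0] by (auto simp: j0_def)
  ultimately show "pt T' (inward (e' j) u) = exp (Complex (- u) (pi / m * j))"
    using pt_collar[of j0 u] by (simp add: gap_def)
next
  fix a assume a: "a \<in> places m"
  show "(\<exists>j<2 * m. \<exists>u\<in>{0..\<tau> / 2}. a = inward (e' j) u) \<or> norm (pt T' a) < exp (- (\<tau> / 2))"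
    using collar_or_core[OF a]
  proof (elim disjE exE conjE bexE)
    assume n: "norm (pt T a) < exp (- \<tau>)"
    moreover have "exp (- \<tau>) \<le> exp (- (\<tau> / 2))" using tau by simp
    ultimately show ?thesis using norm_pt_T'[of a] by linarith
  next
    fix j u assume j: "j < 2 * m" "u \<in> {0..\<tau>}" "a = inward (e j) u"
    show ?thesis
    proof (cases "u \<le> \<tau> / 2")
      case True
      define j0 where "j0 = (if j = k then Suc k else if j = Suc k then k else j)"
      have "j0 < 2 * m" "e' j0 = e j" using j k by (auto simp: j0_def e'_def)
      then show ?thesis using True j by (intro disjI1 exI[of _ j0]) auto
    next
      case False
      then show ?thesis using j norm_pt_T'[of a] collar_norm[of j u] by auto
    qed
  qed
qed

lemma under_places_core:
  assumes "a \<in> under_places T"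
  shows "a \<in> places m" "norm (pt T a) < exp (- \<tau>)"
proof -
  have "crossing_information m T" using tangle by (simp add: virtual_tangle_def)
  then have "a \<in> places m" "pt T a \<in> crossings m T" using assms by (auto simp: crossing_information_def)
  then show "a \<in> places m" "norm (pt T a) < exp (- \<tau>)" using crossings_norm by auto
qed

text \<open>
  The string that runs under at the new crossing receives beyond it the color forced by the crossing
  relation; the over-string keeps its color up to its end.
\<close>

lemma recolor:
  assumes \<kappa>: "place_coloring p m T \<kappa>"
    and jj': "j = k \<and> j' = Suc k \<or> j = Suc k \<and> j' = k"
    and U': "under_places T' = insert (inward (e j) (3 * \<tau> / 4)) (under_places T)"
  obtains \<kappa>' where "place_coloring p m T' \<kappa>'" "\<kappa>' (e j) = 2 * \<kappa> (e j') - \<kappa> (e j)"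
    "\<And>i. i < 2 * m \<Longrightarrow> i \<noteq> j \<Longrightarrow> \<kappa>' (e i) = \<kappa> (e i)"
proof -
  have j: "j < 2 * m" "j' < 2 * m" "j \<noteq> j'" using jj' k by auto
  obtain i0 \<epsilon> where e0: "e j = (i0, \<epsilon>)" by force
  then have i0: "i0 < m" "\<epsilon> = 0 \<or> \<epsilon> = 1" using e_ends[OF j(1)] by (auto simp: ends_def)
  define c where "c = snd (inward (e j) (3 * \<tau> / 4))"
  have ic: "inward (e j) (3 * \<tau> / 4) = (i0, c)" by (simp add: c_def e0 inward_def)
  define D where "D = (if \<epsilon> = 0 then {0..<c} else {c<..1})"
  have c: "0 < c" "c < 1" using i0(2) tau by (auto simp: c_def e0 inward_def)
  have D_inward: "\<exists>u\<in>{0..\<tau>}. a = inward (e j) u \<and> (a \<in> {i0} \<times> D \<longrightarrow> u < 3 * \<tau> / 4)"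
    if "a \<in> {i0} \<times> insert c D" for a
    using that i0(2) tau
    by (intro bexI[of _ "if \<epsilon> = 0 then snd a else 1 - snd a"])
       (auto simp: D_def c_def e0 inward_0 inward_1)
  have not_core: "\<not> norm (pt T a) < exp (- \<tau>)" if "a \<in> {i0} \<times> insert c D" for a
    using D_inward[OF that] collar_norm[OF j(1)] by auto
  have const: "\<kappa> (inward (e l) u) = \<kappa> (e l)" if l: "l < 2 * m" and u: "0 \<le> u" "u \<le> \<tau>" for l u
  proof -
    obtain i \<delta> where l': "e l = (i, \<delta>)" by force
    then have i: "i < m" "\<delta> = 0 \<or> \<delta> = 1" using e_ends[OF l] by (auto simp: ends_def)
    have free: "inward (e l) x \<notin> under_places T" if "0 \<le> x" "x \<le> \<tau>" for x
      using under_places_core(2)[of "inward (e l) x"] collar_norm[OF l, of x] that by auto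
    from i(2) show ?thesis
    proof
      assume "\<delta> = 0"
      then have "({i} \<times> {0..u}) \<inter> under_places T = {}" using free u by (fastforce simp: l' inward_0)
      then show ?thesis using \<kappa>[unfolded place_coloring_def, THEN conjunct1, rule_format, of i 0 u] i u tau
        by (simp add: l' inward_0 \<open>\<delta> = 0\<close>)
    next
      assume "\<delta> = 1"
      then have "({i} \<times> {1 - u..1}) \<inter> under_places T = {}"
        using free[of "1 - _"] u by (fastforce simp: l' inward_1)
      then show ?thesis using \<kappa>[unfolded place_coloring_def, THEN conjunct1, rule_format, of i "1 - u" 1] i u tau
        by (simp add: l' inward_1 \<open>\<delta> = 1\<close>)
    qed
  qed
  define w where "w = 2 * \<kappa> (e j') - \<kappa> (e j)"
  define \<kappa>' where "\<kappa>' a = (if a \<in> {i0} \<times> D then w else \<kappa> a)" for a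
  have other: "inward (e j') (3 * \<tau> / 4) \<notin> {i0} \<times> D"
    using D_inward[of "inward (e j') (3 * \<tau> / 4)"] tau j e_ends e_inj
      inward_inj[of "e j'" m "e j" "3 * \<tau> / 4"] by fastforce
  have "place_coloring p m T' \<kappa>'"
    unfolding \<kappa>'_def[abs_def]
  proof (rule place_coloring_new_under_place[OF \<kappa> _ i0(1) c])
    show "under_places T' = insert (i0, c) (under_places T)" using U' by (simp add: ic)
    show "D = {0..<c} \<or> D = {c<..1}" by (simp add: D_def)
    show "({i0} \<times> insert c D) \<inter> under_places T = {}" using not_core under_places_core(2) by blast
    show "pt T b = pt T a \<and> b \<notin> {i0} \<times> D"
      if "a \<in> under_places T" "b \<in> places m" "b \<noteq> a" "pt T' b = pt T' a" for a b
    proof -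
      have "norm (pt T b) = norm (pt T a)" using norm_pt_T'[of a] norm_pt_T'[of b] that(4) by simp
      then have "norm (pt T b) < exp (- \<tau>)" using under_places_core[OF that(1)] by simp
      then show ?thesis
        using pt_core[of a] pt_core[of b] under_places_core[OF that(1)] that not_core[of b] by auto
    qed
    show "b \<notin> {i0} \<times> D \<and> [w + \<kappa> (i0, c) = 2 * \<kappa> b] (mod p)"
      if "b \<in> places m" "b \<noteq> (i0, c)" "pt T' b = pt T' (i0, c)" for b
    proof -
      have "pt T' (i0, c) = X" using pt_PQ jj' by (auto simp: ic[symmetric] P_def Q_def)
      then have "b \<in> {a \<in> places m. pt T' a = X}" using that(1,3) by simp
      then have "b \<in> {P, Q}" unfolding preimage_X .
      then have b: "b = inward (e j') (3 * \<tau> / 4)"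
        using that(2) jj' ic unfolding P_def Q_def by (metis insertE singletonD)
      have "\<kappa> b = \<kappa> (e j')" "\<kappa> (i0, c) = \<kappa> (e j)"
        using const[OF j(2), of "3 * \<tau> / 4"] const[OF j(1), of "3 * \<tau> / 4"] tau by (auto simp: b ic)
      then show ?thesis using other by (simp add: b w_def)
    qed
  qed
  moreover have "\<kappa>' (e j) = w" using c i0(2) by (auto simp: \<kappa>'_def e0 D_def)
  moreover have "\<kappa>' (e i) = \<kappa> (e i)" if "i < 2 * m" "i \<noteq> j" for i
  proof -
    have "e i \<notin> {i0} \<times> D"
    proof
      assume "e i \<in> {i0} \<times> D"
      moreover have "e i \<noteq> (i0, \<epsilon>)" "snd (e i) \<in> {0, 1}"
        using e_inj[OF that(1) j(1)] that(2) e0 e_ends[OF that(1)] by (auto simp: ends_def)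
      ultimately show False using i0(2) c by (auto simp: D_def split: if_splits)
    qed
    then show ?thesis by (simp add: \<kappa>'_def)
  qed
  ultimately show ?thesis using that by (simp add: w_def)
qed

end

section \<open>The added crossing is removed by a boundary move\<close>

context twist
begin

lemma T'_sel: "under_places T' = under_places T \<union> U" "virtuals T' = virtuals T \<union> V"
  by (simp_all add: T'_def)

text \<open>
  The part of the collar between the two rays; in logarithmic coordinates it is a rectangle.
\<close>

definition N :: "complex set" where
  "N = exp ` cbox (Complex (- \<tau>) (gap * k)) (Complex 0 (gap * (real k + 1)))"

text \<open>
  The position of the two turned strings between their rays as a function of \<open>x = ln r\<close>: one runs at the
  fraction \<open>width x\<close> of the way, the other at \<open>1 - width x\<close>.
\<close>

definition width :: "real \<Rightarrow> real" where "width x = fall (- 2 * x / \<tau> - 1)"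

text \<open>
  The triangle cut off by the new crossing, in logarithmic coordinates. Its corner at the crossing has
  \<open>x = - (3 * \<tau> / 4)\<close>, where both bounds are equal.
\<close>

definition K :: "complex set" where
  "K = {z. - (3 * \<tau> / 4) \<le> Re z \<and> Re z \<le> 0 \<and>
     gap * (real k + 1 - width (Re z)) \<le> Im z \<and> Im z \<le> gap * (k + width (Re z))}"

lemma width: "0 \<le> width x" "width x \<le> 1" "width (- (3 * \<tau> / 4)) = 1/2" "width 0 = 1"
    "- (3 * \<tau> / 4) < x \<Longrightarrow> 1/2 < width x"
proof -
  show "0 \<le> width x" "width x \<le> 1" by (auto simp: width_def)
  have "- 2 * (- (3 * \<tau> / 4)) / \<tau> - 1 = 1/2" using tau by (simp add: field_simps)
  then show "width (- (3 * \<tau> / 4)) = 1/2" unfolding width_def by (simp only: fall_half)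
  show "width 0 = 1" by (simp add: width_def fall_left)
  assume "- (3 * \<tau> / 4) < x"
  then have "- 2 * x / \<tau> - 1 < 1/2" using tau by (simp add: field_simps)
  then show "1/2 < width x"
    using fall_strict_antimono[of "- 2 * x / \<tau> - 1" "1/2"] fall_half by (simp add: width_def)
qed

lemma K_subset: "K \<subseteq> cbox (Complex (- \<tau>) (gap * k)) (Complex 0 (gap * (real k + 1)))"
proof
  fix z assume z: "z \<in> K"
  have "gap * k \<le> gap * (real k + 1 - width (Re z))" "gap * (k + width (Re z)) \<le> gap * (real k + 1)"
    using width(1,2)[of "Re z"] gap(1) by (auto intro!: mult_left_mono)
  then show "z \<in> cbox (Complex (- \<tau>) (gap * k)) (Complex 0 (gap * (real k + 1)))"
    using z tau by (auto simp: K_def in_cbox_complex_iff)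
qed

lemma rectangle_strip:
  assumes "z \<in> cbox (Complex (- \<tau>) (gap * k)) (Complex 0 (gap * (real k + 1)))"
  shows "\<bar>Im z - gap * (k + 1/2)\<bar> < pi"
proof -
  define c where "c = gap * k"
  have c: "gap * (real k + 1) = c + gap" "gap * (k + 1/2) = c + gap / 2" by (simp_all add: c_def distrib_left)
  have "c \<le> Im z" "Im z \<le> c + gap" using assms unfolding c by (auto simp: c_def in_cbox_complex_iff)
  then show ?thesis unfolding c using gap by linarith
qed

lemma K_region:
  shows "compact K"
    and "interior K = {z. - (3 * \<tau> / 4) < Re z \<and> Re z < 0 \<and>
     gap * (real k + 1 - width (Re z)) < Im z \<and> Im z < gap * (k + width (Re z))}"
    and "frontier K = (\<lambda>x. Complex x (gap * (k + width x))) ` {- (3 * \<tau> / 4)..0} \<union>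
      (\<lambda>x. Complex x (gap * (real k + 1 - width x))) ` {- (3 * \<tau> / 4)..0} \<union> Complex 0 ` {gap * k..gap * (real k + 1)}"
proof -
  have cont: "continuous_on UNIV (\<lambda>x. gap * (real k + 1 - width x))" "continuous_on UNIV (\<lambda>x. gap * (k + width x))"
    unfolding width_def using tau by (auto intro!: continuous_intros)
  have "bounded K" by (rule bounded_subset[OF bounded_cbox K_subset])
  moreover have "gap * (real k + 1 - width x) < gap * (k + width x)" if "- (3 * \<tau> / 4) < x" for x
    using width(5)[OF that] gap(1) by (intro mult_strict_left_mono) auto
  moreover have "- (3 * \<tau> / 4) < 0" using tau by simp
  ultimately show "compact K"
    and "interior K = {z. - (3 * \<tau> / 4) < Re z \<and> Re z < 0 \<and>
     gap * (real k + 1 - width (Re z)) < Im z \<and> Im z < gap * (k + width (Re z))}"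
    and "frontier K = (\<lambda>x. Complex x (gap * (k + width x))) ` {- (3 * \<tau> / 4)..0} \<union>
      (\<lambda>x. Complex x (gap * (real k + 1 - width x))) ` {- (3 * \<tau> / 4)..0} \<union> Complex 0 ` {gap * k..gap * (real k + 1)}"
    using region_between_graphs[OF _ cont, of "- (3 * \<tau> / 4)" 0] width(3,4) unfolding K_def by simp_all
qed

lemma width_concave:
  assumes "- (3 * \<tau> / 4) \<le> x" "- (3 * \<tau> / 4) \<le> y" "0 \<le> s" "0 \<le> t" "s + t = 1"
  shows "s * width x + t * width y \<le> width (s * x + t * y)"
proof -
  have "- 2 * z / \<tau> - 1 \<in> {..1/2}" if "- (3 * \<tau> / 4) \<le> z" for z
    using that tau by (simp add: field_simps)
  then have "s * fall (- 2 * x / \<tau> - 1) + t * fall (- 2 * y / \<tau> - 1) \<le>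
      fall (s *\<^sub>R (- 2 * x / \<tau> - 1) + t *\<^sub>R (- 2 * y / \<tau> - 1))"
    using fall_concave_first_half assms unfolding concave_on_iff by blast
  moreover have "s *\<^sub>R (- 2 * x / \<tau> - 1) + t *\<^sub>R (- 2 * y / \<tau> - 1) = - 2 * (s * x + t * y) / \<tau> - (s + t)"
    using tau(1) by (simp add: field_simps)
  ultimately show ?thesis using assms(5) by (simp add: width_def)
qed

text \<open>
  The upper bound is a concave function and the lower one a convex function, because \<open>fall\<close> is concave
  on the first half of its step.
\<close>

lemma convex_K: "convex K"
  unfolding convex_def
proof (intro ballI allI impI)
  fix z w s t assume z: "z \<in> K" and w: "w \<in> K" and st: "(0::real) \<le> s" "0 \<le> t" "s + t = 1"
  define h where "h = width (Re (s *\<^sub>R z + t *\<^sub>R w))"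
  have conc: "s * width (Re z) + t * width (Re w) \<le> h"
    using width_concave[of "Re z" "Re w" s t] z w st by (simp add: K_def h_def)
  have Ac: "gap * (s * width (Re z) + t * width (Re w)) \<le> gap * h"
    using conc gap(1) by (intro mult_left_mono) auto
  have up: "s * Im z \<le> s * (gap * (k + width (Re z)))" "t * Im w \<le> t * (gap * (k + width (Re w)))"
    using z w st by (auto simp: K_def intro!: mult_left_mono)
  have lo: "s * (gap * (real k + 1 - width (Re z))) \<le> s * Im z" "t * (gap * (real k + 1 - width (Re w))) \<le> t * Im w"
    using z w st by (auto simp: K_def intro!: mult_left_mono)
  have k1: "s * (gap * k) + t * (gap * k) = gap * k" "s * gap + t * gap = gap"
    using st(3) by (simp_all add: distrib_right[symmetric])
  have "s * Im z + t * Im w \<le> gap * (k + h)" using up Ac k1 by (simp add: algebra_simps)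
  moreover have "gap * (real k + 1 - h) \<le> s * Im z + t * Im w" using lo Ac k1 by (simp add: algebra_simps)
  moreover have "- (3 * \<tau> / 4) \<le> s * Re z + t * Re w" "s * Re z + t * Re w \<le> 0"
    using convex_bound_le[of "- Re z" "3 * \<tau> / 4" "- Re w" s t] convex_bound_le[of "Re z" 0 "Re w" s t] z w st
    by (auto simp: K_def)
  ultimately show "s *\<^sub>R z + t *\<^sub>R w \<in> K" by (simp add: K_def h_def)
qed

lemma disks: "exp ` K homeomorphic disk" "N homeomorphic disk" "exp ` K \<subseteq> N" "N \<subseteq> disk"
proof -
  have "Complex (- (\<tau> / 4)) (gap * (k + 1/2)) \<in> interior K"
    using width(5)[of "- (\<tau> / 4)"] gap(1) tau unfolding K_region(2) by auto
  then show "exp ` K homeomorphic disk"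
    using exp_image_homeomorphic_disk[OF rectangle_strip[OF subsetD[OF K_subset]] K_region(1) convex_K] by blast
  have "box (Complex (- \<tau>) (gap * k)) (Complex 0 (gap * (real k + 1))) \<noteq> {}"
    using tau gap(1) by (auto simp: box_ne_empty Basis_complex_def)
  then show "N homeomorphic disk"
    unfolding N_def by (intro exp_image_homeomorphic_disk[OF rectangle_strip]) (auto simp: interior_cbox)
  show "exp ` K \<subseteq> N" using K_subset unfolding N_def by blast
  show "N \<subseteq> disk" by (auto simp: N_def in_cbox_complex_iff)
qed

lemma in_N_iff:
  fixes x y :: real
  assumes "0 \<le> y" "y \<le> 2 * m - 1"
  shows "exp (Complex x (gap * y)) \<in> N \<longleftrightarrow> - \<tau> \<le> x \<and> x \<le> 0 \<and> k \<le> y \<and> y \<le> real k + 1"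
proof
  assume "exp (Complex x (gap * y)) \<in> N"
  then obtain z where z: "- \<tau> \<le> Re z" "Re z \<le> 0" "gap * k \<le> Im z" "Im z \<le> gap * (real k + 1)"
      "exp (Complex x (gap * y)) = exp z"
    by (auto simp: N_def in_cbox_complex_iff)
  define r where "r = Im z / gap"
  have z': "z = Complex (Re z) (gap * r)" using gap(1) by (simp add: r_def)
  have r: "k \<le> r" "r \<le> real k + 1" using z(3,4) gap(1) by (auto simp: r_def field_simps)
  have "x = Re z \<and> y = r"
    using polar_inj[OF assms, of r x "Re z"] z(5) z' r k by auto
  then show "- \<tau> \<le> x \<and> x \<le> 0 \<and> k \<le> y \<and> y \<le> real k + 1" using z r by auto
next
  assume "- \<tau> \<le> x \<and> x \<le> 0 \<and> k \<le> y \<and> y \<le> real k + 1"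
  then have "Complex x (gap * y) \<in> cbox (Complex (- \<tau>) (gap * k)) (Complex 0 (gap * (real k + 1)))"
    using gap(1) by (auto simp: in_cbox_complex_iff)
  then show "exp (Complex x (gap * y)) \<in> N" unfolding N_def by blast
qed

lemma core_not_N: "z \<in> N \<Longrightarrow> \<not> norm z < exp (- \<tau>)"
  by (auto simp: N_def in_cbox_complex_iff)

definition S :: "(nat \<times> real) set" where
  "S = inward (e k) ` {0..\<tau>} \<union> inward (e (Suc k)) ` {0..\<tau>}"

lemma preimage_N: "{a \<in> places m. pt T a \<in> N} = S" "{a \<in> places m. pt T' a \<in> N} = S"
proof -
  have S_places: "S \<subseteq> places m"
    using e_ends[of k] e_ends[of "Suc k"] k tau by (auto simp: S_def intro!: inward_places)
  have collar_N: "pt T (inward (e j) u) \<in> N \<longleftrightarrow> j = k \<or> j = Suc k"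
      "pt T' (inward (e j) u) \<in> N \<longleftrightarrow> j = k \<or> j = Suc k"
    if "j < 2 * m" "u \<in> {0..\<tau>}" for j u
  proof -
    show "pt T (inward (e j) u) \<in> N \<longleftrightarrow> j = k \<or> j = Suc k"
      using in_N_iff[of j "- u"] that m collar[of j u] by auto
    define r where "r = rot (e j) * fall (2 * u / \<tau> - 1)"
    have "pt T' (inward (e j) u) \<in> N \<longleftrightarrow> k \<le> real j + r \<and> real j + r \<le> real k + 1"
      using in_N_iff[of "real j + r" "- u"] that pt_collar[of j u] sector[OF that(1), of "2 * u / \<tau> - 1"]
      by (auto simp: r_def)
    also have "\<dots> \<longleftrightarrow> j = k \<or> j = Suc k"
      using fall_nonneg[of "2 * u / \<tau> - 1"] fall_le_1[of "2 * u / \<tau> - 1"]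
      by (auto simp: r_def rot_e[OF that(1)] simp del: fall_nonneg fall_le_1)
    finally show "pt T' (inward (e j) u) \<in> N \<longleftrightarrow> j = k \<or> j = Suc k" .
  qed
  have "a \<in> S" if a: "a \<in> places m" and "pt T a \<in> N \<or> pt T' a \<in> N" for a
  proof -
    have "\<not> norm (pt T a) < exp (- \<tau>)" using that(2) core_not_N norm_pt_T'[of a] by metis
    then obtain j u where "j < 2 * m" "u \<in> {0..\<tau>}" "a = inward (e j) u" using collar_or_core[OF a] by auto
    then show ?thesis using collar_N[of j u] that(2) by (auto simp: S_def)
  qed
  moreover have "pt T a \<in> N \<and> pt T' a \<in> N" if "a \<in> S" for a
    using that collar_N[of k] collar_N[of "Suc k"] k by (auto simp: S_def)
  ultimately show "{a \<in> places m. pt T a \<in> N} = S" "{a \<in> places m. pt T' a \<in> N} = S"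
    using S_places by blast+
qed

lemma crossing_segments:
  assumes "0 \<le> u" "u \<le> \<tau>"
  shows "pt T' (inward (e k) u) = exp (Complex (- u) (gap * (k + width (- u))))"
    and "pt T' (inward (e (Suc k)) u) = exp (Complex (- u) (gap * (real k + 1 - width (- u))))"
  using pt_collar[of k u] pt_collar[of "Suc k" u] k assms by (auto simp: rot_e width_def algebra_simps)

lemma segment_images:
  "pt T' ` inward (e k) ` {0..3 * \<tau> / 4} = exp ` (\<lambda>x. Complex x (gap * (k + width x))) ` {- (3 * \<tau> / 4)..0}"
  "pt T' ` inward (e (Suc k)) ` {0..3 * \<tau> / 4} =
     exp ` (\<lambda>x. Complex x (gap * (real k + 1 - width x))) ` {- (3 * \<tau> / 4)..0}"
proof -
  have flip: "{- (3 * \<tau> / 4)..0} = uminus ` {0..3 * \<tau> / 4}" by simp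
  show "pt T' ` inward (e k) ` {0..3 * \<tau> / 4} = exp ` (\<lambda>x. Complex x (gap * (k + width x))) ` {- (3 * \<tau> / 4)..0}"
    "pt T' ` inward (e (Suc k)) ` {0..3 * \<tau> / 4} =
     exp ` (\<lambda>x. Complex x (gap * (real k + 1 - width x))) ` {- (3 * \<tau> / 4)..0}"
    unfolding flip image_image by (intro image_cong refl; use crossing_segments tau in simp)+
qed

text \<open>
  The boundary interval between the two ends, from the end of the string that has been turned upwards
  to the other one.
\<close>

definition rim :: "real \<Rightarrow> complex" where "rim t = exp (Complex 0 (gap * (real k + 1 - t)))"

lemma rim:
  "arc rim" "path_image rim = exp ` Complex 0 ` {gap * k..gap * (real k + 1)}"
  "pathstart rim = pt T' (e k)" "pathfinish rim = pt T' (e (Suc k))"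
proof -
  have rim_eq: "rim t = cis (gap * (real k + 1 - t))" for t by (simp add: rim_def exp_eq_polar)
  have "inj_on rim {0..1}"
  proof (rule inj_onI)
    fix s t :: real assume st: "s \<in> {0..1}" "t \<in> {0..1}" "rim s = rim t"
    have "\<bar>t - s\<bar> \<le> 1" using st by (auto simp: abs_if)
    then have "gap * \<bar>t - s\<bar> \<le> pi * 1" using gap by (intro mult_mono) auto
    then have "\<bar>gap * (t - s)\<bar> < 2 * pi" using gap(1) pi_gt_zero unfolding abs_mult abs_of_pos[OF gap(1)] by linarith
    moreover have "gap * (real k + 1 - s) - gap * (real k + 1 - t) = gap * (t - s)" by (simp add: algebra_simps)
    ultimately have "\<bar>Im (Complex 0 (gap * (real k + 1 - s))) - Im (Complex 0 (gap * (real k + 1 - t)))\<bar> < 2 * pi"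
      by simp
    from exp_complex_eqI[OF this] show "s = t" using st(3) gap(1) by (simp add: rim_def)
  qed
  moreover have "path rim" unfolding path_def rim_eq[abs_def] by (intro continuous_intros)
  ultimately show "arc rim" by (simp add: arc_def)
  have "(\<lambda>t. gap * (real k + 1 - t)) ` {0..1} = {gap * k..gap * (real k + 1)}"
    using gap(1) by (auto simp: image_iff intro!: bexI[of _ "real k + 1 - _ / gap"] simp: field_simps)
  then show "path_image rim = exp ` Complex 0 ` {gap * k..gap * (real k + 1)}"
    by (metis (no_types, lifting) image_cong image_image path_image_def rim_def)
  show "pathstart rim = pt T' (e k)" "pathfinish rim = pt T' (e (Suc k))"
    using crossing_segments[of 0] tau width(4)
    by (simp_all add: pathstart_def pathfinish_def rim_def inward_def)
qed

lemma strand_segment: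
  assumes "j < 2 * m" "0 \<le> c"
  shows "strand T' (fst (e j)) ` closed_segment (snd (e j)) (snd (inward (e j) c)) = pt T' ` inward (e j) ` {0..c}"
proof -
  have "strand T' i ` J = pt T' ` ({i} \<times> J)" for i J by (force simp: pt_def image_iff)
  then show ?thesis
    using inward_segment[of "fst (e j)" "snd (e j)" m c] e_ends[OF assms(1)] assms(2) by simp
qed

lemma triangle: "boundary_triangle m T' (e k) (snd P) (e (Suc k)) (snd Q) (exp ` K)"
proof -
  obtain i \<epsilon> j \<delta> where ek: "e k = (i, \<epsilon>)" "e (Suc k) = (j, \<delta>)" by force
  have PQ_pair: "P = (i, snd P)" "Q = (j, snd Q)" by (auto simp: P_def Q_def inward_def ek)
  define F where "F = strand T' i ` closed_segment \<epsilon> (snd P)"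
  define G where "G = strand T' j ` closed_segment \<delta> (snd Q)"
  have F: "F = pt T' ` inward (e k) ` {0..3 * \<tau> / 4}" and G: "G = pt T' ` inward (e (Suc k)) ` {0..3 * \<tau> / 4}"
    using strand_segment[of k "3 * \<tau> / 4"] strand_segment[of "Suc k" "3 * \<tau> / 4"] k tau
    by (simp_all add: F_def G_def P_def Q_def ek)
  have ends: "(i, \<epsilon>) \<in> ends m" "(j, \<delta>) \<in> ends m" "(i, \<epsilon>) \<noteq> (j, \<delta>)"
    using e_ends[of k] e_ends[of "Suc k"] e_inj[of k "Suc k"] k by (auto simp: ek)
  have FG_crossings: "(F \<union> G) \<inter> crossings m T' = {X}"
  proof -
    have "z = X" if z: "z \<in> F \<union> G" "z \<in> crossings m T'" for z
    proof -
      have "exp (- \<tau>) \<le> norm z"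
        using z(1) tau unfolding F G segment_images by auto
      then show ?thesis using z(2) crossings_norm[of z] by (auto simp: crossings_T')
    qed
    moreover have "X \<in> F"
      unfolding F pt_PQ(1)[symmetric] P_def using tau by (intro imageI) simp
    ultimately show ?thesis by (auto simp: crossings_T')
  qed
  have "frontier (exp ` K) = exp ` frontier K"
    by (rule exp_image_frontier[OF rectangle_strip[OF subsetD[OF K_subset]] K_region(1)])
  then have front: "frontier (exp ` K) = F \<union> G \<union> path_image rim"
    unfolding K_region(3) image_Un F G segment_images rim(2) .
  have "path_image rim \<subseteq> N"
    unfolding rim(2) N_def using tau by (auto simp: in_cbox_complex_iff)
  then have rim_ends: "\<forall>a\<in>ends m. pt T' a \<in> path_image rim \<longrightarrow> a \<in> {(i, \<epsilon>), (j, \<delta>)}"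
  proof (intro ballI impI)
    fix a assume a: "a \<in> ends m" "pt T' a \<in> path_image rim" and "path_image rim \<subseteq> N"
    then have "a \<in> {a \<in> places m. pt T' a \<in> N}" by (auto simp: ends_def places_def)
    then obtain b u where b: "b = e k \<or> b = e (Suc k)" "u \<in> {0..\<tau>}" "a = inward b u"
      unfolding preimage_N(2) S_def by blast
    have "b \<in> ends m" using b(1) e_ends k by auto
    moreover have "a = inward a 0" by (simp add: inward_def)
    ultimately have "a = b" using inward_inj(1)[of a m b 0 u] a(1) b tau by auto
    then show "a \<in> {(i, \<epsilon>), (j, \<delta>)}" using b(1) by (auto simp: ek)
  qed
  have rim_circle: "path_image rim \<subseteq> bdisk" by (auto simp: rim(2))
  have inside: "interior (exp ` K) \<inter> pt T' ` places m = {}"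
  proof -
    have False if z: "z \<in> interior K" and a: "a \<in> places m" "pt T' a = exp z" for z a
    proof -
      have zK: "z \<in> K" using z interior_subset by blast
      then have "pt T' a \<in> N" using a(2) disks(3) by auto
      then have "a \<in> S" using a(1) preimage_N(2) by blast
      then obtain u where u: "u \<in> {0..\<tau>}" "a = inward (e k) u \<or> a = inward (e (Suc k)) u"
        unfolding S_def by blast
      define w where "w = (if a = inward (e k) u then k + width (- u) else real k + 1 - width (- u))"
      have w: "pt T' a = exp (Complex (- u) (gap * w))"
        using crossing_segments[of u] u by (auto simp: w_def)
      have w_bounds: "0 \<le> w" "w \<le> 2 * m - 1" using width(1,2)[of "- u"] k by (auto simp: w_def)
      define r where "r = Im z / gap"
      have z': "z = Complex (Re z) (gap * r)" using gap(1) by (simp add: r_def)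
      have "z \<in> cbox (Complex (- \<tau>) (gap * k)) (Complex 0 (gap * (real k + 1)))" using zK K_subset by blast
      then have "k \<le> r" "r \<le> real k + 1" using gap(1) by (auto simp: r_def in_cbox_complex_iff field_simps)
      then have "w = r" "- u = Re z"
        using polar_inj[OF w_bounds, of r "- u" "Re z"] k a(2) w z' by auto
      then have "Im z = gap * w" "Re z = - u" using gap(1) by (auto simp: r_def)
      then show False using z unfolding K_region(2) by (auto simp: w_def split: if_splits)
    qed
    then show ?thesis
      using exp_image_interior[OF rectangle_strip[OF subsetD[OF K_subset]]] by fastforce
  qed
  have "exp ` K \<subseteq> disk" using disks by blast
  then have "arc rim \<and> path_image rim \<subseteq> bdisk \<and>
        pathstart rim = pt T' (i, \<epsilon>) \<and> pathfinish rim = pt T' (j, \<delta>) \<and>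
        (\<forall>a\<in>ends m. pt T' a \<in> path_image rim \<longrightarrow> a \<in> {(i, \<epsilon>), (j, \<delta>)}) \<and>
        exp ` K \<subseteq> disk \<and> exp ` K homeomorphic disk \<and>
        frontier (exp ` K) = F \<union> G \<union> path_image rim"
    using rim(1,3,4) rim_circle rim_ends disks(1) front unfolding ek by (intro conjI)
  then have "\<exists>\<kappa>. arc \<kappa> \<and> path_image \<kappa> \<subseteq> bdisk \<and>
        pathstart \<kappa> = pt T' (i, \<epsilon>) \<and> pathfinish \<kappa> = pt T' (j, \<delta>) \<and>
        (\<forall>a\<in>ends m. pt T' a \<in> path_image \<kappa> \<longrightarrow> a \<in> {(i, \<epsilon>), (j, \<delta>)}) \<and>
        exp ` K \<subseteq> disk \<and> exp ` K homeomorphic disk \<and>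
        frontier (exp ` K) = F \<union> G \<union> path_image \<kappa>"
    by (rule exI[of _ rim])
  moreover have "pt T' P = pt T' Q" "(F \<union> G) \<inter> crossings m T' = {pt T' P}"
    using pt_PQ FG_crossings by simp_all
  ultimately show ?thesis
    unfolding boundary_triangle_def ek prod.case F_def[symmetric] G_def[symmetric]
      PQ_pair(1)[symmetric] PQ_pair(2)[symmetric]
    using ends PQ(1-3) inside by (intro conjI)
qed

text \<open>
  The move removes the new crossing and leads back to the original diagram, which has two disjoint rays
  in \<open>N\<close>.
\<close>

lemma endpoint_move: "endpoint_move m X T' T"
proof -
  obtain i \<epsilon> j \<delta> where ek: "e k = (i, \<epsilon>)" "e (Suc k) = (j, \<delta>)" by force
  have PQ_pair: "P = (i, snd P)" "Q = (j, snd Q)" by (auto simp: P_def Q_def inward_def ek)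
  define s' where "s' = snd (inward (e k) \<tau>)"
  define t' where "t' = snd (inward (e (Suc k)) \<tau>)"
  have ends: "(i, \<epsilon>) \<in> ends m" "(j, \<delta>) \<in> ends m"
    using e_ends[of k] e_ends[of "Suc k"] k by (auto simp: ek)
  have S_eq: "S = {i} \<times> closed_segment \<epsilon> s' \<union> {j} \<times> closed_segment \<delta> t'"
    using inward_segment[OF ends(1), of \<tau>] inward_segment[OF ends(2), of \<tau>] tau
    by (simp add: S_def s'_def t'_def ek)
  have "s' \<in> {0<..<1}" "t' \<in> {0<..<1}" "snd P \<in> open_segment \<epsilon> s'" "snd Q \<in> open_segment \<delta> t'"
    using ends tau
    by (auto simp: s'_def t'_def P_def Q_def ek ends_def inward_def open_segment_eq_real_ivl)
  moreover have "crossings m T' \<inter> N = {X}" "crossings m T \<inter> N = {}"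
  proof -
    show "crossings m T \<inter> N = {}" using crossings_norm core_not_N by blast
    moreover have "P \<in> S" using tau by (auto simp: S_def P_def)
    then have "pt T' P \<in> N" unfolding preimage_N(2)[symmetric] by blast
    then have "X \<in> N" using pt_PQ by simp
    ultimately show "crossings m T' \<inter> N = {X}" by (auto simp: crossings_T')
  qed
  moreover have "pt T a = pt T' a" if "a \<in> (places m - S) \<union> {(i, s'), (j, t')}" for a
  proof -
    have same: "pt T (inward (e l) u) = pt T' (inward (e l) u)"
      if "l < 2 * m" "u \<le> \<tau>" "l \<notin> {k, Suc k} \<or> u = \<tau>" for l u
      using that collar[of l u] pt_collar[of l u] lev_0[of u] by (auto simp: rot_e)
    show ?thesis
    proof (cases "a \<in> {(i, s'), (j, t')}")
      case True
      then have "a = inward (e k) \<tau> \<or> a = inward (e (Suc k)) \<tau>"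
        by (auto simp: s'_def t'_def inward_def ek)
      then show ?thesis using same[of k \<tau>] same[of "Suc k" \<tau>] k by auto
    next
      case False
      then have a: "a \<in> places m" "a \<notin> S" using that by auto
      show ?thesis using collar_or_core[OF a(1)]
      proof (elim disjE exE conjE bexE)
        fix l u assume l: "l < 2 * m" "u \<in> {0..\<tau>}" "a = inward (e l) u"
        then have "l \<notin> {k, Suc k}" using a(2) by (auto simp: S_def)
        then show ?thesis using same[of l u] l by auto
      qed (use pt_core[OF a(1)] in simp)
    qed
  qed
  moreover have "pt T (i, \<epsilon>) = pt T' (j, \<delta>)" "pt T (j, \<delta>) = pt T' (i, \<epsilon>)"
    using collar[of k 0] collar[of "Suc k" 0] pt_collar[of k 0] pt_collar[of "Suc k" 0] k tau
    by (auto simp: ek[symmetric] inward_def rot_e fall_left algebra_simps)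
  moreover have "virtuals T = virtuals T' - {X}" "under_places T = under_places T' - {P, Q}"
  proof -
    have "X \<notin> virtuals T" using X_new tangle by (auto simp: virtual_tangle_def crossing_information_def)
    then show "virtuals T = virtuals T' - {X}" by (rule_tac kind_cases) auto
    have "P \<notin> under_places T" "Q \<notin> under_places T"
      using under_places_core(2)[of P] under_places_core(2)[of Q] PQ X_new by auto
    then show "under_places T = under_places T' - {P, Q}" by (rule_tac kind_cases) auto
  qed
  moreover have "boundary_triangle m T' (i, \<epsilon>) (snd P) (j, \<delta>) (snd Q) (exp ` K)"
    using triangle by (simp add: ek)
  moreover have "X = pt T' (i, snd P)" "{(i, snd P), (j, snd Q)} = {P, Q}"
    using PQ_pair pt_PQ by simp_all
  ultimately have move:
    "boundary_triangle m T' (i, \<epsilon>) (snd P) (j, \<delta>) (snd Q) (exp ` K) \<and> X = pt T' (i, snd P) \<and>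
        s' \<in> {0<..<1} \<and> snd P \<in> open_segment \<epsilon> s' \<and> t' \<in> {0<..<1} \<and> snd Q \<in> open_segment \<delta> t' \<and>
        S = {i} \<times> closed_segment \<epsilon> s' \<union> {j} \<times> closed_segment \<delta> t' \<and>
        exp ` K \<subseteq> N \<and> N \<subseteq> disk \<and> N homeomorphic disk \<and>
        {a \<in> places m. pt T' a \<in> N} = S \<and> {a \<in> places m. pt T a \<in> N} = S \<and>
        crossings m T' \<inter> N = {X} \<and> crossings m T \<inter> N = {} \<and>
        (\<forall>a \<in> (places m - S) \<union> {(i, s'), (j, t')}. pt T a = pt T' a) \<and>
        pt T (i, \<epsilon>) = pt T' (j, \<delta>) \<and> pt T (j, \<delta>) = pt T' (i, \<epsilon>) \<and>
        virtuals T = virtuals T' - {X} \<and> under_places T = under_places T' - {(i, snd P), (j, snd Q)}"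
    using S_eq preimage_N disks by (intro conjI ballI; simp only:)
  show ?thesis
    unfolding endpoint_move_def
    by (intro conjI tangle tangle_T', rule exI[of _ i], rule exI[of _ \<epsilon>], rule exI[of _ "snd P"],
        rule exI[of _ s'], rule exI[of _ j], rule exI[of _ \<delta>], rule exI[of _ "snd Q"],
        rule exI[of _ t'], rule exI[of _ "exp ` K"], rule exI[of _ N], rule exI[of _ S], rule move)
qed

lemma P3_T':
  assumes "P3 m T" shows "P3 m T'"
proof -
  obtain T0 where T0: "(\<lambda>A B. planar_isotopic m A B \<or> move_a m A B \<or> move_b m A B)\<^sup>*\<^sup>* T T0" "trivial_tangle m T0"
    using assms by (auto simp: P3_def)
  have "move_a m T' T \<or> move_b m T' T" using endpoint_move by (auto simp: move_a_def move_b_def)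
  then have "(\<lambda>A B. planar_isotopic m A B \<or> move_a m A B \<or> move_b m A B)\<^sup>*\<^sup>* T' T0"
    by (intro converse_rtranclp_into_rtranclp[OF _ T0(1)]) blast
  then show ?thesis using T0(2) unfolding P3_def by blast
qed

end

section \<open>Trivial tangles and realizable colors\<close>

text \<open>
  The logarithm of the distance from the origin along a string that leaves the circle with unit speed,
  turns round by a parabola, and comes back with unit speed.
\<close>

definition dip :: "real \<Rightarrow> real" where
  "dip t = - t + 2 * (max (t - 1/4) 0)^2 - 2 * (max (t - 3/4) 0)^2"

definition dip' :: "real \<Rightarrow> real" where
  "dip' t = - 1 + 4 * max (t - 1/4) 0 - 4 * max (t - 3/4) 0"

lemma dip_derivative: "(dip has_real_derivative dip' t) (at t)"
  unfolding dip_def[abs_def] dip'_def by (auto intro!: derivative_eq_intros)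

lemma dip_left: "t \<le> 1/4 \<Longrightarrow> dip t = - t" "t \<le> 1/4 \<Longrightarrow> dip' t = - 1"
  by (auto simp: dip_def dip'_def max_def)

lemma dip_right: "3/4 \<le> t \<Longrightarrow> dip t = t - 1" "3/4 \<le> t \<Longrightarrow> dip' t = 1"
  by (simp_all add: dip_def dip'_def max_absorb1 power2_eq_square field_simps)

lemma dip_middle:
  assumes "1/4 < t" "t < 3/4" shows "dip t < - (1/4)"
proof -
  have "dip t = - (1/4) + 2 * ((t - 1/4) * (t - 3/4))"
    using assms by (simp add: dip_def max_absorb1 max_absorb2 power2_eq_square field_simps)
  moreover have "(t - 1/4) * (t - 3/4) < 0" using assms by (intro mult_pos_neg) auto
  ultimately show ?thesis by linarith
qed

text \<open>
  Every string stays in a sector of its own: it follows a ray inwards, changes to the next ray while it is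
  deeper than \<open>1/4\<close>, and follows that ray outwards.
\<close>

definition arches :: "nat \<Rightarrow> vdiagram" where
  "arches m = \<lparr>strand = \<lambda>i t. exp (Complex (dip t) (pi / m * (2 * real i + 1 - fall (2 * t - 1/2)))),
     under_places = {}, virtuals = {}\<rparr>"

definition arch_end :: "nat \<Rightarrow> nat \<times> real" where
  "arch_end j = (j div 2, of_nat (j mod 2))"

lemma arches_velocity:
  "(strand (arches m) i has_vector_derivative
     Complex (dip' t) (- (pi / m * 2 * fall' (2 * t - 1/2))) * pt (arches m) (i, t)) (at t)"
proof -
  have "((\<lambda>t. c * (2 * real i + 1 - fall (2 * t - 1/2))) has_real_derivative - (c * 2 * fall' (2 * t - 1/2))) (at t)" for c
    by (auto intro!: derivative_eq_intros)
  from polar_derivative[OF dip_derivative this[of "pi / m"]] show ?thesis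
    by (simp add: arches_def pt_def)
qed

lemma norm_arches: "norm (pt (arches m) (i, t)) = exp (dip t)"
  by (simp add: pt_def arches_def)

lemma arches_inj:
  assumes m: "m \<ge> 1" and ab: "a \<in> places m" "b \<in> places m" "pt (arches m) a = pt (arches m) b"
  shows "a = b"
proof -
  obtain i s j t where ij: "a = (i, s)" "b = (j, t)" by force
  then have lt: "i < m" "j < m" using ab by (auto simp: places_def)
  define y where "y i t = 2 * real i + 1 - fall (2 * t - 1/2)" for i :: nat and t
  have y: "0 \<le> y i t" "y i t \<le> 2 * m - 1" if "i < m" for i t
    using that fall_nonneg[of "2 * t - 1/2"] fall_le_1[of "2 * t - 1/2"]
    by (auto simp: y_def simp del: fall_nonneg fall_le_1)
  have eq: "exp (Complex (dip s) (pi / m * y i s)) = exp (Complex (dip t) (pi / m * y j t))"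
    using ab(3) by (simp add: ij pt_def arches_def y_def)
  have "\<bar>y i s - y j t\<bar> < 2 * m" using y[OF lt(1), of s] y[OF lt(2), of t] m by linarith
  then have "pi / m * \<bar>y i s - y j t\<bar> < pi / m * (2 * m)" using m by (intro mult_strict_left_mono) auto
  then have "\<bar>pi / m * (y i s - y j t)\<bar> < 2 * pi" using m by (simp add: abs_mult)
  then have "\<bar>pi / m * y i s - pi / m * y j t\<bar> < 2 * pi" by (simp only: right_diff_distrib)
  then have "\<bar>Im (Complex (dip s) (pi / m * y i s)) - Im (Complex (dip t) (pi / m * y j t))\<bar> < 2 * pi"
    by simp
  from exp_complex_eqI[OF this eq] have dip: "dip s = dip t" and y_eq: "y i s = y j t" using m by auto
  have "\<bar>real i - real j\<bar> < 1"
    using y_eq fall_nonneg[of "2 * s - 1/2"] fall_le_1[of "2 * s - 1/2"]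
      fall_nonneg[of "2 * t - 1/2"] fall_le_1[of "2 * t - 1/2"] unfolding y_def by linarith
  then have "i = j" by linarith
  have "\<not> s < t" if "dip s = dip t" "fall (2 * s - 1/2) = fall (2 * t - 1/2)" for s t
  proof
    assume "s < t"
    then have "\<not> (0 < 2 * t - 1/2 \<and> 2 * s - 1/2 < 1)"
      using fall_strict_antimono[of "2 * s - 1/2" "2 * t - 1/2"] that(2) by auto
    \<comment> \<open>Angles agree only if both places lie on the same ray of the string, where the depth is monotone.\<close>
    then have "t \<le> 1/4 \<or> 3/4 \<le> s" by auto
    then show False
      using \<open>s < t\<close> that(1) dip_left(1)[of s] dip_left(1)[of t] dip_right(1)[of s] dip_right(1)[of t] by auto
  qed
  from this[of s t] this[of t s] have "s = t" using dip y_eq \<open>i = j\<close> by (auto simp: y_def)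
  then show ?thesis using \<open>i = j\<close> by (simp add: ij)
qed

lemma trivial_arches:
  assumes m: "m \<ge> 1"
  shows "trivial_tangle m (arches m)"
proof -
  have no_crossing: "crossings m (arches m) = {}"
    using arches_inj[OF m] unfolding crossings_def by blast
  have velocity: "velocity (arches m) (i, t) =
      Complex (dip' t) (- (pi / m * 2 * fall' (2 * t - 1/2))) * pt (arches m) (i, t)" for i t
    using vector_derivative_at[OF arches_velocity[of m i t]] by (simp add: velocity_def)
  have dip_neg: "dip t < 0" if "0 < t" "t < 1" for t
    using that dip_left(1)[of t] dip_middle[of t] dip_right(1)[of t] by linarith
  have "properly_immersed m (arches m)"
    unfolding properly_immersed_def
  proof (intro conjI allI impI ballI)
    fix i assume "i < m"
    show "strand (arches m) i C1_differentiable_on {0..1}"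
      unfolding C1_differentiable_on_def
    proof (intro exI conjI ballI)
      show "(strand (arches m) i has_vector_derivative
        Complex (dip' t) (- (pi / m * 2 * fall' (2 * t - 1/2))) * pt (arches m) (i, t)) (at t)" for t
        by (rule arches_velocity)
      have "continuous_on {0..1} (strand (arches m) i)"
        using arches_velocity by (blast intro: continuous_at_imp_continuous_on has_vector_derivative_continuous)
      then have "continuous_on {0..1} (\<lambda>t. Complex (dip' t) (- (c * 2 * fall' (2 * t - 1/2))) *
          pt (arches m) (i, t))" for c
        unfolding Complex_eq dip'_def pt_def by (auto intro!: continuous_intros)
      then show "continuous_on {0..1} (\<lambda>t. Complex (dip' t) (- (pi / m * 2 * fall' (2 * t - 1/2))) *
          pt (arches m) (i, t))" .
    qed
  next
    fix a assume a: "a \<in> places m"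
    obtain i t where it: "a = (i, t)" by force
    then have t: "i < m" "0 \<le> t" "t \<le> 1" using a by (auto simp: places_def)
    have "Complex (dip' t) (- (pi / m * 2 * fall' (2 * t - 1/2))) \<noteq> 0"
    proof (cases "1/4 < t \<and> t < 3/4")
      case True
      then show ?thesis using fall'_neg[of "2 * t - 1/2"] m by (auto simp: complex_eq_iff)
    next
      case False
      then show ?thesis using dip_left(2)[of t] dip_right(2)[of t] by (auto simp: complex_eq_iff)
    qed
    moreover have "pt (arches m) a \<noteq> 0" by (simp add: pt_def arches_def)
    ultimately show "velocity (arches m) a \<noteq> 0" unfolding it velocity by (simp only: mult_eq_0_iff) blast
    have "exp (dip t) \<le> 1" "exp (dip t) = 1 \<longleftrightarrow> t = 0 \<or> t = 1"
      using t dip_neg[of t] dip_left(1)[of 0] dip_right(1)[of 1] by (cases "t = 0 \<or> t = 1"; force)+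
    then show "pt (arches m) a \<in> disk" "pt (arches m) a \<in> bdisk \<longleftrightarrow> a \<in> ends m"
      using t by (auto simp: it norm_arches ends_def)
  next
    fix a assume a: "a \<in> ends m"
    obtain i t where it: "a = (i, t)" by force
    then have "t = 0 \<or> t = 1" using a by (auto simp: ends_def)
    then have "velocity (arches m) a = dip' t *\<^sub>R pt (arches m) a" "dip' t \<noteq> 0"
      by (auto simp: it velocity fall'_left fall'_right dip_left dip_right Complex_eq)
    moreover have "pt (arches m) a \<noteq> 0" by (simp add: pt_def arches_def)
    ultimately show "velocity (arches m) a \<bullet> pt (arches m) a \<noteq> 0" by simp
  qed
  moreover have "transverse_double_points m (arches m)"
    using arches_inj[OF m] by (auto simp: transverse_double_points_def no_crossing)
  moreover have "crossing_information m (arches m)"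
    using arches_inj[OF m] by (auto simp: crossing_information_def arches_def)
  ultimately show ?thesis by (simp add: trivial_tangle_def virtual_tangle_def no_crossing)
qed

lemma collared_arches:
  assumes m: "m \<ge> 1"
  shows "collared m (arches m) arch_end (1/4)"
  unfolding collared_def
proof (intro conjI allI impI ballI)
  show "virtual_tangle m (arches m)" using trivial_arches[OF m] by (simp add: trivial_tangle_def)
  show "bij_betw arch_end {..<2 * m} (ends m)"
    unfolding bij_betw_def
  proof
    show "inj_on arch_end {..<2 * m}"
      by (rule inj_onI) (metis arch_end_def div_mult_mod_eq of_nat_eq_iff prod.inject)
    have "(i, t) \<in> arch_end ` {..<2 * m}" if "i < m" "t = 0 \<or> t = 1" for i t
      using that(2)
    proof
      assume "t = 0"
      then show ?thesis using that by (intro image_eqI[of _ _ "2 * i"]) (auto simp: arch_end_def)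
    next
      assume "t = 1"
      then show ?thesis using that by (intro image_eqI[of _ _ "2 * i + 1"]) (auto simp: arch_end_def)
    qed
    moreover have "arch_end j \<in> ends m" if "j < 2 * m" for j
      using that by (cases "even j") (auto simp: arch_end_def ends_def odd_iff_mod_2_eq_one)
    ultimately show "arch_end ` {..<2 * m} = ends m"
      unfolding ends_def by (intro equalityI image_subsetI subrelI) auto
  qed
  fix j u assume j: "j < 2 * m" and u: "u \<le> (1/4 :: real)"
  show "pt (arches m) (inward (arch_end j) u) = exp (Complex (- u) (pi / m * j))"
  proof (cases "even j")
    case True
    then obtain i where "j = 2 * i" by (auto elim: evenE)
    then show ?thesis using u by (simp add: arch_end_def inward_def pt_def arches_def dip_left fall_left)
  next
    case False
    then obtain i where "j = 2 * i + 1" by (auto elim: oddE)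
    then show ?thesis using u
      by (simp add: arch_end_def inward_def pt_def arches_def dip_right fall_right add.commute)
  qed
next
  fix a assume a: "a \<in> places m"
  obtain i t where it: "a = (i, t)" by force
  then have t: "i < m" "0 \<le> t" "t \<le> 1" using a by (auto simp: places_def)
  consider "t \<le> 1/4" | "1/4 < t" "t < 3/4" | "3/4 \<le> t" by linarith
  then show "(\<exists>j<2 * m. \<exists>u\<in>{0..1/4}. a = inward (arch_end j) u) \<or> norm (pt (arches m) a) < exp (- (1/4))"
  proof cases
    case 1
    then show ?thesis using t
      by (intro disjI1 exI[of _ "2 * i"] conjI bexI[of _ t]) (auto simp: it arch_end_def inward_def)
  next
    case 2
    then show ?thesis using dip_middle[of t] by (simp add: it norm_arches)
  next
    case 3
    then show ?thesis using t
      by (intro disjI1 exI[of _ "2 * i + 1"] conjI bexI[of _ "1 - t"]) (auto simp: it arch_end_def inward_def)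
  qed
qed auto

text \<open>
  The vectors modulo \<open>p\<close> that are boundaries of collared diagrams with at most \<open>n\<close> virtual crossings which
  boundary moves make trivial. The colors are integers, taken modulo \<open>p\<close> only at the end.
\<close>

definition realizable :: "int \<Rightarrow> nat \<Rightarrow> nat \<Rightarrow> (nat \<Rightarrow> int) \<Rightarrow> bool" where
  "realizable p m n v \<longleftrightarrow>
     (\<exists>T e \<tau> \<kappa>. collared m T e \<tau> \<and> place_coloring p m T \<kappa> \<and> (\<forall>j<2 * m. [\<kappa> (e j) = v j] (mod p)) \<and>
        finite (virtuals T) \<and> card (virtuals T) \<le> n \<and> P3 m T)"

lemma realizable_arches:
  assumes "m \<ge> 1" and v: "\<And>i. i < m \<Longrightarrow> [v (2 * i) = v (2 * i + 1)] (mod p)"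
  shows "realizable p m 0 v"
proof -
  define \<kappa> :: "nat \<times> real \<Rightarrow> int" where "\<kappa> a = v (2 * fst a)" for a
  have "place_coloring p m (arches m) \<kappa>" by (auto simp: place_coloring_def \<kappa>_def arches_def)
  moreover have "[\<kappa> (arch_end j) = v j] (mod p)" if "j < 2 * m" for j
    using v[of "j div 2"] that by (cases "even j") (auto simp: \<kappa>_def arch_end_def elim!: evenE oddE)
  moreover have "P3 m (arches m)" using trivial_arches[OF assms(1)] unfolding P3_def by blast
  ultimately show ?thesis
    using collared_arches[OF assms(1)] unfolding realizable_def
    by (intro exI[of _ "arches m"] exI[of _ arch_end] exI[of _ "1/4"] exI[of _ \<kappa>]) (auto simp: arches_def)
qed

lemma realizable_virtual_swap:
  assumes v: "realizable p m n v" and k: "Suc k < 2 * m"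
  shows "realizable p m (Suc n) (v(k := v (Suc k), Suc k := v k))"
proof -
  obtain T e \<tau> \<kappa> where T: "collared m T e \<tau>" "place_coloring p m T \<kappa>" "\<forall>j<2 * m. [\<kappa> (e j) = v j] (mod p)"
      "finite (virtuals T)" "card (virtuals T) \<le> n" "P3 m T"
    using v unfolding realizable_def by blast
  interpret twist m T e \<tau> k "{}" "{exp (Complex (- (3 * \<tau> / 4)) (pi / m * (k + 1/2)))}"
    by unfold_locales (use T(1) k in auto)
  have same: "under_places T' = under_places T" and virt: "virtuals T' = insert X (virtuals T)"
    unfolding T'_sel X_def gap_def by simp_all
  have "place_coloring p m T' \<kappa>"
    unfolding place_coloring_def same
  proof (intro conjI allI impI)
    show "\<kappa> (i, s) = \<kappa> (i, t)" if "i < m" "0 \<le> s \<and> s \<le> t \<and> t \<le> 1 \<and> ({i} \<times> {s..t}) \<inter> under_places T = {}" for i s t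
      using T(2) that unfolding place_coloring_def by blast
    fix i u b s t
    assume h: "(i, u) \<in> under_places T \<and> b \<in> places m \<and> b \<noteq> (i, u) \<and> pt T' b = pt T' (i, u) \<and> 0 \<le> s \<and> s < u \<and>
      u < t \<and> t \<le> 1 \<and> {i} \<times> {s..t} \<inter> under_places T = {(i, u)}"
    then have "norm (pt T b) = norm (pt T (i, u))" using norm_pt_T' by metis
    then have "pt T b = pt T (i, u)"
      using h under_places_core[of "(i, u)"] pt_core[of b] pt_core[of "(i, u)"] by auto
    then show "[\<kappa> (i, s) + \<kappa> (i, t) = 2 * \<kappa> b] (mod p)"
      using T(2)[unfolded place_coloring_def, THEN conjunct2, rule_format, of i u b s t] h by auto
  qed
  moreover have "[\<kappa> (e' j) = (v(k := v (Suc k), Suc k := v k)) j] (mod p)" if "j < 2 * m" for j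
    using T(3) that k by (auto simp: e'_def)
  moreover have "card (virtuals T') \<le> Suc n" unfolding virt using T(4,5) by (simp add: card_insert_if)
  moreover have "finite (virtuals T')" unfolding virt using T(4) by simp
  ultimately show ?thesis
    using collared_T' P3_T'[OF T(6)] unfolding realizable_def by blast
qed

text \<open>
  The string that starts at the end number \<open>j\<close> runs under the one that starts at the end number \<open>j'\<close>.
\<close>

lemma realizable_classical:
  assumes v: "realizable p m n v" and k: "Suc k < 2 * m"
    and j: "j = k \<and> j' = Suc k \<or> j = Suc k \<and> j' = k"
  shows "realizable p m n (v(j := v j', j' := 2 * v j' - v j))"
proof -
  obtain T e \<tau> \<kappa> where T: "collared m T e \<tau>" "place_coloring p m T \<kappa>" "\<forall>j<2 * m. [\<kappa> (e j) = v j] (mod p)"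
      "finite (virtuals T)" "card (virtuals T) \<le> n" "P3 m T"
    using v unfolding realizable_def by blast
  interpret twist m T e \<tau> k "{inward (e j) (3 * \<tau> / 4)}" "{}"
    by unfold_locales (use T(1) k j in auto)
  have under: "under_places T' = insert (inward (e j) (3 * \<tau> / 4)) (under_places T)"
    and virt: "virtuals T' = virtuals T"
    unfolding T'_sel by simp_all
  obtain \<kappa>' where \<kappa>': "place_coloring p m T' \<kappa>'" "\<kappa>' (e j) = 2 * \<kappa> (e j') - \<kappa> (e j)"
    "\<And>i. i < 2 * m \<Longrightarrow> i \<noteq> j \<Longrightarrow> \<kappa>' (e i) = \<kappa> (e i)"
    using recolor[OF T(2) j under] by blast
  have jj: "j < 2 * m" "j' < 2 * m" "j \<noteq> j'" using j k by auto
  have new: "[\<kappa>' (e j) = 2 * v j' - v j] (mod p)" "[\<kappa>' (e j') = v j'] (mod p)"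
    using T(3) jj \<kappa>'(2) \<kappa>'(3)[of j'] by (auto intro!: cong_diff cong_mult)
  have "[\<kappa>' (e' i) = (v(j := v j', j' := 2 * v j' - v j)) i] (mod p)" if "i < 2 * m" for i
  proof -
    have "e' i = (if i = j then e j' else if i = j' then e j else e i)" using j by (auto simp: e'_def)
    then show ?thesis using new jj \<kappa>'(3)[of i] T(3) that by auto
  qed
  then show ?thesis
    using collared_T' P3_T'[OF T(6)] \<kappa>'(1) T(4,5) unfolding realizable_def virt[symmetric] by blast
qed

section \<open>Reducing the colors to those of a trivial tangle\<close>

text \<open>
  In terms of the differences \<open>d = y - x\<close> and \<open>d' = z - y\<close> the four replacements change \<open>d'\<close> to \<open>d' - d\<close> or
  \<open>d' + d\<close>, and \<open>d\<close> to \<open>d + d'\<close> or \<open>d - d'\<close>. One of them makes the difference of larger absolute value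
  smaller, until one of the differences is \<open>0\<close>. All of them preserve \<open>x - y + z\<close>.
\<close>

lemma euclid_on_triples:
  fixes P :: "int \<Rightarrow> int \<Rightarrow> int \<Rightarrow> bool"
  assumes R1: "\<And>x y z. P y (2 * y - x) z \<Longrightarrow> P x y z" and L1: "\<And>x y z. P (2 * x - y) x z \<Longrightarrow> P x y z"
    and R2: "\<And>x y z. P x z (2 * z - y) \<Longrightarrow> P x y z" and L2: "\<And>x y z. P x (2 * y - z) y \<Longrightarrow> P x y z"
    and equal: "\<And>x. P x x s"
  shows "x - y + z = s \<Longrightarrow> P x y z"
proof (induction "nat \<bar>y - x\<bar> + nat \<bar>z - y\<bar>" arbitrary: x y z rule: less_induct)
  case less
  consider "x = y" | "y = z" | "x \<noteq> y" "\<bar>y - x\<bar> \<le> \<bar>z - y\<bar>" | "y \<noteq> z" "\<bar>z - y\<bar> < \<bar>y - x\<bar>" by linarith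
  then show ?case
  proof cases
    case 1
    then show ?thesis using equal[of x] less.prems by simp
  next
    case 2
    then have "P (2 * x - y) (2 * x - y) x" using equal[of "2 * x - y"] less.prems by simp
    then show ?thesis using L1 L2 2 by blast
  next
    case 3
    \<comment> \<open>Subtract the first difference from the second, or add it, according to their signs.\<close>
    show ?thesis
    proof (cases "(0 < y - x) = (0 < z - y)")
      case True
      show ?thesis by (rule R1, rule less.hyps) (use 3 True less.prems in auto)
    next
      case False
      show ?thesis by (rule L1, rule less.hyps) (use 3 False less.prems in auto)
    qed
  next
    case 4
    show ?thesis
    proof (cases "(0 < y - x) = (0 < z - y)")
      case True
      show ?thesis by (rule L2, rule less.hyps) (use 4 True less.prems in auto)
    next
      case False
      show ?thesis by (rule R2, rule less.hyps) (use 4 False less.prems in auto)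
    qed
  qed
qed

text \<open>
  The two classical replacements are inverse to each other, so realizability can be traced backwards.
\<close>

lemma realizable_right:
  assumes "realizable p m n (v(k := v (Suc k), Suc k := 2 * v (Suc k) - v k))" "Suc k < 2 * m"
  shows "realizable p m n v"
proof -
  have "v = (v(k := v (Suc k), Suc k := 2 * v (Suc k) - v k))(Suc k := v (Suc k), k := v k)" by auto
  then show ?thesis using realizable_classical[OF assms, of "Suc k" k] by simp
qed

lemma realizable_left:
  assumes "realizable p m n (v(k := 2 * v k - v (Suc k), Suc k := v k))" "Suc k < 2 * m"
  shows "realizable p m n v"
proof -
  have "v = (v(k := 2 * v k - v (Suc k), Suc k := v k))(k := v k, Suc k := v (Suc k))" by auto
  then show ?thesis using realizable_classical[OF assms, of k "Suc k"] by simp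
qed

lemma equalize_pair:
  assumes k: "Suc (Suc k) < 2 * m"
    and equal: "\<And>w. w k = w (Suc k) \<Longrightarrow> w (Suc (Suc k)) = v k - v (Suc k) + v (Suc (Suc k)) \<Longrightarrow>
      (\<And>i. i < k \<or> Suc (Suc k) < i \<Longrightarrow> w i = v i) \<Longrightarrow> realizable p m n w"
  shows "realizable p m n v"
proof -
  define f where "f x y z = v(k := x, Suc k := y, Suc (Suc k) := z)" for x y z
  have upd: "(f x y z)(k := a, Suc k := b) = f a b z" "(f x y z)(Suc k := b, Suc (Suc k) := c) = f x b c"
    and at: "f x y z k = x" "f x y z (Suc k) = y" "f x y z (Suc (Suc k)) = z" for x y z a b c
    by (auto simp: f_def)
  have "realizable p m n (f x y z)" if "x - y + z = v k - v (Suc k) + v (Suc (Suc k))" for x y z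
  proof (rule euclid_on_triples[where P = "\<lambda>x y z. realizable p m n (f x y z)", OF _ _ _ _ _ that])
    show "realizable p m n (f x y z)" if "realizable p m n (f y (2 * y - x) z)" for x y z
      by (rule realizable_right[of _ _ _ _ k]) (use that k in \<open>simp_all add: upd at\<close>)
    show "realizable p m n (f x y z)" if "realizable p m n (f (2 * x - y) x z)" for x y z
      by (rule realizable_left[of _ _ _ _ k]) (use that k in \<open>simp_all add: upd at\<close>)
    show "realizable p m n (f x y z)" if "realizable p m n (f x z (2 * z - y))" for x y z
      by (rule realizable_right[of _ _ _ _ "Suc k"]) (use that k in \<open>simp_all add: upd at\<close>)
    show "realizable p m n (f x y z)" if "realizable p m n (f x (2 * y - z) y)" for x y z
      by (rule realizable_left[of _ _ _ _ "Suc k"]) (use that k in \<open>simp_all add: upd at\<close>)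
    show "realizable p m n (f x x (v k - v (Suc k) + v (Suc (Suc k))))" for x
      by (rule equal) (auto simp: at f_def)
  qed
  then have "realizable p m n (f (v k) (v (Suc k)) (v (Suc (Suc k))))" by simp
  moreover have "f (v k) (v (Suc k)) (v (Suc (Suc k))) = v" by (auto simp: f_def)
  ultimately show ?thesis by simp
qed

text \<open>
  If all pairs but the last two are equal, one more run of the Euclidean algorithm on the first three of
  the last four colors makes the last but one pair equal. The third color is then the alternating sum
  of the three, which the hypothesis makes equal to the fourth color.
\<close>

lemma realizable_alternating_sum_zero:
  assumes q: "2 * m = q + 4" "even q"
    and pairs: "\<And>i. 2 * i < q \<Longrightarrow> v (2 * i) = v (2 * i + 1)"
    and sum: "[v q - v (q + 1) + v (q + 2) = v (q + 3)] (mod p)"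
  shows "realizable p m 0 v"
proof (rule equalize_pair[of q])
  show "Suc (Suc q) < 2 * m" using q by simp
  fix w assume w: "w q = w (Suc q)" "w (Suc (Suc q)) = v q - v (Suc q) + v (Suc (Suc q))"
    "\<And>i. i < q \<or> Suc (Suc q) < i \<Longrightarrow> w i = v i"
  show "realizable p m 0 w"
  proof (rule realizable_arches)
    show "m \<ge> 1" using q by simp
    fix i assume "i < m"
    then have "2 * i < q \<or> 2 * i = q \<or> 2 * i = q + 2" using q by presburger
    then consider "2 * i < q" | "2 * i = q" | "2 * i = q + 2" by blast
    then show "[w (2 * i) = w (2 * i + 1)] (mod p)"
    proof cases
      case 1
      then have "Suc (2 * i) < q" using q(2) by (metis Suc_lessI even_Suc even_mult_iff even_numeral)
      then show ?thesis using pairs[OF 1] w(3)[of "2 * i"] w(3)[of "2 * i + 1"] by simp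
    next
      case 2
      then show ?thesis using w(1) by simp
    next
      case 3
      have "2 * i = Suc (Suc q)" "2 * i + 1 = q + 3" using 3 by simp_all
      moreover have "w (q + 3) = v (q + 3)" using w(3)[of "q + 3"] by simp
      ultimately show ?thesis using sum w(2) by (simp only:) simp
    qed
  qed
qed

text \<open>
  The replacement \<open>(x, y, z, u) \<mapsto> (2 x - y, x, u, 2 u - z)\<close> preserves the outer differences and adds
  \<open>u - x\<close> to the inner difference. After \<open>n = (p - 1) / 2\<close> of them the virtual interchange of the inner
  colors makes the alternating sum a multiple of \<open>p\<close>; here \<open>p\<close> has to be odd.
\<close>

lemma realizable_one_virtual_last_four:
  assumes q: "2 * m = q + 4" "even q" and p: "odd p" "p \<ge> 3"
    and pairs: "\<And>i. 2 * i < q \<Longrightarrow> v (2 * i) = v (2 * i + 1)"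
    and mid: "v (q + 1) = v (q + 2)"
  shows "realizable p m 1 v"
proof -
  define f where "f x y z u = v(q := x, q + 1 := y, q + 2 := z, q + 3 := u)" for x y z u
  have at: "f x y z u q = x" "f x y z u (Suc q) = y" "f x y z u (Suc (Suc q)) = z"
      "f x y z u (Suc (Suc (Suc q))) = u" and off: "i < q \<Longrightarrow> f x y z u i = v i" for x y z u i
    by (auto simp: f_def)
  have upd: "(f x y z u)(q := a, Suc q := b) = f a b z u" "(f x y z u)(Suc q := a, Suc (Suc q) := b) = f x a b u"
      "(f x y z u)(Suc (Suc q) := a, Suc (Suc (Suc q)) := b) = f x y a b" for x y z u a b
    by (auto simp: f_def fun_eq_iff)
  define n where "n = (p - 1) div 2"
  have n: "2 * n = p - 1" "n \<ge> 0" using p by (auto simp: n_def elim!: oddE)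
  define x y u where "x = v q" and "y = v (q + 1)" and "u = v (q + 3)"
  have v: "v = f x y y u" using mid by (auto simp: f_def x_def y_def u_def fun_eq_iff)
  have shift: "realizable p m 1 (f x y z u)"
    if "realizable p m 1 (f (2 * x - y) x u (2 * u - z))" for x y z u
  proof -
    have "realizable p m 1 (f (2 * x - y) x z u)"
      by (rule realizable_right[of _ _ _ _ "Suc (Suc q)"]) (use that q in \<open>simp_all add: upd at\<close>)
    then show ?thesis
      by (intro realizable_left[of _ _ _ "f x y z u" q]) (use q in \<open>simp_all add: upd at\<close>)
  qed
  have shift_n: "realizable p m 1 (f x y z u)"
    if "realizable p m 1 (f (x - int l * (y - x)) (y - int l * (y - x)) (z + int l * (u - z)) (u + int l * (u - z)))"
    for l x y z u
    using that
  proof (induction l arbitrary: x y z u)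
    case (Suc l)
    show ?case
      by (rule shift, rule Suc.IH) (use Suc.prems in \<open>simp add: algebra_simps\<close>)
  qed simp
  define x' y' z' u' where "x' = x - n * (y - x)" and "y' = y - n * (y - x)"
    and "z' = y + n * (u - y)" and "u' = u + n * (u - y)"
  have "realizable p m 0 (f x' z' y' u')"
  proof (rule realizable_alternating_sum_zero[OF q])
    show "f x' z' y' u' (2 * i) = f x' z' y' u' (2 * i + 1)" if "2 * i < q" for i
      using pairs[OF that] that q(2) off[of "2 * i"] off[of "2 * i + 1"]
      by (metis Suc_eq_plus1 Suc_lessI even_Suc even_mult_iff even_numeral)
    have "x' - z' + y' - u' = (x - u) - (2 * n) * (u - x)"
      by (simp add: x'_def y'_def z'_def u'_def algebra_simps)
    also have "\<dots> = p * (x - u)" unfolding n(1) by (simp add: algebra_simps)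
    finally have "x' - z' + y' - u' = p * (x - u)" .
    then have "[x' - z' + y' = u'] (mod p)" by (simp add: cong_iff_dvd_diff)
    then show "[f x' z' y' u' q - f x' z' y' u' (q + 1) + f x' z' y' u' (q + 2) = f x' z' y' u' (q + 3)] (mod p)"
      by (simp add: at numeral_eq_Suc)
  qed
  from realizable_virtual_swap[OF this, of "Suc q"] have "realizable p m 1 (f x' y' z' u')"
    using q by (simp add: upd at)
  then have "realizable p m 1 (f x y y u)"
    by (intro shift_n[of x "nat n" y y u]) (use n(2) in \<open>simp add: x'_def y'_def z'_def u'_def\<close>)
  then show ?thesis using v by simp
qed

text \<open>
  From the left, pair after pair is made equal until four colors remain.
\<close>

theorem realizable_one_virtual:
  assumes m: "m \<ge> 2" and p: "odd p" "p \<ge> 3"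
  shows "realizable p m 1 v"
proof -
  define q where "q = 2 * m - 4"
  have q: "2 * m = q + 4" "even q" using m by (auto simp: q_def)
  have all: "realizable p m 1 v" if "r \<le> m - 2" "\<And>i. i < r \<Longrightarrow> v (2 * i) = v (2 * i + 1)" for r v
    using that
  proof (induction arbitrary: v rule: inc_induct)
    case base
    show ?case
    \<comment> \<open>On the last three of the four remaining colors, so that the two inner ones become equal.\<close>
    proof (rule equalize_pair[of "q + 1"])
      show "Suc (Suc (q + 1)) < 2 * m" using q by simp
      fix w assume w: "w (q + 1) = w (Suc (q + 1))" "\<And>i. i < q + 1 \<or> Suc (Suc (q + 1)) < i \<Longrightarrow> w i = v i"
      show "realizable p m 1 w"
      proof (rule realizable_one_virtual_last_four[OF q p])
        show "w (2 * i) = w (2 * i + 1)" if "2 * i < q" for i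
          using base[of i] w(2)[of "2 * i"] w(2)[of "2 * i + 1"] that by (auto simp: q_def)
        show "w (q + 1) = w (q + 2)" using w(1) by simp
      qed
    qed
  next
    case (step r)
    show ?case
    proof (rule equalize_pair[of "2 * r"])
      show "Suc (Suc (2 * r)) < 2 * m" using step.hyps by simp
      fix w assume w: "w (2 * r) = w (Suc (2 * r))" "\<And>i. i < 2 * r \<or> Suc (Suc (2 * r)) < i \<Longrightarrow> w i = v i"
      show "realizable p m 1 w"
      proof (rule step.IH)
        show "w (2 * i) = w (2 * i + 1)" if "i < Suc r" for i
          using that w(1) step.prems[of i] w(2)[of "2 * i"] w(2)[of "2 * i + 1"] by (cases "i = r") auto
      qed
    qed
  qed
  show ?thesis by (rule all[of 0]) auto
qed

lemma realizable_diagram: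
  assumes real: "realizable p m n v" and p: "p > 0" and v: "\<And>j. j < 2 * m \<Longrightarrow> v j \<in> {0..<p}"
  obtains T C where "colored_diagram p m T C" "boundary_colors m T C (map v [0..<2 * m])"
    "finite (virtuals T)" "card (virtuals T) \<le> n" "P3 m T"
proof -
  obtain T e \<tau> \<kappa> where T: "collared m T e \<tau>" "place_coloring p m T \<kappa>" "\<forall>j<2 * m. [\<kappa> (e j) = v j] (mod p)"
      "finite (virtuals T)" "card (virtuals T) \<le> n" "P3 m T"
    using real unfolding realizable_def by blast
  obtain C where C: "coloring p m T C" "\<And>a x. x \<in> arcs m T \<Longrightarrow> a \<in> x \<Longrightarrow> C x = \<kappa> a mod p"
    using coloring_from_places[OF T(2) p] by blast
  have tangle: "virtual_tangle m T" and e: "bij_betw e {..<2 * m} (ends m)" and \<tau>: "0 < \<tau>"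
    and collar: "\<And>j u. j < 2 * m \<Longrightarrow> u \<le> \<tau> \<Longrightarrow> pt T (inward (e j) u) = exp (Complex (- u) (pi / m * j))"
    using T(1) by (simp_all add: collared_def)
  have pt: "pt T (e j) = exp (Complex 0 (pi / m * j))" if "j < 2 * m" for j
    using collar[OF that, of 0] \<tau> by (simp add: inward_def)
  have "boundary_colors m T C (map v [0..<2 * m])"
    unfolding boundary_colors_def
  proof (intro conjI exI[of _ e] exI[of _ "\<lambda>j::nat. pi / m * real j"] allI impI)
    show "strict_mono_on {..<2 * m} (\<lambda>j::nat. pi / m * real j)"
      unfolding strict_mono_on_def by (auto intro!: divide_strict_right_mono)
    fix j assume j: "j < 2 * m"
    then have "pi / m * j < pi / m * (2 * m)" by (intro mult_strict_left_mono) auto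
    then show "pi / m * real j < pi / m * real 0 + 2 * pi" using j by simp
    show "pt T (e j) = cis (pi / m * real j)" using pt[OF j] by (simp add: exp_eq_polar)
    have end_j: "e j \<in> ends m" using e j by (auto dest: bij_betwE)
    then have place: "e j \<in> places m" by (auto simp: ends_def places_def)
    have "e j \<notin> under_places T"
      using tangle end_j place by (auto simp: virtual_tangle_def crossing_information_def
        transverse_double_points_def properly_immersed_def)
    then obtain x where x: "x \<in> arcs m T" "e j \<in> x" using arc_through_place[OF place] by blast
    have "C x = v j" using C(2)[OF x] T(3) v[OF j] j by (simp add: cong_def)
    then show "\<exists>x\<in>arcs m T. e j \<in> x \<and> C x = map v [0..<2 * m] ! j" using x j by auto
  qed (use e in auto)
  then show ?thesis using that C(1) tangle T by (simp add: colored_diagram_def)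
qed

section \<open>One string\<close>

text \<open>
  The string is the curve with polar angle \<open>\<theta>\<close> running from \<open>\<delta>\<close> to \<open>4 \<pi> - \<delta>\<close> and radius
  \<open>1/2 + c (2 + cos (\<theta> / 2)) cos (p \<theta> / 2)\<close>, where \<open>c\<close> makes the radius at the ends \<open>1\<close>. As \<open>p\<close> is odd, the factor
  \<open>cos (p \<theta> / 2)\<close> changes its sign from one turn to the next, so the two turns cross where it is \<open>0\<close>. The
  positive factor in front of it is largest at the ends; the last assumption, true for all small \<open>\<delta>\<close>,
  ensures that the ends are the only points on the unit circle.
\<close>

locale spiral =
  fixes p :: nat and \<delta> :: real
  assumes odd: "odd p" and p3: "p \<ge> 3" and delta: "0 < \<delta>" "\<delta> < pi / p"
    and small: "2 + cos (pi / (2 * real p)) < (2 + cos (\<delta> / 2)) * cos (real p * \<delta> / 2)"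
begin

text \<open>
  The oscillating part of the radius.
\<close>

definition W :: "real \<Rightarrow> real" where "W \<theta> = (2 + cos (\<theta> / 2)) * cos (real p * \<theta> / 2)"

definition W' :: "real \<Rightarrow> real" where
  "W' \<theta> = - (sin (\<theta> / 2) / 2 * cos (real p * \<theta> / 2)) - (2 + cos (\<theta> / 2)) * (p / 2 * sin (real p * \<theta> / 2))"

definition radius :: "real \<Rightarrow> real" where "radius \<theta> = (1 + W \<theta> / W \<delta>) / 2"

definition angle :: "real \<Rightarrow> real" where "angle t = \<delta> + (4 * pi - 2 * \<delta>) * t"

text \<open>
  The zeros of \<open>cos (p \<theta> / 2)\<close>. Since \<open>\<Theta> (n + p) = \<Theta> n + 2 \<pi>\<close>, the passages \<open>n\<close> and \<open>n + p\<close> meet in a crossing.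
\<close>

definition \<Theta> :: "nat \<Rightarrow> real" where "\<Theta> n = (2 * real n + 1) * pi / p"

definition passage :: "nat \<Rightarrow> nat \<times> real" where
  "passage n = (0, (\<Theta> n - \<delta>) / (4 * pi - 2 * \<delta>))"

definition curve :: "real \<Rightarrow> complex" where
  "curve t = exp (Complex (ln (radius (angle t))) (angle t))"

text \<open>
  The passages alternate between over and under along the string, odd ones being under. The last
  crossing, where the passages \<open>p - 1\<close> and \<open>2 p - 1\<close> meet, is virtual.
\<close>

definition T :: vdiagram where
  "T = \<lparr>strand = \<lambda>_. curve, under_places = passage ` {n. odd n \<and> n < 2 * p - 1},
     virtuals = {curve (snd (passage (p - 1)))}\<rparr>"

lemma W_derivative: "(W has_real_derivative W' \<theta>) (at \<theta>)"
  unfolding W_def[abs_def] W'_def by (auto intro!: derivative_eq_intros)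

lemma p_pos: "0 < real p" and pi_p: "pi / p \<le> pi / 3" and delta_pi: "\<delta> < pi"
proof -
  show "0 < real p" using p3 by simp
  show le: "pi / p \<le> pi / 3" using p3 by (intro divide_left_mono) auto
  show "\<delta> < pi" using le delta pi_gt_zero by linarith
qed

lemma len: "0 < 4 * pi - 2 * \<delta>" using delta_pi pi_gt_zero by linarith

lemma p_delta: "0 < real p * \<delta> / 2" "real p * \<delta> / 2 < pi / 2"
  using delta p_pos by (auto simp: field_simps)

lemma cos_shift: "cos (real p * (\<theta> + 2 * pi) / 2) = - cos (real p * \<theta> / 2)"
  "sin (real p * (\<theta> + 2 * pi) / 2) = - sin (real p * \<theta> / 2)"
proof -
  have *: "real p * (\<theta> + 2 * pi) / 2 = real p * \<theta> / 2 + real p * pi" by (simp add: field_simps)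
  have "cos (real p * pi) = - 1" using odd by (simp add: cos_npi)
  then show "cos (real p * (\<theta> + 2 * pi) / 2) = - cos (real p * \<theta> / 2)"
    "sin (real p * (\<theta> + 2 * pi) / 2) = - sin (real p * \<theta> / 2)"
    unfolding * by (simp_all add: cos_add sin_add)
qed

lemma half_shift: "cos ((\<theta> + 2 * pi) / 2) = - cos (\<theta> / 2)" 
  by (simp add: add_divide_distrib)

text \<open>
  The positive factors on the two turns add up to the constant \<open>4\<close>, so the difference of the two
  turns is a pure cosine; it has simple zeros, whence the crossings are transverse.
\<close>

lemma W_shift: "W \<theta> - W (\<theta> + 2 * pi) = 4 * cos (real p * \<theta> / 2)"
  unfolding W_def cos_shift half_shift by (simp add: algebra_simps)

lemma W'_shift: "W' \<theta> - W' (\<theta> + 2 * pi) = - (2 * real p * sin (real p * \<theta> / 2))"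
proof -
  have "sin ((\<theta> + 2 * pi) / 2) = - sin (\<theta> / 2)" by (simp add: add_divide_distrib)
  then show ?thesis unfolding W'_def cos_shift half_shift by (simp add: algebra_simps)
qed

lemma W_reflect: "W (4 * pi - \<theta>) = W \<theta>" "W' (4 * pi - \<theta>) = - W' \<theta>"
proof -
  have p: "real p * (4 * pi - \<theta>) / 2 = 2 * real p * pi - real p * \<theta> / 2" by (simp add: field_simps)
  have h: "(4 * pi - \<theta>) / 2 = 2 * pi - \<theta> / 2" by (simp add: field_simps)
  have "cos (2 * real p * pi) = 1" "sin (2 * real p * pi) = 0" by (simp_all add: cos_2npi sin_2npi)
  then have c: "cos (2 * real p * pi - real p * \<theta> / 2) = cos (real p * \<theta> / 2)" "sin (2 * real p * pi - real p * \<theta> / 2) = - sin (real p * \<theta> / 2)"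
    by (simp_all add: cos_diff sin_diff)
  have d: "cos (2 * pi - \<theta> / 2) = cos (\<theta> / 2)" "sin (2 * pi - \<theta> / 2) = - sin (\<theta> / 2)"
    by (simp_all add: cos_diff sin_diff)
  show "W (4 * pi - \<theta>) = W \<theta>" "W' (4 * pi - \<theta>) = - W' \<theta>"
    unfolding W_def W'_def p h c d by (simp_all add: algebra_simps)
qed

lemma W_delta: "0 < W \<delta>" "W' \<delta> < 0"
proof -
  have pos: "0 < cos (real p * \<delta> / 2)" "0 < sin (real p * \<delta> / 2)" "0 < sin (\<delta> / 2)" "0 < cos (\<delta> / 2)"
    using p_delta delta delta_pi by (auto intro!: cos_gt_zero sin_gt_zero)
  then show "0 < W \<delta>" by (simp add: W_def)
  have "0 < sin (\<delta> / 2) / 2 * cos (real p * \<delta> / 2)"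
      "0 < (2 + cos (\<delta> / 2)) * (p / 2 * sin (real p * \<delta> / 2))"
    using pos p_pos by (auto intro!: mult_pos_pos)
  then show "W' \<delta> < 0" unfolding W'_def by linarith
qed

text \<open>
  Up to the first zero of the cosine both factors decrease.
\<close>

lemma W_small_first: "\<delta> < \<theta> \<Longrightarrow> \<theta> \<le> pi / p \<Longrightarrow> \<bar>W \<theta>\<bar> < W \<delta>"
proof -
  assume \<theta>: "\<delta> < \<theta>" "\<theta> \<le> pi / p"
  have "real p * \<theta> / 2 \<le> pi / 2" using \<theta> p_pos by (simp add: field_simps)
  moreover have "\<theta> / 2 \<le> pi / 2" using \<theta> pi_p pi_gt_zero by linarith
  ultimately have le: "real p * \<theta> / 2 \<le> pi / 2" "\<theta> / 2 \<le> pi / 2" .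
  have "0 \<le> cos (real p * \<theta> / 2)" using le \<theta> delta p_pos by (intro cos_ge_zero) (auto intro: order_trans[of _ 0])
  moreover have "cos (real p * \<theta> / 2) < cos (real p * \<delta> / 2)"
    by (rule cos_monotone_0_pi) (use \<theta> le delta p_pos in auto)
  moreover have "cos (\<theta> / 2) \<le> cos (\<delta> / 2)"
    by (rule cos_monotone_0_pi_le) (use \<theta> le delta in auto)
  moreover have "0 \<le> cos (\<theta> / 2)" using le \<theta> delta by (intro cos_ge_zero) auto
  ultimately show ?thesis unfolding W_def by (simp add: abs_mult mult_le_less_imp_less)
qed

lemma W_small_middle:
  assumes "pi / p \<le> \<theta>" "\<theta> \<le> 4 * pi - pi / p" shows "\<bar>W \<theta>\<bar> < W \<delta>"
proof -
  have pp: "pi / (2 * real p) = pi / p / 2" by simp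
  have "cos (\<theta> / 2) \<le> cos (pi / (2 * real p))"
  proof (cases "\<theta> / 2 \<le> pi")
    case True
    then show ?thesis unfolding pp using assms p_pos by (intro cos_monotone_0_pi_le) auto
  next
    case False
    have "cos (2 * pi - \<theta> / 2) \<le> cos (pi / (2 * real p))"
      unfolding pp using assms False p_pos by (intro cos_monotone_0_pi_le) auto
    then show ?thesis by (simp add: cos_diff)
  qed
  then have "2 + cos (\<theta> / 2) < W \<delta>" using small by (simp add: W_def)
  moreover have "0 \<le> 2 + cos (\<theta> / 2)" using cos_ge_minus_one[of "\<theta> / 2"] by linarith
  moreover have "\<bar>W \<theta>\<bar> \<le> 2 + cos (\<theta> / 2)"
    using mult_left_le[of "\<bar>cos (real p * \<theta> / 2)\<bar>" "2 + cos (\<theta> / 2)"] calculation(2)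
    by (simp add: W_def abs_mult)
  ultimately show ?thesis by simp
qed

lemma W_small:
  assumes "\<delta> < \<theta>" "\<theta> < 4 * pi - \<delta>" shows "\<bar>W \<theta>\<bar> < W \<delta>"
  using W_small_first[of \<theta>] W_small_middle[of \<theta>] W_small_first[of "4 * pi - \<theta>"] assms
  by (cases "\<theta> \<le> pi / p"; cases "\<theta> \<le> 4 * pi - pi / p") (auto simp: W_reflect)

lemma radius_inside: "\<delta> < \<theta> \<Longrightarrow> \<theta> < 4 * pi - \<delta> \<Longrightarrow> 0 < radius \<theta> \<and> radius \<theta> < 1"
  using W_small[of \<theta>] W_delta(1) by (auto simp: radius_def abs_less_iff field_simps)

lemma radius_ends: "radius \<delta> = 1" "radius (4 * pi - \<delta>) = 1"
  using W_delta(1) by (auto simp: radius_def W_reflect)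

lemma radius_pos: "\<delta> \<le> \<theta> \<Longrightarrow> \<theta> \<le> 4 * pi - \<delta> \<Longrightarrow> 0 < radius \<theta>"
  using radius_inside[of \<theta>] radius_ends by (cases "\<theta> = \<delta> \<or> \<theta> = 4 * pi - \<delta>") auto

lemma angle_range:
  assumes "0 \<le> t" "t \<le> 1" shows "\<delta> \<le> angle t" "angle t \<le> 4 * pi - \<delta>"
proof -
  have "(4 * pi - 2 * \<delta>) * t \<le> (4 * pi - 2 * \<delta>) * 1" using assms len by (intro mult_left_mono) auto
  then show "angle t \<le> 4 * pi - \<delta>" by (simp add: angle_def)
  show "\<delta> \<le> angle t" using assms len by (simp add: angle_def)
qed

lemma angle_less: "angle s < angle t \<longleftrightarrow> s < t" "angle s = angle t \<longleftrightarrow> s = t"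
  and angle_ends: "angle 0 = \<delta>" "angle 1 = 4 * pi - \<delta>"
  using len by (auto simp: angle_def)

lemma angle_passage: "angle (snd (passage n)) = \<Theta> n"
  using len by (simp add: passage_def angle_def)

lemma curve_derivative:
  assumes "0 \<le> t" "t \<le> 1"
  shows "(curve has_vector_derivative
    (4 * pi - 2 * \<delta>) *\<^sub>R Complex (W' (angle t) / (2 * W \<delta>) / radius (angle t)) 1 * curve t) (at t)"
proof -
  have a: "(angle has_real_derivative 4 * pi - 2 * \<delta>) (at t)"
    unfolding angle_def[abs_def] by (auto intro!: derivative_eq_intros)
  have "(radius has_real_derivative W' \<theta> / (2 * W \<delta>)) (at \<theta>)" for \<theta>
    unfolding radius_def[abs_def] using W_delta(1)
    by (auto intro!: derivative_eq_intros W_derivative simp: field_simps)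
  from DERIV_chain2[OF this a]
  have "((\<lambda>t. ln (radius (angle t))) has_real_derivative
      inverse (radius (angle t)) * (W' (angle t) / (2 * W \<delta>) * (4 * pi - 2 * \<delta>))) (at t)"
    using radius_pos angle_range[OF assms] by (intro DERIV_chain2[OF DERIV_ln]) auto
  from polar_derivative[OF this a] show ?thesis
    unfolding curve_def by (simp add: field_simps scaleR_conv_of_real Complex_eq)
qed

lemma velocity_T:
  assumes "0 \<le> t" "t \<le> 1"
  shows "velocity T (0, t) =
    (4 * pi - 2 * \<delta>) *\<^sub>R Complex (W' (angle t) / (2 * W \<delta>) / radius (angle t)) 1 * curve t"
  using vector_derivative_at[OF curve_derivative[OF assms]] by (simp add: velocity_def T_def)

lemma pt_T: "pt T a = curve (snd a)"
  by (simp add: pt_def T_def)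

lemma cos_Theta: "cos (real p * \<Theta> n / 2) = 0"
proof -
  have "real p * \<Theta> n / 2 = real n * pi + pi / 2" using p_pos by (simp add: \<Theta>_def field_simps)
  moreover have "cos (real n * pi + pi / 2) = 0" by (simp add: cos_add)
  ultimately show ?thesis by (simp only:)
qed

lemma curve_meets:
  assumes st: "s \<in> {0..1}" "t \<in> {0..1}" "s < t"
  shows "curve s = curve t \<longleftrightarrow> (\<exists>n<p. angle s = \<Theta> n \<and> angle t = \<Theta> (n + p))"
proof -
  let ?s = "angle s" and ?t = "angle t"
  have range: "\<delta> \<le> ?s" "?s < ?t" "?t \<le> 4 * pi - \<delta>" using angle_range st angle_less by auto
  have pos: "0 < radius ?s" "0 < radius ?t" using radius_pos range by auto
  have "curve s = curve t \<longleftrightarrow> radius ?s = radius ?t \<and> ?t = ?s + 2 * pi"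
  proof
    assume eq: "curve s = curve t"
    \<comment> \<open>Less than two full turns are available, so equal points are one full turn apart.\<close>
    then obtain n :: int where n: "Complex (ln (radius ?t)) ?t = Complex (ln (radius ?s)) ?s + (of_int (2 * n) * pi) * \<i>"
      unfolding curve_def by (metis exp_eq)
    then have "ln (radius ?t) = ln (radius ?s)" "?t = ?s + 2 * of_int n * pi" by (auto simp: complex_eq_iff)
    moreover from this(2) have "0 < of_int n * pi" "of_int n * pi < 2 * pi" using range delta by linarith+
    then have "0 < n" "n < 2" by (auto simp: zero_less_mult_iff)
    ultimately show "radius ?s = radius ?t \<and> ?t = ?s + 2 * pi" using pos by auto
  next
    assume "radius ?s = radius ?t \<and> ?t = ?s + 2 * pi"
    then have "Complex (ln (radius ?t)) ?t = Complex (ln (radius ?s)) ?s + (of_int (2 * 1) * pi) * \<i>"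
      by (auto simp: complex_eq_iff)
    then show "curve s = curve t" unfolding curve_def by (metis exp_eq)
  qed
  also have "\<dots> \<longleftrightarrow> (\<exists>n<p. ?s = \<Theta> n \<and> ?t = ?s + 2 * pi)"
  proof -
    have "radius ?s = radius ?t \<longleftrightarrow> cos (real p * ?s / 2) = 0" if "?t = ?s + 2 * pi"
      using W_shift[of ?s] W_delta(1) that by (auto simp: radius_def)
    moreover have "cos (real p * ?s / 2) = 0 \<longleftrightarrow> (\<exists>n<p. ?s = \<Theta> n)" if "?t = ?s + 2 * pi"
    proof
      assume "cos (real p * ?s / 2) = 0"
      moreover have "0 \<le> real p * ?s / 2" using range(1) delta by simp
      ultimately obtain n where n: "odd n" "real p * ?s / 2 = real n * (pi / 2)" using cos_zero_lemma by blast
      then obtain l where l: "n = 2 * l + 1" by (auto elim: oddE)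
      have s: "?s = \<Theta> l" using n(2) p_pos by (simp add: l \<Theta>_def field_simps)
      have "?s < 2 * pi" using range that delta by linarith
      then have "(2 * real l + 1) * pi < 2 * real p * pi" unfolding s \<Theta>_def using p_pos by (simp add: field_simps)
      then have "l < p" by simp
      then show "\<exists>n<p. ?s = \<Theta> n" using s by blast
    next
      assume "\<exists>n<p. ?s = \<Theta> n"
      then obtain n where "?s = \<Theta> n" by blast
      then show "cos (real p * ?s / 2) = 0" using cos_Theta by simp
    qed
    ultimately show ?thesis by blast
  qed
  also have "\<dots> \<longleftrightarrow> (\<exists>n<p. ?s = \<Theta> n \<and> ?t = \<Theta> (n + p))"
  proof -
    have "\<Theta> (n + p) = \<Theta> n + 2 * pi" for n using p_pos by (simp add: \<Theta>_def field_simps)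
    then show ?thesis by auto
  qed
  finally show ?thesis .
qed

lemma Theta_less: "\<Theta> n < \<Theta> l \<longleftrightarrow> n < l" and Theta_eq: "\<Theta> n = \<Theta> l \<longleftrightarrow> n = l"
  using p_pos by (auto simp: \<Theta>_def field_simps)

lemma Theta_range: "n < 2 * p \<Longrightarrow> \<delta> < \<Theta> n \<and> \<Theta> n < 4 * pi - \<delta>"
proof -
  assume "n < 2 * p"
  then have "2 * real n + 1 \<le> 4 * real p - 1" by linarith
  then have "\<Theta> n \<le> (4 * real p - 1) * pi / p" unfolding \<Theta>_def by (intro divide_right_mono mult_right_mono) auto
  also have "\<dots> = 4 * pi - pi / p" using p_pos by (simp add: field_simps)
  finally have "\<Theta> n < 4 * pi - \<delta>" using delta by linarith
  moreover have "1 * pi / p \<le> \<Theta> n" unfolding \<Theta>_def by (intro divide_right_mono mult_right_mono) auto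
  ultimately show ?thesis using delta by simp
qed

lemma passage_less: "snd (passage n) < snd (passage l) \<longleftrightarrow> n < l"
  using angle_less(1)[of "snd (passage n)" "snd (passage l)"] by (simp add: angle_passage Theta_less)

lemma passage_range:
  assumes "n < 2 * p" shows "snd (passage n) \<in> {0<..<1}"
proof -
  have "angle 0 < angle (snd (passage n))" "angle (snd (passage n)) < angle 1"
    using Theta_range[OF assms] by (simp_all only: angle_ends angle_passage)
  then show ?thesis unfolding angle_less(1) by simp
qed

lemma passage_inj: "passage n = passage l \<longleftrightarrow> n = l"
  using angle_passage Theta_eq by metis

lemma passage_places: "n < 2 * p \<Longrightarrow> passage n \<in> places 1"
  using passage_range[of n] by (auto simp: places_def passage_def)

lemma passage_unique:
  assumes "a \<in> places 1" "angle (snd a) = \<Theta> n" shows "a = passage n"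
proof (rule prod_eqI)
  show "fst a = fst (passage n)" using assms(1) by (auto simp: places_def passage_def)
  show "snd a = snd (passage n)" using assms(2) angle_less(2) angle_passage[of n] by metis
qed

lemma same_point:
  assumes "a \<in> places 1" "b \<in> places 1"
  shows "a \<noteq> b \<and> pt T a = pt T b \<longleftrightarrow>
    (\<exists>n<p. (a = passage n \<and> b = passage (n + p)) \<or> (b = passage n \<and> a = passage (n + p)))"
proof -
  have less: "snd (passage n) < snd (passage (n + p))" for n
    using p3 by (simp add: passage_less)
  have main: "a \<noteq> b \<and> pt T a = pt T b \<longleftrightarrow>
      (\<exists>n<p. (a = passage n \<and> b = passage (n + p)) \<or> (b = passage n \<and> a = passage (n + p)))"
    if ab: "a \<in> places 1" "b \<in> places 1" "snd a < snd b" for a b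
  proof -
    have range: "snd a \<in> {0..1}" "snd b \<in> {0..1}" "a \<noteq> b" using ab by (auto simp: places_def)
    have "pt T a = pt T b \<longleftrightarrow> (\<exists>n<p. angle (snd a) = \<Theta> n \<and> angle (snd b) = \<Theta> (n + p))"
      unfolding pt_T by (rule curve_meets[OF range(1,2) ab(3)])
    also have "\<dots> \<longleftrightarrow> (\<exists>n<p. a = passage n \<and> b = passage (n + p))"
      using passage_unique[OF ab(1)] passage_unique[OF ab(2)] angle_passage by blast
    also have "\<dots> \<longleftrightarrow> (\<exists>n<p. (a = passage n \<and> b = passage (n + p)) \<or> (b = passage n \<and> a = passage (n + p)))"
    proof -
      have "\<not> (b = passage n \<and> a = passage (n + p))" for n using less[of n] ab(3) by auto
      then show ?thesis by blast
    qed
    finally show ?thesis using range(3) by blast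
  qed
  show ?thesis
  proof (cases "snd a" "snd b" rule: linorder_cases)
    case equal
    then have "a = b" using assms by (auto simp: places_def)
    moreover have "passage n \<noteq> passage (n + p)" for n using less[of n] by auto
    ultimately show ?thesis by auto
  next
    case less
    then show ?thesis by (rule main[OF assms])
  next
    case greater
    then have "b \<noteq> a \<and> pt T b = pt T a \<longleftrightarrow>
        (\<exists>n<p. (b = passage n \<and> a = passage (n + p)) \<or> (a = passage n \<and> b = passage (n + p)))"
      by (rule main[OF assms(2,1)])
    then show ?thesis by (simp only: disj_commute eq_commute[of "pt T b"] eq_commute[of b a])
  qed
qed

lemma meet: "n < p \<Longrightarrow> pt T (passage n) = pt T (passage (n + p))"
  using same_point[of "passage n" "passage (n + p)"] passage_places[of n] passage_places[of "n + p"] by auto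

lemma crossings_T: "crossings 1 T = (\<lambda>n. pt T (passage n)) ` {..<p}"
proof
  show "crossings 1 T \<subseteq> (\<lambda>n. pt T (passage n)) ` {..<p}"
  proof
    fix z assume "z \<in> crossings 1 T"
    then obtain a b where "a \<in> places 1" "b \<in> places 1" "a \<noteq> b" "pt T a = z" "pt T b = z"
      by (auto simp: crossings_def)
    then obtain n where "n < p" "a = passage n \<or> b = passage n" using same_point[of a b] by auto
    then have "z = pt T (passage n)" using \<open>pt T a = z\<close> \<open>pt T b = z\<close> by metis
    then show "z \<in> (\<lambda>n. pt T (passage n)) ` {..<p}" using \<open>n < p\<close> by blast
  qed
  show "(\<lambda>n. pt T (passage n)) ` {..<p} \<subseteq> crossings 1 T"
  proof
    fix z assume "z \<in> (\<lambda>n. pt T (passage n)) ` {..<p}"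
    then obtain n where n: "n < p" "z = pt T (passage n)" by auto
    have "passage n \<noteq> passage (n + p)" using passage_inj[of n "n + p"] p3 by simp
    then show "z \<in> crossings 1 T"
      unfolding crossings_def using n meet[OF n(1)] passage_places[of n] passage_places[of "n + p"] by auto
  qed
qed

lemma preimage:
  assumes "n < p" shows "{a \<in> places 1. pt T a = pt T (passage n)} = {passage n, passage (n + p)}"
proof -
  have "a \<in> {passage n, passage (n + p)}" if "a \<in> places 1" "pt T a = pt T (passage n)" for a
    using same_point[of a "passage n"] that passage_places[of n] assms passage_inj by auto
  then show ?thesis using assms meet[OF assms] passage_places[of n] passage_places[of "n + p"] by auto
qed

lemma velocity_passage:
  assumes "n < 2 * p"
  shows "velocity T (passage n) =
    (4 * pi - 2 * \<delta>) *\<^sub>R Complex (W' (\<Theta> n) / (2 * W \<delta>) / radius (\<Theta> n)) 1 * pt T (passage n)"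
proof -
  have "(0, snd (passage n)) = passage n" by (simp add: passage_def)
  then show ?thesis
    using velocity_T[of "snd (passage n)"] passage_range[OF assms] by (simp add: angle_passage pt_T)
qed

lemma inner_mult_complex: "(Complex a b * z) \<bullet> z = a * (norm z)\<^sup>2"
  unfolding inner_complex_def cmod_power2 by (simp add: algebra_simps power2_eq_square)

lemma properly_immersed_T: "properly_immersed 1 T"
proof -
  have curve: "norm (curve t) = radius (angle t)" "curve t \<noteq> 0" if "0 \<le> t" "t \<le> 1" for t
    using radius_pos angle_range[OF that] by (auto simp: curve_def)
  have "curve C1_differentiable_on {0..1}"
    unfolding C1_differentiable_on_def
  proof (intro exI conjI ballI)
    show "(curve has_vector_derivative
      (4 * pi - 2 * \<delta>) *\<^sub>R Complex (W' (angle t) / (2 * W \<delta>) / radius (angle t)) 1 * curve t) (at t)"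
      if "t \<in> {0..1}" for t using curve_derivative that by simp
    have cont: "continuous_on {0..1} curve"
      using curve_derivative by (meson atLeastAtMost_iff continuous_at_imp_continuous_on has_vector_derivative_continuous)
    have slope: "continuous_on {0..1} (\<lambda>t. W' (angle t) / (2 * W \<delta>) / radius (angle t))"
    proof -
      have nonzero: "radius (angle t) \<noteq> 0" if "t \<in> {0..1}" for t using radius_pos[of "angle t"] angle_range[of t] that by auto
      have num: "continuous_on {0..1} (\<lambda>t. W' (angle t) / (2 * W \<delta>))"
        unfolding W'_def angle_def using W_delta(1) by (intro continuous_intros) auto
      have den: "continuous_on {0..1} (\<lambda>t. radius (angle t))"
      proof -
        have "continuous_on UNIV W"
          using W_derivative DERIV_isCont continuous_at_imp_continuous_on by blast
        moreover have "continuous_on {0..1} angle" unfolding angle_def by (intro continuous_intros)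
        ultimately have "continuous_on {0..1} (\<lambda>t. W (angle t))" by (rule continuous_on_compose2) auto
        then show ?thesis unfolding radius_def using W_delta(1) by (intro continuous_intros) auto
      qed
      show ?thesis by (rule continuous_on_divide[OF num den]) (use nonzero in blast)
    qed
    show "continuous_on {0..1} (\<lambda>t. (4 * pi - 2 * \<delta>) *\<^sub>R
        Complex (W' (angle t) / (2 * W \<delta>) / radius (angle t)) 1 * curve t)"
      unfolding Complex_eq
      by (intro continuous_on_scaleR continuous_on_mult continuous_on_add continuous_on_of_real
          continuous_on_const slope cont)
  qed
  moreover have "velocity T a \<noteq> 0 \<and> pt T a \<in> disk \<and> (pt T a \<in> bdisk \<longleftrightarrow> a \<in> ends 1)" if a: "a \<in> places 1" for a
  proof -
    obtain t where t: "a = (0, t)" "0 \<le> t" "t \<le> 1" using a by (auto simp: places_def)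
    have "Complex y 1 \<noteq> 0" for y by (simp add: complex_eq_iff)
    then have "velocity T a \<noteq> 0"
      unfolding t(1) velocity_T[OF t(2,3)] using curve(2)[OF t(2,3)] len by simp
    moreover have "radius (angle t) = 1" if "t = 0 \<or> t = 1" using that radius_ends by (auto simp: angle_ends)
    moreover have "radius (angle t) < 1" if "t \<noteq> 0" "t \<noteq> 1"
      using radius_inside[of "angle t"] angle_less(1)[of 0 t] angle_less(1)[of t 1] that t(2,3)
      by (auto simp: angle_ends)
    ultimately show ?thesis using curve(1)[OF t(2,3)] by (cases "t = 0 \<or> t = 1") (auto simp: t(1) pt_T ends_def)
  qed
  moreover have "velocity T a \<bullet> pt T a \<noteq> 0" if "a \<in> ends 1" for a
  proof -
    obtain t where t: "a = (0, t)" "t = 0 \<or> t = 1" using \<open>a \<in> ends 1\<close> by (auto simp: ends_def)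
    then have "W' (angle t) \<noteq> 0" "radius (angle t) = 1"
      using W_delta(2) radius_ends W_reflect(2)[of \<delta>] by (auto simp: angle_ends)
    moreover have "velocity T a = (4 * pi - 2 * \<delta>) *\<^sub>R (Complex (W' (angle t) / (2 * W \<delta>) / radius (angle t)) 1 * curve t)"
      using velocity_T[of t] t by auto
    ultimately show ?thesis
      using W_delta(1) len curve(2)[of t] t by (auto simp: inner_mult_complex pt_T)
  qed
  ultimately show ?thesis by (simp add: properly_immersed_def) (simp add: T_def)
qed

lemma transverse_T: "transverse_double_points 1 T"
proof -
  have transverse: "\<not> collinear {0, velocity T (passage n), velocity T (passage (n + p))}" if n: "n < p" for n
  proof
    assume col: "collinear {0, velocity T (passage n), velocity T (passage (n + p))}"
    define R where "R = radius (\<Theta> n)"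
    define z where "z = pt T (passage n)"
    have z: "z = pt T (passage (n + p))" using meet[OF n] by (simp add: z_def)
    have pos: "0 < R" "0 < radius (\<Theta> (n + p))"
      using Theta_range[of n] Theta_range[of "n + p"] n radius_pos by (auto simp: R_def)
    have "norm z = R" using pos by (simp add: z_def pt_T curve_def angle_passage R_def)
    moreover have "norm z = radius (\<Theta> (n + p))" using pos by (simp add: z pt_T curve_def angle_passage)
    ultimately have R: "radius (\<Theta> (n + p)) = R" by simp
    define x where "x \<theta> = W' \<theta> / (2 * W \<delta>) / R" for \<theta>
    have vel: "velocity T (passage n) = (4 * pi - 2 * \<delta>) *\<^sub>R Complex (x (\<Theta> n)) 1 * z"
        "velocity T (passage (n + p)) = (4 * pi - 2 * \<delta>) *\<^sub>R Complex (x (\<Theta> (n + p))) 1 * z"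
      using velocity_passage[of n] velocity_passage[of "n + p"] n
      unfolding R R_def[symmetric] z[symmetric] z_def[symmetric] x_def by auto
    have "z \<noteq> 0" using \<open>norm z = R\<close> pos by auto
    then have cancel: "(L *\<^sub>R c * z) / (L *\<^sub>R c' * z) = c / c'" if "L \<noteq> 0" for L c c'
      using that by (simp add: scaleR_conv_of_real)
    have "velocity T (passage n) / velocity T (passage (n + p)) =
        Complex (x (\<Theta> n)) 1 / Complex (x (\<Theta> (n + p))) 1"
      unfolding vel by (rule cancel) (use len in simp)
    moreover have "velocity T (passage n) / velocity T (passage (n + p)) \<in> \<real>"
      using col unfolding collinear_iff_Reals[symmetric] by (simp only: insert_commute)
    ultimately have "Im (Complex (x (\<Theta> n)) 1 / Complex (x (\<Theta> (n + p))) 1) = 0"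
      by (simp only: complex_is_Real_iff)
    then have "x (\<Theta> (n + p)) = x (\<Theta> n)"
      by (simp add: Im_divide power2_eq_square add_nonneg_eq_0_iff)
    then have eq: "W' (\<Theta> (n + p)) = W' (\<Theta> n)" using pos W_delta(1) by (simp add: x_def)
    have "sin (real p * \<Theta> n / 2) \<noteq> 0" using sin_zero_abs_cos_one cos_Theta[of n] by force
    moreover have "\<Theta> (n + p) = \<Theta> n + 2 * pi" using p_pos by (simp add: \<Theta>_def field_simps)
    ultimately show False using W'_shift[of "\<Theta> n"] eq p_pos by simp
  qed
  have "\<not> collinear {0, velocity T a, velocity T b}"
    if "a \<in> places 1" "b \<in> places 1" "a \<noteq> b" "pt T a = pt T b" for a b
    using same_point[OF that(1,2)] that(3,4) transverse by (auto simp: insert_commute)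
  moreover have "card {a \<in> places 1. pt T a = z} = 2" if z: "z \<in> crossings 1 T" for z
  proof -
    obtain n where n: "n < p" "z = pt T (passage n)" using z unfolding crossings_T by blast
    have "passage n \<noteq> passage (n + p)" using passage_inj[of n "n + p"] p3 by simp
    then show ?thesis unfolding n(2) preimage[OF n(1)] by simp
  qed
  moreover have "crossings 1 T \<inter> bdisk = {}"
  proof -
    have "pt T (passage n) \<notin> bdisk" if "n < p" for n
      using properly_immersed_T passage_places[of n] passage_range[of n] that
      by (auto simp: properly_immersed_def ends_def)
    then show ?thesis unfolding crossings_T by blast
  qed
  moreover have "finite (crossings 1 T)" unfolding crossings_T by simp
  ultimately show ?thesis unfolding transverse_double_points_def by (intro conjI ballI impI) blast+
qed

lemma under_T: "under_places T = passage ` {n. odd n \<and> n < 2 * p - 1}"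
  and virtuals_T: "virtuals T = {pt T (passage (p - 1))}"
  by (simp_all add: T_def pt_def)

lemma passage_under: "passage n \<in> under_places T \<longleftrightarrow> odd n \<and> n < 2 * p - 1"
  by (auto simp: under_T passage_inj)

lemma same_crossing:
  assumes "n < p" "l < p" shows "pt T (passage n) = pt T (passage l) \<longleftrightarrow> n = l"
proof
  assume "pt T (passage n) = pt T (passage l)"
  then have "passage n \<in> {passage l, passage (l + p)}" using preimage[OF assms(2)] passage_places[of n] assms by auto
  then show "n = l" using assms by (auto simp: passage_inj)
qed simp

lemma crossing_information_T: "crossing_information 1 T"
  unfolding crossing_information_def
proof (intro conjI ballI impI)
  show "virtuals T \<subseteq> crossings 1 T" unfolding virtuals_T crossings_T using p3 by auto
  have n_cases: "\<exists>l<p. pt T (passage n) = pt T (passage l) \<and> (n = l \<or> n = l + p)" if "n < 2 * p" for n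
  proof (cases "n < p")
    case False
    then show ?thesis using meet[of "n - p"] that by (intro exI[of _ "n - p"]) auto
  qed auto
  show "under_places T \<subseteq> {a \<in> places 1. pt T a \<in> crossings 1 T - virtuals T}"
  proof
    fix a assume "a \<in> under_places T"
    then obtain n where n: "odd n" "n < 2 * p - 1" "a = passage n" by (auto simp: under_T)
    then have "n < 2 * p" by simp
    then obtain l where l: "l < p" "pt T a = pt T (passage l)" "n = l \<or> n = l + p"
      using n_cases[of n] n(3) by blast
    have "l \<noteq> p - 1" using n(1,2) l(3) odd p3 by auto
    then show "a \<in> {a \<in> places 1. pt T a \<in> crossings 1 T - virtuals T}"
      unfolding crossings_T virtuals_T
      using n l passage_places[of n] same_crossing[of l "p - 1"] p3 by auto
  qed
  fix a b assume ab: "a \<in> places 1" "b \<in> places 1" "a \<noteq> b \<and> pt T a = pt T b \<and> pt T a \<notin> virtuals T"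
  then obtain n where n: "n < p" "(a = passage n \<and> b = passage (n + p)) \<or> (b = passage n \<and> a = passage (n + p))"
    using same_point[OF ab(1,2)] by auto
  then have "n \<noteq> p - 1" using ab(3) by (auto simp: virtuals_T)
  then have "passage n \<in> under_places T \<longleftrightarrow> passage (n + p) \<notin> under_places T"
    using n(1) odd by (auto simp: passage_under)
  then show "a \<in> under_places T \<longleftrightarrow> b \<notin> under_places T" using n(2) by auto
qed

lemma tangle_T: "virtual_tangle 1 T"
  unfolding virtual_tangle_def by (intro conjI properly_immersed_T transverse_T crossing_information_T)

definition under_time :: "nat \<Rightarrow> real" where "under_time l = snd (passage (2 * l + 1))"

text \<open>
  The number of under-passages before the time \<open>t\<close>, which is the number of the arc, counted from \<open>0\<close>.
\<close>

definition arc_index :: "real \<Rightarrow> nat" where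
  "arc_index t = card {l. l < p - 1 \<and> under_time l < t}"

lemma under_time_less: "under_time l < snd (passage n) \<longleftrightarrow> 2 * l + 1 < n"
    "snd (passage n) < under_time l \<longleftrightarrow> n < 2 * l + 1"
  unfolding under_time_def by (rule passage_less)+

lemma under_time: "l < p - 1 \<Longrightarrow> (0, under_time l) \<in> under_places T"
  using passage_under[of "2 * l + 1"] by (simp add: under_time_def passage_def)

lemma arc_index_passage:
  assumes "j \<le> p - 1" shows "arc_index (snd (passage (2 * j))) = j"
proof -
  have "2 * l + 1 < 2 * j \<longleftrightarrow> l < j" for l by linarith
  then have "arc_index (snd (passage (2 * j))) = card {l. l < p - 1 \<and> l < j}"
    unfolding arc_index_def under_time_less by simp
  also have "{l. l < p - 1 \<and> l < j} = {..<j}" using assms by auto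
  finally show ?thesis by simp
qed

text \<open>
  At the under-passage \<open>2 k + 1\<close> the over-passage is even, say \<open>2 j\<close>, and lies on the arc \<open>j\<close>. As it is
  \<open>p\<close> passages away, \<open>2 j\<close> and \<open>k + (k + 1)\<close> agree modulo \<open>p\<close>, and this is the crossing relation for an
  arithmetic progression.
\<close>

lemma place_coloring_T: "place_coloring (int p) 1 T (\<lambda>a. c + d * int (arc_index (snd a)))"
  unfolding place_coloring_def
proof (intro conjI allI impI)
  fix i s t assume i: "i < (1::nat)" and st: "0 \<le> s \<and> s \<le> t \<and> t \<le> 1 \<and> ({i} \<times> {s..t}) \<inter> under_places T = {}"
  have "under_time l < s \<longleftrightarrow> under_time l < t" if "l < p - 1" for l
  proof -
    have "under_time l \<notin> {s..t}" using under_time[OF that] st i by blast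
    then show ?thesis using st by auto
  qed
  then have "{l. l < p - 1 \<and> under_time l < s} = {l. l < p - 1 \<and> under_time l < t}" by blast
  then show "c + d * int (arc_index (snd (i, s))) = c + d * int (arc_index (snd (i, t)))"
    by (simp add: arc_index_def)
next
  fix i u b s t
  assume h: "(i, u) \<in> under_places T \<and> b \<in> places 1 \<and> b \<noteq> (i, u) \<and> pt T b = pt T (i, u) \<and> 0 \<le> s \<and> s < u \<and>
      u < t \<and> t \<le> 1 \<and> {i} \<times> {s..t} \<inter> under_places T = {(i, u)}"
  then obtain n where n: "odd n" "n < 2 * p - 1" "(i, u) = passage n" unfolding under_T by blast
  then obtain k where k: "n = 2 * k + 1" by (auto elim: oddE)
  have i: "i = 0" and u: "u = under_time k" using n(3) by (auto simp: passage_def under_time_def k)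
  have kp: "k < p - 1" using n(2) k by simp
  have order: "under_time l < u \<longleftrightarrow> l < k" "u < under_time l \<longleftrightarrow> k < l" for l
    unfolding u under_time_def passage_less by linarith+
  have only: "l = k" if "l < p - 1" "under_time l \<in> {s..t}" for l
  proof -
    have "(i, under_time l) \<in> {i} \<times> {s..t} \<inter> under_places T" using under_time[OF that(1)] that(2) i by blast
    then have "under_time l = u" using h by blast
    then show ?thesis using order[of l] by auto
  qed
  have st: "s < u" "u < t" using h by auto
  have "under_time l < s \<longleftrightarrow> l < k" if "l < p - 1" for l
    using only[OF that] order[of l] st by (cases l k rule: linorder_cases) force+
  then have "{l. l < p - 1 \<and> under_time l < s} = {..<k}" using kp by auto
  then have s: "arc_index s = k" by (simp add: arc_index_def)
  have "under_time l < t \<longleftrightarrow> l \<le> k" if "l < p - 1" for l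
    using only[OF that] order[of l] st by (cases l k rule: linorder_cases) force+
  then have "{l. l < p - 1 \<and> under_time l < t} = {..k}" using kp by auto
  then have t: "arc_index t = Suc k" by (simp add: arc_index_def)
  obtain j where j: "j \<le> p - 1" "b = passage (2 * j)" "2 * j = n + p \<or> n = 2 * j + p"
  proof -
    have "b \<in> places 1" "passage n \<in> places 1" "b \<noteq> passage n \<and> pt T b = pt T (passage n)"
      using h n passage_places[of n] by auto
    then obtain l where l: "l < p" "(b = passage l \<and> n = l + p) \<or> (n = l \<and> b = passage (l + p))"
      using same_point[of b "passage n"] by (auto simp: passage_inj)
    then show ?thesis
    proof (elim disjE conjE)
      assume "b = passage l" "n = l + p"
      moreover from this obtain j where "l = 2 * j" using n(1) odd by (auto elim: evenE)
      ultimately show ?thesis using that[of j] l(1) by auto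
    next
      assume "n = l" "b = passage (l + p)"
      moreover from this obtain j where "l + p = 2 * j" using n(1) odd by (metis evenE odd_even_add)
      ultimately show ?thesis using that[of j] l(1) by auto
    qed
  qed
  have "arc_index (snd b) = j" using arc_index_passage j by simp
  moreover have "2 * int k + 1 - 2 * int j = int p \<or> 2 * int k + 1 - 2 * int j = - int p"
    using j(3) k by linarith
  then have "int p dvd d * (2 * int k + 1 - 2 * int j)" by (intro dvd_mult) auto
  ultimately show "[c + d * int (arc_index (snd (i, s))) + (c + d * int (arc_index (snd (i, t)))) =
      2 * (c + d * int (arc_index (snd b)))] (mod int p)"
    by (simp add: s t cong_iff_dvd_diff algebra_simps)
qed

lemma colored_T:
  assumes a: "a \<in> {0..<int p}" and b: "b \<in> {0..<int p}"
  shows "\<exists>C. colored_diagram (int p) 1 T C \<and> boundary_colors 1 T C [a, b]"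
proof -
  define \<kappa> where "\<kappa> x = a + (a - b) * int (arc_index (snd x))" for x :: "nat \<times> real"
  have "place_coloring (int p) 1 T \<kappa>" using place_coloring_T by (simp add: \<kappa>_def[abs_def])
  then obtain C where C: "coloring (int p) 1 T C" "\<And>a x. x \<in> arcs 1 T \<Longrightarrow> a \<in> x \<Longrightarrow> C x = \<kappa> a mod int p"
    using coloring_from_places p_pos by (metis of_nat_0_less_iff)
  have "0 < under_time l \<and> under_time l < 1" if "l < p - 1" for l
    using passage_range[of "2 * l + 1"] that by (simp add: under_time_def)
  then have "{l. l < p - 1 \<and> under_time l < 0} = {}" "{l. l < p - 1 \<and> under_time l < 1} = {..<p - 1}"
    by force+
  then have index: "arc_index 0 = 0" "arc_index 1 = p - 1" by (simp_all add: arc_index_def)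
  define e where "e j = (0 :: nat, real j)" for j :: nat
  define \<theta> where "\<theta> j = (if j = 0 then \<delta> else 2 * pi - \<delta>)" for j :: nat
  have at_end: "\<exists>x\<in>arcs 1 T. e j \<in> x \<and> C x = [a, b] ! j" if "j = 0 \<or> j = 1" for j
  proof -
    have place: "e j \<in> places 1" using that by (auto simp: e_def places_def)
    have "e j \<notin> under_places T"
    proof
      assume "e j \<in> under_places T"
      then obtain n where n: "n < 2 * p - 1" "e j = passage n" unfolding under_T by blast
      then have "snd (e j) \<in> {0<..<1}" using passage_range[of n] by simp
      then show False using that by (auto simp: e_def)
    qed
    then obtain x where x: "x \<in> arcs 1 T" "e j \<in> x" using arc_through_place[OF place] by blast
    have "a + (a - b) * (int p - 1) = b + (a - b) * int p" by (simp add: algebra_simps)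
    then have "\<kappa> (e j) mod int p = [a, b] ! j"
      using that a b index p3 by (auto simp: \<kappa>_def e_def of_nat_diff)
    then show ?thesis using C(2)[OF x] x by auto
  qed
  have "boundary_colors 1 T C [a, b]"
    unfolding boundary_colors_def
  proof (intro conjI exI[of _ e] exI[of _ \<theta>] allI impI)
    show "bij_betw e {..<2 * 1} (ends 1)"
      by (rule bij_betwI[of _ _ _ "\<lambda>x. if snd x = 0 then 0 else 1"]) (auto simp: e_def ends_def less_2_cases_iff)
    show "strict_mono_on {..<2 * 1} \<theta>"
      using delta_pi by (auto simp: strict_mono_on_def \<theta>_def less_2_cases_iff)
    fix j :: nat assume "j < 2 * 1"
    then have j: "j = 0 \<or> j = 1" by auto
    show "\<theta> j < \<theta> 0 + 2 * pi" using j delta by (auto simp: \<theta>_def)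
    show "pt T (e j) = cis (\<theta> j)"
    proof (cases "j = 0")
      case True
      then show ?thesis by (simp add: pt_T e_def \<theta>_def curve_def angle_ends radius_ends exp_eq_polar)
    next
      case False
      then have "pt T (e j) = cis (4 * pi - \<delta>)" using j
        by (simp add: pt_T e_def curve_def angle_ends radius_ends exp_eq_polar)
      also have "\<dots> = cis (2 * pi - \<delta> + 2 * pi)" by (simp add: algebra_simps)
      also have "cis (x + 2 * pi) = cis x" for x by (simp add: complex_eq_iff)
      also have "cis (2 * pi - \<delta>) = cis (\<theta> j)" using False by (simp add: \<theta>_def)
      finally show ?thesis .
    qed
    show "\<exists>x\<in>arcs 1 T. e j \<in> x \<and> C x = [a, b] ! j" by (rule at_end[OF j])
  qed simp
  then show ?thesis using C(1) tangle_T by (auto simp: colored_diagram_def)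
qed

end

lemma spiral_exists:
  assumes "odd p" "p \<ge> 3"
  obtains \<delta> where "spiral p \<delta>"
proof -
  have p: "0 < pi / p" using assms by simp
  have "((\<lambda>\<delta>. (2 + cos (\<delta> / 2)) * cos (real p * \<delta> / 2)) \<longlongrightarrow> (2 + cos (0 / 2)) * cos (real p * 0 / 2)) (at_right 0)"
    by (intro tendsto_intros) auto
  moreover have "cos (pi / (2 * real p)) < cos 0"
    using assms by (intro cos_monotone_0_pi) (auto simp: field_simps)
  then have "2 + cos (pi / (2 * real p)) < (2 + cos (0 / 2)) * cos (real p * 0 / 2)" by simp
  ultimately have "eventually (\<lambda>\<delta>. 2 + cos (pi / (2 * real p)) < (2 + cos (\<delta> / 2)) * cos (real p * \<delta> / 2)) (at_right 0)"
    by (rule order_tendstoD)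
  moreover have "eventually (\<lambda>\<delta>. \<delta> \<in> {0<..<pi / p}) (at_right 0)" using p by (rule eventually_at_right_real)
  ultimately have "eventually (spiral p) (at_right 0)"
    by eventually_elim (use assms in \<open>auto simp: spiral_def\<close>)
  then show ?thesis using that eventually_happens' trivial_limit_at_right_real by blast
qed

section \<open>Every color vector is a boundary\<close>

theorem corollary1p3:
  fixes p :: int and m :: nat and v :: "int list"
  assumes "p \<ge> 3" and "odd p" and "m \<ge> 1"
    and "length v = 2 * m" and "set v \<subseteq> {0..<p}"
  shows "(\<exists>T C. colored_diagram p m T C \<and> boundary_colors m T C v) \<and>
    (m = 1 \<longrightarrow> (\<exists>T C. colored_diagram p m T C \<and> boundary_colors m T C v \<and> P2 T)) \<and>
    (m \<ge> 2 \<longrightarrow> (\<exists>T C. colored_diagram p m T C \<and> boundary_colors m T C v \<and> P2 T \<and> P3 m T))"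
proof -
  have one: "\<exists>T C. colored_diagram p m T C \<and> boundary_colors m T C v \<and> P2 T" if "m = 1"
  proof -
    obtain a b where v: "v = [a, b]" using assms(4) \<open>m = 1\<close> by (auto simp: length_Suc_conv numeral_2_eq_2)
    have p: "int (nat p) = p" using assms(1) by simp
    then have "odd (nat p)" "nat p \<ge> 3" using assms(1,2) by (auto simp: even_nat_iff)
    then obtain \<delta> where "spiral (nat p) \<delta>" using spiral_exists by blast
    then interpret spiral "nat p" \<delta> .
    have "\<exists>C. colored_diagram p 1 T C \<and> boundary_colors 1 T C [a, b]"
      using colored_T[of a b] assms(5) by (simp add: v p)
    moreover have "P2 T" by (simp add: P2_def virtuals_T)
    ultimately show ?thesis using \<open>m = 1\<close> v by blast
  qed
  have more: "\<exists>T C. colored_diagram p m T C \<and> boundary_colors m T C v \<and> P2 T \<and> P3 m T" if "m \<ge> 2"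
  proof -
    have "realizable p m 1 (\<lambda>j. v ! j)" using realizable_one_virtual that assms(1,2) by blast
    moreover have "v ! j \<in> {0..<p}" if "j < 2 * m" for j
      using subsetD[OF assms(5) nth_mem[of j v]] assms(4) that by simp
    moreover have "map (\<lambda>j. v ! j) [0..<2 * m] = v" using map_nth[of v] assms(4) by simp
    ultimately show ?thesis
      using realizable_diagram[of p m 1 "\<lambda>j. v ! j"] assms(1) unfolding P2_def by (metis zero_less_numeral order_less_le_trans)
  qed
  show ?thesis using one more assms(3) by (metis One_nat_def Suc_1 Suc_leI le_neq_implies_less)
qed

end
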